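(* Let $E$ be a compact metric space with Borel $\sigma$-field $\mathcal{A}$, $T:E\to E$ continuous, $\mu$ a $T$-invariant Borel probability measure such that $S=(E,\mathcal{A},\mu,T)$ is uniquely ergodic, $f:E\to[0,1]$ continuous with $\int_Ef\,d\mu=\frac12$ and $a=\int_E4f(1-f)\,d\mu>0$, $x\in E$, and $J>0$. Assume that $\Lambda(u)=\int_E\log\big(f(y)e^u+(1-f(y))e^{-u}\big)\,d\mu(y)$ is even and that $\Lambda'$ is concave on $(0,+\infty)$. Let $G_\beta$, $\beta_c$, $\mathbb{Q}_{n,x}$, $M_n$, $L$, $\mathcal{C}_\alpha(S)$ be as in the context. 1. Let $\beta=\beta_c$, and let $2k\ge4$ and $\lambda$ be the type and the strength of $0$, the unique global minimum point of $G_{\beta_c}$. Assume that for every $j\in\{1,\dots,2k\}$ the function $f^j$ belongs to $\mathcal{C}_{j/(2k)}(S)$. Then, under $\mathbb{Q}_{n,x}$, as $n\to\infty$, $$\frac{M_n}{n}\Rightarrow\delta_0\qquad\text{and}\qquad\frac{M_n}{n^{1-1/(2k)}}\Rightarrow Z,$$ where $Z$ is the probability measure on $\mathbb{R}$ with density $C\exp\big(-\lambda s^{2k}/(2k)!\big)$, $C$ being the normalizing constant. 2. Let $\beta>\beta_c$, and let $\pm m$ ($m>0$) be the two global minimum points of $G_\beta$. Assume that the two functions $y\mapsto\frac{\partial L}{\partial s}(f(y),\pm\beta Jm)$ belong to $\mathcal{C}_{1/2}(S)$. Then, for every bounded continuous function $h:\mathbb{R}\to\mathbb{R}$, the expectation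 of $h(M_n/n)$ under $\mathbb{Q}_{n,x}$ is equivalent, as $n$ goes to infinity, to $$\frac{b_{m,n}\,h(m)+b_{-m,n}\,h(-m)}{b_{m,n}+b_{-m,n}},$$ where $$b_{\pm m,n}=\prod_{j=1}^n\Big(f(T^jx)\,e^{\pm\beta Jm}+(1-f(T^jx))\,e^{\mp\beta Jm}\Big).$$
   Context: Uniquely ergodic: $\mu$ is the only $T$-invariant Borel probability measure on $E$. $\Rightarrow$ denotes convergence in distribution. Gibbs measure: for $n\ge1$, $\mathbb{Q}_{n,x}$ (depending on $\beta,J,f$) is the probability measure on $\{-1,+1\}^n$ giving $\sigma=(\sigma_1,\dots,\sigma_n)$ a mass proportional to $$\exp\Big(\frac{\beta J}{2n}\Big(\sum_{i=1}^n\sigma_i\Big)^2\Big)\prod_{i=1}^n p_i(\sigma_i),\qquad p_i(1)=f(T^ix),\ p_i(-1)=1-f(T^ix).$$ When $f$ takes values in $(0,1)$ this is the measure proportional to $\exp[H_{n,x}(\sigma)]$ with $H_{n,x}(\sigma)=\frac{\beta J}{2n}(\sum_i\sigma_i)^2+\frac12\sum_{i}\log\big(\frac{f(T^ix)}{1-f(T^ix)}\big)\sigma_i$. The magnetization is $M_n=\sum_{i=1}^n\sigma_i$. Functions: $L(\phi,s)=\log(\phi e^s+(1-\phi)e^{-s})$ on $[0,1]\times\mathbb{R}$, with $\frac{\partial L}{\partial s}$ the partial derivative in the second variable; $G_\beta(s)=\frac{\beta J}{2}s^2-\Lambda(\beta Js)$; $\beta_c=\sup\{\beta>0: G_\beta(s)\ge0\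 \forall s\in\mathbb{R}\}$. Under the stated assumption on $\Lambda$, $\beta_c=1/(Ja)$; $G_{\beta_c}$ has $0$ as unique global minimum point, of type at least $4$; and for $\beta>\beta_c$, $G_\beta$ has exactly two global minimum points $\pm m$, $m>0$, of type $2$ and equal strength. Type and strength: for a global minimum point $m$ of $G_\beta$, the type is $2k=\min\{j\ge1: G_\beta^{(j)}(m)\ne0\}$ and the strength is $G_\beta^{(2k)}(m)>0$. Class $\mathcal{C}_\alpha(S)$, $\alpha\in[0,1]$: the $\mu$-integrable functions $h:E\to\mathbb{R}$ such that for every $y\in E$, $\big|\sum_{k=1}^n\big(h(T^ky)-\int_Eh\,d\mu\big)\big|=o(n^\alpha)$ as $n\to\infty$.
   Formalization: In part 2, "is equivalent to" is stated as: the difference tends to 0 for every bounded continuous h, and the quotient tends to 1 when the reference sequence is eventually bounded away from 0; as a quotient for every h the claim fails (f = 1/2, h vanishing exactly at m and -m). *)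

theory Defs
  imports "HOL-Probability.Probability" "HOL-Library.Landau_Symbols"
begin

section \<open>Unique ergodicity\<close>

definition invariant_prob :: "('a::topological_space \<Rightarrow> 'a) \<Rightarrow> 'a measure \<Rightarrow> bool" where
  "invariant_prob T \<mu> \<longleftrightarrow> prob_space \<mu> \<and> sets \<mu> = sets borel \<and> distr \<mu> borel T = \<mu>"

definition uniquely_ergodic :: "('a::topological_space \<Rightarrow> 'a) \<Rightarrow> 'a measure \<Rightarrow> bool" where
  "uniquely_ergodic T \<mu> \<longleftrightarrow>
     invariant_prob T \<mu> \<and> (\<forall>\<nu>. invariant_prob T \<nu> \<longrightarrow> \<nu> = \<mu>)"

definition class_C :: "('a \<Rightarrow> 'a) \<Rightarrow> 'a measure \<Rightarrow> real \<Rightarrow> ('a \<Rightarrow> real) set" where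
  "class_C T \<mu> \<alpha> =
     {h. integrable \<mu> h \<and>
         (\<forall>y. (\<lambda>n. \<bar>\<Sum>k=1..n. (h ((T ^^ k) y) - (\<integral>z. h z \<partial>\<mu>))\<bar>)
              \<in> o[at_top](\<lambda>n. real n powr \<alpha>))}"

section \<open>The Gibbs measure\<close>

text \<open>Configurations in \<open>{-1,+1}\<^sup>n\<close> are real-valued functions on \<open>{1..n}\<close>, extended by
  \<open>undefined\<close> outside \<open>{1..n}\<close>.\<close>

definition configs :: "nat \<Rightarrow> (nat \<Rightarrow> real) set" where
  "configs n = PiE {1..n} (\<lambda>_. {-1, 1})"

definition magnetization :: "nat \<Rightarrow> (nat \<Rightarrow> real) \<Rightarrow> real" where
  "magnetization n \<sigma> = (\<Sum>i=1..n. \<sigma> i)"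

definition site_prob :: "('a \<Rightarrow> 'a) \<Rightarrow> ('a \<Rightarrow> real) \<Rightarrow> 'a \<Rightarrow> nat \<Rightarrow> real \<Rightarrow> real" where
  "site_prob T f x i s = (if s = 1 then f ((T ^^ i) x) else 1 - f ((T ^^ i) x))"

definition gibbs_weight ::
  "('a \<Rightarrow> 'a) \<Rightarrow> ('a \<Rightarrow> real) \<Rightarrow> real \<Rightarrow> real \<Rightarrow> nat \<Rightarrow> 'a \<Rightarrow> (nat \<Rightarrow> real) \<Rightarrow> real" where
  "gibbs_weight T f J \<beta> n x \<sigma> =
     exp (\<beta> * J / (2 * real n) * (magnetization n \<sigma>)\<^sup>2) * (\<Prod>i=1..n. site_prob T f x i (\<sigma> i))"

definition gibbs ::
  "('a \<Rightarrow> 'a) \<Rightarrow> ('a \<Rightarrow> real) \<Rightarrow> real \<Rightarrow> real \<Rightarrow> nat \<Rightarrow> 'a \<Rightarrow> (nat \<Rightarrow> real) measure" where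
  "gibbs T f J \<beta> n x =
     point_measure (configs n)
       (\<lambda>\<sigma>. ennreal (gibbs_weight T f J \<beta> n x \<sigma> /
                        (\<Sum>\<tau>\<in>configs n. gibbs_weight T f J \<beta> n x \<tau>)))"

section \<open>The functions \<open>L\<close>, \<open>\<Lambda>\<close>, \<open>G\<^sub>\<beta>\<close> and the critical value\<close>

definition L_fun :: "real \<Rightarrow> real \<Rightarrow> real" where
  "L_fun \<phi> s = ln (\<phi> * exp s + (1 - \<phi>) * exp (- s))"

definition dL_ds :: "real \<Rightarrow> real \<Rightarrow> real" where
  "dL_ds \<phi> s = deriv (\<lambda>t. L_fun \<phi> t) s"

definition Lambda :: "'a measure \<Rightarrow> ('a \<Rightarrow> real) \<Rightarrow> real \<Rightarrow> real" where
  "Lambda \<mu> f u = (\<integral>y. L_fun (f y) u \<partial>\<mu>)"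

definition G_fun :: "'a measure \<Rightarrow> ('a \<Rightarrow> real) \<Rightarrow> real \<Rightarrow> real \<Rightarrow> real \<Rightarrow> real" where
  "G_fun \<mu> f J \<beta> s = \<beta> * J / 2 * s\<^sup>2 - Lambda \<mu> f (\<beta> * J * s)"

definition beta_c :: "'a measure \<Rightarrow> ('a \<Rightarrow> real) \<Rightarrow> real \<Rightarrow> real" where
  "beta_c \<mu> f J = Sup {\<beta>. \<beta> > 0 \<and> (\<forall>s. G_fun \<mu> f J \<beta> s \<ge> 0)}"

definition global_min_points :: "(real \<Rightarrow> real) \<Rightarrow> real set" where
  "global_min_points g = {s. \<forall>t. g s \<le> g t}"

text \<open>\<open>has_type_strength g m j l\<close>: \<open>j\<close> is the smallest order \<open>\<ge> 1\<close> of a non-vanishing derivative of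
  \<open>g\<close> at \<open>m\<close>, and \<open>l\<close> is the value of that derivative. At a global minimum point of a smooth
  \<open>g\<close>, \<open>j\<close> is automatically even and \<open>l > 0\<close>.\<close>

definition has_type_strength :: "(real \<Rightarrow> real) \<Rightarrow> real \<Rightarrow> nat \<Rightarrow> real \<Rightarrow> bool" where
  "has_type_strength g m j l \<longleftrightarrow>
     j \<ge> 1 \<and> (deriv ^^ j) g m \<noteq> 0 \<and> (\<forall>i. 1 \<le> i \<and> i < j \<longrightarrow> (deriv ^^ i) g m = 0) \<and>
     l = (deriv ^^ j) g m"

section \<open>Limit laws\<close>

definition limit_Z :: "nat \<Rightarrow> real \<Rightarrow> real measure" where
  "limit_Z k l =
     (let w = (\<lambda>s::real. exp (- l * s ^ (2 * k) / fact (2 * k)));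
          C = 1 / (\<integral>s. w s \<partial>lborel)
      in density lborel (\<lambda>s. ennreal (C * w s)))"

definition b_weight ::
  "('a \<Rightarrow> 'a) \<Rightarrow> ('a \<Rightarrow> real) \<Rightarrow> real \<Rightarrow> real \<Rightarrow> 'a \<Rightarrow> real \<Rightarrow> nat \<Rightarrow> real" where
  "b_weight T f J \<beta> x m n =
     (\<Prod>j=1..n. (f ((T ^^ j) x) * exp (\<beta> * J * m) + (1 - f ((T ^^ j) x)) * exp (- (\<beta> * J * m))))"

text \<open>Asymptotic equivalence of real sequences with values in a bounded set. The plain quotient
  relation would be too strong for such sequences: a reference sequence that vanishes or comes
  arbitrarily close to 0 says nothing about quotients. The first conjunct says that the difference
  tends to 0; the second that the quotient tends to 1 as soon as the reference sequence \<open>v\<close> is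
  bounded away from 0.\<close>

definition equivalent_seq :: "(nat \<Rightarrow> real) \<Rightarrow> (nat \<Rightarrow> real) \<Rightarrow> bool" where
  "equivalent_seq u v \<longleftrightarrow>
     (\<lambda>n. u n - v n) \<longlonglongrightarrow> 0 \<and>
     ((\<exists>c>0. \<forall>\<^sub>F n in sequentially. \<bar>v n\<bar> \<ge> c) \<longrightarrow> u \<sim>[sequentially] v)"

end

theory Submission
  imports Defs
begin

text \<open>The Gaussian (Hubbard--Stratonovich) identity rewrites Gibbs expectations: \<open>M\<^sub>n / n\<close> plus an
  independent centred Gaussian of variance \<open>1 / (n \<beta> J)\<close> has density proportional to
  \<open>exp (- n G\<^sub>n(s))\<close>, where \<open>G\<^sub>n\<close> is \<open>G\<^sub>\<beta>\<close> with \<open>\<Lambda>\<close> replaced by the average of \<open>L(f(T\<^sup>i x), \<cdot>)\<close> over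
  \<open>i = 1, \<dots>, n\<close>. Both claims then follow from Laplace's method. Unique ergodicity gives \<open>G\<^sub>n \<rightarrow> G\<^sub>\<beta>\<close>
  locally uniformly, which disposes of the integral away from the minimum points; near a minimum point
  the class assumptions make all Taylor coefficients of order below the type negligible at the relevant
  scale. Concavity of \<open>\<Lambda>'\<close> yields \<open>\<beta>\<^sub>c = 1 / (J a)\<close>, the uniqueness of the minimum at \<open>\<beta>\<^sub>c\<close> and the
  nondegeneracy of the minima above it.\<close>

section \<open>Orbit averages in uniquely ergodic systems\<close>

text \<open>The smearing Gaussian has width of order n^(-1/2), and both limit theorems are arranged
  so that it stays invisible. At the critical point the natural scale of M_n/n is n^(-1/(2k)), much
  wider than n^(-1/2) because 2k >= 4; above it only the unscaled M_n/n is tested. Test functions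
  therefore get a modulus of the form eps + C (z - y)^2, whose Gaussian average is explicit, and C
  may grow with n as long as it is o(n). The exponents j/(2k) of the class assumptions come from the
  substitution s = t n^(-1/(2k)): it multiplies the Taylor term of order j of n G_n by n^(1 -
  j/(2k)), and the derivative of order j of L at s = 0 is a polynomial of degree at most j in f.
  Above the critical value nothing compares n G_n(m) with n G_n(-m): the assumptions control the
  slopes there, not the values. Each half-line is therefore normalized by its own minimum value, and
  the two weights stay in the answer. Only the Gaussian constants agree, since G''(m) =
  G''(-m).\<close>

lemma ternary_digits_separate:
  fixes b b' :: "nat \<Rightarrow> bool"
  assumes close: "\<bar>(\<Sum>i. of_bool (b i) * (1/3::real) ^ i) - (\<Sum>i. of_bool (b' i) * (1/3) ^ i)\<bar> < (1/3) ^ N / 2"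
    and i: "i \<le> N"
  shows "b i = b' i"
  using i
proof (induction i rule: less_induct)
  case (less i)
  define d where "d j = (of_bool (b j) - of_bool (b' j)) * (1/3::real) ^ j" for j
  have geo: "summable (\<lambda>j. (1/3::real) ^ j)" by (rule summable_geometric) simp
  have smm: "summable (\<lambda>j. of_bool (c j) * (1/3::real) ^ j)" for c :: "nat \<Rightarrow> bool"
    by (rule summable_comparison_test'[OF geo, of 0]) auto
  have dle: "\<bar>d j\<bar> \<le> (1/3) ^ j" for j by (auto simp: d_def)
  have d: "summable d"
    by (rule summable_comparison_test'[OF geo, of 0]) (use dle in auto)
  have eq: "(\<Sum>j. d j) = (\<Sum>i. of_bool (b i) * (1/3) ^ i) - (\<Sum>i. of_bool (b' i) * (1/3) ^ i)"
    using suminf_diff[OF smm smm, of b b'] by (simp add: d_def left_diff_distrib)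
  have geo': "summable (\<lambda>j. (1/3::real) ^ (j + Suc i))" by (rule summable_ignore_initial_segment[OF geo])
  show ?case
  proof (rule ccontr)
    assume ne: "b i \<noteq> b' i"
    have "b j = b' j" if "j < i" for j using less that by auto
    then have "(\<Sum>j<Suc i. d j) = d i" by (simp add: d_def)
    then have "(\<Sum>j. d j) = (\<Sum>j. d (j + Suc i)) + d i"
      using suminf_split_initial_segment[OF d, of "Suc i"] by simp
    moreover have "\<bar>d i\<bar> = (1/3) ^ i" using ne by (auto simp: d_def)
    moreover have "\<bar>\<Sum>j. d (j + Suc i)\<bar> \<le> (\<Sum>j. (1/3) ^ (j + Suc i))"
      using norm_suminf_le[of "\<lambda>j. d (j + Suc i)", OF _ geo'] dle unfolding real_norm_def by blast
    \<comment> \<open>All later digits together weigh half as much as the first disagreement at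
      \<open>i\<close>. In base 2 they could cancel it, which is why the digits 0 and 1 are read in
      base 3.\<close>
    moreover have "(\<Sum>j. (1/3::real) ^ (j + Suc i)) = (1/3) ^ i / 2"
    proof -
      have "(\<Sum>j. (1/3::real) ^ (j + Suc i)) = (\<Sum>j. (1/3) ^ j) * (1/3) ^ Suc i"
        unfolding suminf_mult2[OF geo] power_add ..
      then show ?thesis using suminf_geometric[of "1/3::real"] by simp
    qed
    ultimately have "\<bar>\<Sum>j. d j\<bar> \<ge> (1/3) ^ i / 2" by linarith
    moreover have "(1/3::real) ^ i \<ge> (1/3) ^ N" using less.prems by (intro power_decreasing) auto
    ultimately show False using close eq by linarith
  qed
qed

text \<open>The digits of \<open>e y\<close> in base 3 record which balls of a countable family contain \<open>y\<close>. Such an \<open>e\<close>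
  need not be continuous, but its inverse is, and this turns weak limits of measures on \<open>\<real>\<close>, which
  Helly's theorem provides, into measures on the compact space.\<close>

lemma compact_metric_encoding:
  assumes "compact (UNIV :: 'a set)"
  obtains e :: "'a::metric_space \<Rightarrow> real" where "range e \<subseteq> {0..2}"
    and "\<And>\<epsilon>. \<epsilon> > 0 \<Longrightarrow> \<exists>\<delta>>0. \<forall>y y'. \<bar>e y - e y'\<bar> < \<delta> \<longrightarrow> dist y y' < \<epsilon>"
proof -
  have "\<exists>F. finite F \<and> (UNIV :: 'a set) \<subseteq> (\<Union>q\<in>F. ball q (1 / real (Suc k)))" for k
    using assms unfolding compact_eq_totally_bounded by (auto dest!: spec[of _ "1 / real (Suc k)"])
  then obtain F where F: "\<And>k. finite (F k)" "\<And>k. (UNIV :: 'a set) \<subseteq> (\<Union>q\<in>F k. ball q (1 / real (Suc k)))"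
    by metis
  define P where "P = (\<Union>k. F k \<times> {k})"
  have "countable P" unfolding P_def using F(1) by (auto intro: countable_finite)
  moreover have "P \<noteq> {}" using F(2)[of 0] by (fastforce simp: P_def)
  ultimately have P: "range (from_nat_into P) = P" by (rule range_from_nat_into[rotated])
  define B where "B i y = (dist (fst (from_nat_into P i)) y < 1 / real (Suc (snd (from_nat_into P i))))" for i y
  define e where "e y = (\<Sum>i. of_bool (B i y) * (1/3::real) ^ i)" for y
  have geo: "summable (\<lambda>j. (1/3::real) ^ j)" by (rule summable_geometric) simp
  show thesis
  proof
    have "e y \<in> {0..2}" for y
    proof -
      have s: "summable (\<lambda>i. of_bool (B i y) * (1/3::real) ^ i)"
        by (rule summable_comparison_test'[OF geo, of 0]) auto
      have "e y \<le> (\<Sum>i. (1/3) ^ i)" unfolding e_def by (rule suminf_le[OF _ s geo]) auto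
      also have "\<dots> \<le> 2" using suminf_geometric[of "1/3::real"] by simp
      finally show ?thesis using suminf_nonneg[OF s] by (auto simp: e_def)
    qed
    then show "range e \<subseteq> {0..2}" by auto
    fix \<epsilon> :: real assume "\<epsilon> > 0"
    obtain k where k: "1 / real (Suc k) < \<epsilon> / 2"
      using \<open>\<epsilon> > 0\<close> by (meson half_gt_zero nat_approx_posE)
    have "\<forall>q\<in>F k. \<exists>i. from_nat_into P i = (q, k)"
    proof
      fix q assume "q \<in> F k"
      then have "(q, k) \<in> range (from_nat_into P)" unfolding P by (auto simp: P_def)
      then show "\<exists>i. from_nat_into P i = (q, k)" by (metis imageE)
    qed
    then obtain ix where ix: "\<And>q. q \<in> F k \<Longrightarrow> from_nat_into P (ix q) = (q, k)" by metis
    \<comment> \<open>The finitely many balls of generation \<open>k\<close> occupy positions up to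
      \<open>N\<close>, so codes closer than \<open>(1/3)^N / 2\<close> belong to points lying in
      the same ones.\<close>
    define N where "N = Max (ix ` F k)"
    have N: "ix q \<le> N" if "q \<in> F k" for q using that F(1) by (auto simp: N_def)
    show "\<exists>\<delta>>0. \<forall>y y'. \<bar>e y - e y'\<bar> < \<delta> \<longrightarrow> dist y y' < \<epsilon>"
    proof (intro exI[of _ "(1/3)^N / 2"] conjI allI impI)
      fix y y' assume cl: "\<bar>e y - e y'\<bar> < (1/3)^N / 2"
      obtain q where q: "q \<in> F k" "dist q y < 1 / real (Suc k)" using F(2)[of k] unfolding mem_ball[symmetric] by blast
      have "B (ix q) y = B (ix q) y'"
        by (rule ternary_digits_separate[of "\<lambda>i. B i y" "\<lambda>i. B i y'" N]) (use cl N q in \<open>auto simp: e_def\<close>)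
      then have "dist q y' < 1 / real (Suc k)" using q ix[of q] by (simp add: B_def)
      then show "dist y y' < \<epsilon>" using q k dist_triangle3[of y y' q] by linarith
    qed auto
  qed
qed

text \<open>The hypothesis on \<open>e\<close> says that its inverse is uniformly continuous, so the
  inverse extends to the closure: compactness supplies a limit of preimages along a subsequence, and
  separation makes this limit independent of the subsequence. The closure is the set that a weak
  limit of laws on \<open>range e\<close> can charge.\<close>

lemma continuous_inverse_on_closure:
  fixes e :: "'a::metric_space \<Rightarrow> 'b::metric_space"
  assumes comp: "compact (UNIV :: 'a set)"
    and e: "\<And>\<epsilon>. \<epsilon> > 0 \<Longrightarrow> \<exists>\<delta>>0. \<forall>y y'. dist (e y) (e y') < \<delta> \<longrightarrow> dist y y' < \<epsilon>"
  obtains c where "continuous_on (closure (range e)) c" "\<And>y. c (e y) = y"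
proof -
  have ex: "\<exists>w. \<forall>\<epsilon>>0. \<exists>\<delta>>0. \<forall>y. dist (e y) z < \<delta> \<longrightarrow> dist y w < \<epsilon>" if z: "z \<in> closure (range e)" for z
  proof -
    obtain Y where Y: "(\<lambda>n. e (Y n)) \<longlonglongrightarrow> z"
    proof -
      obtain x where x: "\<And>n. x n \<in> range e" "x \<longlonglongrightarrow> z" using z unfolding closure_sequential by blast
      have "\<forall>n. \<exists>y. x n = e y" using x(1) by blast
      then obtain Y where "\<And>n. x n = e (Y n)" by metis
      then have "x = (\<lambda>n. e (Y n))" by auto
      then show thesis using x(2) that by blast
    qed
    obtain w r where r: "strict_mono r" "(Y \<circ> r) \<longlonglongrightarrow> w"
      using compact_imp_seq_compact[OF comp] by (rule seq_compactE) auto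
    show ?thesis
    proof (intro exI[of _ w] allI impI)
      fix \<epsilon> :: real assume "\<epsilon> > 0"
      then obtain \<delta> where \<delta>: "\<delta> > 0" "\<And>y y'. dist (e y) (e y') < \<delta> \<Longrightarrow> dist y y' < \<epsilon> / 2"
        using e[of "\<epsilon>/2"] by auto
      have Yr: "(\<lambda>n. e (Y (r n))) \<longlonglongrightarrow> z"
        using LIMSEQ_subseq_LIMSEQ[OF Y r(1)] by (simp add: o_def)
      have "dist y w < \<epsilon>" if y: "dist (e y) z < \<delta>" for y
      proof -
        have "(\<lambda>n. dist (e y) (e (Y (r n)))) \<longlonglongrightarrow> dist (e y) z" by (intro tendsto_intros Yr)
        then have "\<forall>\<^sub>F n in sequentially. dist (e y) (e (Y (r n))) < \<delta>" using y by (rule order_tendstoD)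
        then have "\<forall>\<^sub>F n in sequentially. dist y ((Y \<circ> r) n) \<le> \<epsilon> / 2"
          by eventually_elim (use \<delta> less_imp_le in auto)
        then have "dist y w \<le> \<epsilon> / 2"
          by (intro tendsto_upperbound[OF tendsto_dist[OF tendsto_const r(2)]]) auto
        then show ?thesis using \<open>\<epsilon> > 0\<close> by linarith
      qed
      then show "\<exists>\<delta>>0. \<forall>y. dist (e y) z < \<delta> \<longrightarrow> dist y w < \<epsilon>" using \<open>\<delta> > 0\<close> by auto
    qed
  qed
  then obtain c where c: "\<And>z \<epsilon>. z \<in> closure (range e) \<Longrightarrow> \<epsilon> > 0 \<Longrightarrow>
      \<exists>\<delta>>0. \<forall>y. dist (e y) z < \<delta> \<longrightarrow> dist y (c z) < \<epsilon>" by metis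
  show thesis
  proof
    show "c (e y) = y" for y
    proof (rule ccontr)
      assume "c (e y) \<noteq> y"
      then have pos: "dist y (c (e y)) > 0" by auto
      have "e y \<in> closure (range e)" by (rule closure_subset[THEN subsetD]) simp
      from c[OF this pos] obtain \<delta> where
        "\<delta> > 0" "\<And>y'. dist (e y') (e y) < \<delta> \<Longrightarrow> dist y' (c (e y)) < dist y (c (e y))"
        by auto
      from this(1) this(2)[of y] show False by simp
    qed
    show "continuous_on (closure (range e)) c"
      unfolding continuous_on_iff
    proof (intro ballI allI impI)
      fix z \<epsilon> assume z: "z \<in> closure (range e)" and "(\<epsilon>::real) > 0"
      then obtain \<delta> where \<delta>: "\<delta> > 0" "\<And>y. dist (e y) z < \<delta> \<Longrightarrow> dist y (c z) < \<epsilon> / 2"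
        using c[of z "\<epsilon>/2"] by auto
      show "\<exists>d>0. \<forall>z'\<in>closure (range e). dist z' z < d \<longrightarrow> dist (c z') (c z) < \<epsilon>"
      proof (intro exI[of _ "\<delta>/2"] conjI ballI impI)
        fix z' assume z': "z' \<in> closure (range e)" "dist z' z < \<delta>/2"
        obtain \<delta>' where \<delta>': "\<delta>' > 0" "\<And>y. dist (e y) z' < \<delta>' \<Longrightarrow> dist y (c z') < \<epsilon> / 2"
          using c[of z' "\<epsilon>/2"] z' \<open>\<epsilon> > 0\<close> by auto
        have "min \<delta>' (\<delta>/2) > 0" using \<delta> \<delta>' by simp
        then obtain y where y: "dist (e y) z' < min \<delta>' (\<delta>/2)"
          using z' unfolding closure_approachable by blast
        then have "dist (e y) z < \<delta>" using z' dist_triangle[of "e y" z z'] by linarith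
        then show "dist (c z') (c z) < \<epsilon>"
          using \<delta>(2)[of y] \<delta>'(2)[of y] y dist_triangle3[of "c z'" "c z" y] by simp
      qed (use \<delta> in auto)
    qed
  qed
qed

section \<open>From weak limits of orbit laws to the invariant measure\<close>

lemma borel_measure_eqI_continuous:
  fixes M N :: "'a::metric_space measure"
  assumes M: "prob_space M" "sets M = sets borel" and N: "prob_space N" "sets N = sets borel"
    and eq: "\<And>h::'a \<Rightarrow> real. continuous_on UNIV h \<Longrightarrow> bounded (range h) \<Longrightarrow> (\<integral>y. h y \<partial>M) = (\<integral>y. h y \<partial>N)"
  shows "M = N"
proof (rule measure_eqI_generator_eq[of "Collect closed" UNIV M N "\<lambda>_. UNIV"])
  interpret M: prob_space M by fact
  interpret N: prob_space N by fact
  show "Int_stable (Collect (closed :: 'a set \<Rightarrow> bool))" by (auto simp: Int_stable_def)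
  show "sets M = sigma_sets UNIV (Collect closed)" "sets N = sigma_sets UNIV (Collect closed)"
    using M N by (simp_all add: borel_eq_closed)
  fix C :: "'a set" assume "C \<in> Collect closed"
  then have C: "closed C" by simp
  show "emeasure M C = emeasure N C"
  \<comment> \<open>\<open>infdist y {}\<close> is 0, so the functions below would converge to 1
    instead of 0 for an empty \<open>C\<close>.\<close>
  proof (cases "C = {}")
    case False
    \<comment> \<open>Continuous functions decreasing to the indicator of \<open>C\<close>; equality
      of integrals passes to the limit by dominated convergence.\<close>
    define h where "h n y = max 0 (1 - real n * infdist y C)" for n y
    have cont: "continuous_on UNIV (h n)" for n unfolding h_def by (intro continuous_intros)
    have bd: "\<bar>h n y\<bar> \<le> 1" for n y by (auto simp: h_def infdist_nonneg)
    have lim: "(\<lambda>n. h n y) \<longlonglongrightarrow> indicator C y" for y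
    proof (cases "y \<in> C")
      case True then show ?thesis by (simp add: h_def)
    next
      case y: False
      then have pos: "infdist y C > 0"
        using C False by (simp add: infdist_pos_not_in_closed)
      have "\<forall>\<^sub>F n in sequentially. h n y = 0"
        using eventually_ge_at_top[of "nat \<lceil>1 / infdist y C\<rceil>"]
      proof eventually_elim
        case (elim n)
        then have "1 / infdist y C \<le> real n" by linarith
        then show ?case using pos by (simp add: h_def field_simps)
      qed
      then show ?thesis using y by (simp add: tendsto_eventually)
    qed
    have conv: "(\<lambda>n. \<integral>y. h n y \<partial>Q) \<longlonglongrightarrow> measure Q C"
      if Q: "prob_space Q" "sets Q = sets borel" for Q :: "'a measure"
    proof -
      interpret Q: prob_space Q by fact
      have [simp]: "C \<in> sets Q" using Q C by simp
      have "(\<lambda>n. \<integral>y. h n y \<partial>Q) \<longlonglongrightarrow> (\<integral>y. indicator C y \<partial>Q)"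
      proof (rule integral_dominated_convergence[where w = "\<lambda>_. 1"])
        show "h n \<in> borel_measurable Q" for n
          using borel_measurable_continuous_onI[OF cont[of n]] measurable_cong_sets[OF Q(2) refl] by blast
        show "indicator C \<in> borel_measurable Q" by (rule borel_measurable_indicator) simp
      qed (use lim bd in auto)
      then show ?thesis by simp
    qed
    have "bounded (range (h n))" for n using bd by (auto simp: bounded_iff)
    then have "(\<lambda>n. \<integral>y. h n y \<partial>M) = (\<lambda>n. \<integral>y. h n y \<partial>N)" using eq[OF cont] by auto
    then have "measure M C = measure N C"
      using conv[OF M] conv[OF N] LIMSEQ_unique by metis
    then show ?thesis by (simp add: M.emeasure_eq_measure N.emeasure_eq_measure)
  qed simp
qed (use prob_space.emeasure_space_1[OF M(1)] sets_eq_imp_space_eq[OF M(2)] in auto)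

text \<open>Telescoping leaves two boundary terms. This is what makes every weak limit of orbit
  averages invariant.\<close>

lemma orbit_average_shift:
  fixes h :: "nat \<Rightarrow> real"
  assumes "\<And>i. \<bar>h i\<bar> \<le> B"
  shows "(\<lambda>n. (\<Sum>i=1..Suc n. h (Suc i)) / real (Suc n) - (\<Sum>i=1..Suc n. h i) / real (Suc n)) \<longlonglongrightarrow> 0"
proof (rule Lim_null_comparison)
  show "(\<lambda>n. 2 * B / real (Suc n)) \<longlonglongrightarrow> 0"
    by (rule LIMSEQ_Suc[OF lim_const_over_n])
  have "norm ((\<Sum>i=1..Suc n. h (Suc i)) / real (Suc n) - (\<Sum>i=1..Suc n. h i) / real (Suc n)) \<le> 2 * B / real (Suc n)" for n
  proof -
    have "(\<Sum>i=1..Suc n. h (Suc i)) - (\<Sum>i=1..Suc n. h i) = h (Suc (Suc n)) - h 1"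
      unfolding sum_subtractf[symmetric] by (subst sum_Suc_diff) auto
    moreover have "\<bar>h (Suc (Suc n)) - h 1\<bar> \<le> 2 * B"
      using assms[of "Suc (Suc n)"] assms[of 1] by linarith
    ultimately show ?thesis unfolding diff_divide_distrib[symmetric] by (simp add: divide_right_mono)
  qed
  then show "\<forall>\<^sub>F n in sequentially. norm ((\<Sum>i=1..Suc n. h (Suc i)) / real (Suc n) - (\<Sum>i=1..Suc n. h i) / real (Suc n)) \<le> 2 * B / real (Suc n)"
    by auto
qed


lemma tightI_bounded_support:
  assumes "\<And>n. real_distribution (M n)" "\<And>n. measure (M n) {a<..b} = 1" "a < b"
  shows "tight M"
  unfolding tight_def using assms by (intro conjI allI impI exI[of _ a] exI[of _ b]) simp_all

text \<open>The Krylov-Bogoliubov argument, run by contradiction. Along a subsequence on which the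
  averages stay away from the integral, tightness gives a weakly convergent further subsequence of
  the laws of coded orbit points. Decoding its limit yields an invariant probability measure,
  necessarily \<open>\<mu>\<close>, so the averages converge to the very integral they were
  avoiding.\<close>

lemma uniquely_ergodic_averages:
  fixes T :: "'a::metric_space \<Rightarrow> 'a" and h :: "'a \<Rightarrow> real"
  assumes comp: "compact (UNIV :: 'a set)" and T: "continuous_on UNIV T"
    and ue: "uniquely_ergodic T \<mu>" and h: "continuous_on UNIV h"
  shows "(\<lambda>n. (\<Sum>i=1..n. h ((T ^^ i) x)) / real n) \<longlonglongrightarrow> (\<integral>y. h y \<partial>\<mu>)"
proof -
  define A where "A g n = (\<Sum>i=1..Suc n. g ((T ^^ i) x)) / real (Suc n)" for g :: "'a \<Rightarrow> real" and n
  obtain e :: "'a \<Rightarrow> real" where e: "range e \<subseteq> {0..2}"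
      "\<And>\<epsilon>. \<epsilon> > 0 \<Longrightarrow> \<exists>\<delta>>0. \<forall>y y'. \<bar>e y - e y'\<bar> < \<delta> \<longrightarrow> dist y y' < \<epsilon>"
    using compact_metric_encoding[OF comp] by blast
  define K where "K = closure (range e)"
  have e2: "\<exists>\<delta>>0. \<forall>y y'. dist (e y) (e y') < \<delta> \<longrightarrow> dist y y' < \<epsilon>" if "\<epsilon> > 0" for \<epsilon>
    using e(2)[OF that] by (simp add: dist_real_def)
  obtain c where c: "continuous_on K c" "\<And>y. c (e y) = y"
    using continuous_inverse_on_closure[OF comp e2] unfolding K_def by blast
  have eK: "e y \<in> K" for y unfolding K_def by (rule closure_subset[THEN subsetD]) simp
  have bdd: "\<exists>B. 0 \<le> B \<and> (\<forall>y. \<bar>g y\<bar> \<le> B)" if g: "continuous_on UNIV g" for g :: "'a \<Rightarrow> real"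
  proof -
    obtain B where "\<forall>y. \<bar>g y\<bar> \<le> B"
      using compact_imp_bounded[OF compact_continuous_image[OF g comp]] by (auto simp: bounded_iff)
    then show ?thesis using abs_ge_zero[of "g x"] order_trans by blast
  qed
  \<comment> \<open>The range \<open>{1..Suc n}\<close> is never empty, so the uniform law on it
    makes sense for every \<open>n\<close>. Its source is discrete, which makes the possibly
    discontinuous \<open>e\<close> measurable.\<close>
  define P where "P n = distr (measure_pmf (pmf_of_set {1..Suc n})) borel (\<lambda>i. e ((T ^^ i) x))" for n
  have P: "real_distribution (P n)" for n
    unfolding P_def by (rule prob_space.real_distribution_distr[OF prob_space_measure_pmf]) simp
  have intP: "(\<integral>z. g z \<partial>P n) = A (\<lambda>y. g (e y)) n" if [measurable]: "g \<in> borel_measurable borel" for g n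
    unfolding P_def A_def by (subst integral_distr) (auto simp: integral_pmf_of_set)
  have tight: "tight P"
  proof (rule tightI_bounded_support[OF P])
    fix n
    have "e y \<in> {-1<..2}" for y using e(1) by (auto simp: subset_iff image_iff dest!: spec[of _ "e y"])
    then have "(\<lambda>i. e ((T ^^ i) x)) -` {-1<..2} = UNIV" by auto
    then show "measure (P n) {-1<..2} = 1"
      unfolding P_def by (subst measure_distr) (auto simp: measure_pmf.prob_space[simplified])
  qed simp
  have "(A h) \<longlonglongrightarrow> (\<integral>y. h y \<partial>\<mu>)"
  proof (rule ccontr)
    assume "\<not> (A h) \<longlonglongrightarrow> (\<integral>y. h y \<partial>\<mu>)"
    then obtain \<epsilon> where \<epsilon>: "\<epsilon> > 0" "infinite {n. \<not> dist (A h n) (\<integral>y. h y \<partial>\<mu>) < \<epsilon>}"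
      by (auto simp: tendsto_iff not_eventually INFM_iff_infinite cofinite_eq_sequentially[symmetric])
    then obtain s :: "nat \<Rightarrow> nat" where s: "strict_mono s" "\<And>n. \<not> dist (A h (s n)) (\<integral>y. h y \<partial>\<mu>) < \<epsilon>"
      using infinite_enumerate[OF \<epsilon>(2)] by auto
    obtain r Q where r: "strict_mono r" and Q: "real_distribution Q" and wc: "weak_conv_m (P \<circ> s \<circ> r) Q"
      using tight_imp_convergent_subsubsequence[OF tight s(1)] by blast
    interpret Q: real_distribution Q by (rule Q)
    define q where "q = s \<circ> r"
    have q: "strict_mono q" unfolding q_def using s(1) r by (rule strict_mono_o)
    have conv: "(\<lambda>n. A (\<lambda>y. g (e y)) (q n)) \<longlonglongrightarrow> (\<integral>z. g z \<partial>Q)"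
      if g: "continuous_on UNIV g" "\<And>z. \<bar>g z\<bar> \<le> B" for g B
    proof -
      have "(\<lambda>n. integral\<^sup>L ((P \<circ> s \<circ> r) n) g) \<longlonglongrightarrow> integral\<^sup>L Q g"
        by (rule weak_conv_imp_integral_bdd_continuous_conv[OF _ Q wc, of g B])
           (use P g in \<open>auto simp: continuous_on_eq_continuous_at\<close>)
      moreover have "g \<in> borel_measurable borel" using g(1) by (rule borel_measurable_continuous_onI)
      ultimately show ?thesis by (simp add: intP q_def)
    qed
    have closedK: "closed K" by (simp add: K_def)
    have Kne: "K \<noteq> {}" using eK by auto
    \<comment> \<open>A bounded continuous function whose zero set is \<open>K\<close>. Its integral
      is 0 along the sequence, hence in the limit, so \<open>Q\<close> is concentrated on
      \<open>K\<close>.\<close>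
    define g0 where "g0 z = min 1 (infdist z K)" for z
    have g0: "continuous_on UNIV g0" "\<And>z. \<bar>g0 z\<bar> \<le> 1"
      unfolding g0_def by (auto intro!: continuous_intros simp: infdist_nonneg)
    have "(\<lambda>n. A (\<lambda>y. g0 (e y)) (q n)) = (\<lambda>n. 0)" using eK by (auto simp: A_def g0_def)
    then have "(\<integral>z. g0 z \<partial>Q) = 0" using conv[OF g0] by (simp add: LIMSEQ_const_iff)
    moreover have "integrable Q g0"
      by (rule Q.integrable_const_bound[of _ 1]) (use g0 borel_measurable_continuous_onI[OF g0(1)] in auto)
    ultimately have "AE z in Q. g0 z = 0"
      by (subst (asm) integral_nonneg_eq_0_iff_AE) (auto simp: g0_def infdist_nonneg)
    then have AEK: "AE z in Q. z \<in> K"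
      by eventually_elim (use closedK Kne infdist_pos_not_in_closed[of K] in \<open>force simp: g0_def min_def split: if_splits\<close>)
    \<comment> \<open>Decoding map, with the arbitrary value \<open>x\<close> on the
      \<open>Q\<close>-null complement of \<open>K\<close>.\<close>
    define c' where "c' z = (if z \<in> K then c z else x)" for z
    have c'm: "c' \<in> measurable Q borel"
    proof -
      have "(\<lambda>z. if z \<in> K then c z else x) \<in> borel_measurable borel"
        by (rule borel_measurable_continuous_on_if) (use closedK c(1) in auto)
      then show ?thesis using measurable_cong_sets[OF Q.events_eq_borel refl] by (auto simp: c'_def[abs_def])
    qed
    define \<nu> where "\<nu> = distr Q borel c'"
    have \<nu>: "prob_space \<nu>" "sets \<nu> = sets borel"
      unfolding \<nu>_def using c'm by (auto intro: Q.prob_space_distr)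
    have conv\<nu>: "(\<lambda>n. A g (q n)) \<longlonglongrightarrow> (\<integral>y. g y \<partial>\<nu>)" if g: "continuous_on UNIV g" for g :: "'a \<Rightarrow> real"
    proof -
      obtain B where B: "B \<ge> 0" "\<And>y. \<bar>g y\<bar> \<le> B" using bdd[OF g] by auto
      have "continuous_on K (\<lambda>z. g (c z))"
        using continuous_on_compose2[OF g c(1)] by auto
      \<comment> \<open>Weak convergence tests functions on the whole line, while \<open>g\<close>
        composed with the decoding lives on \<open>K\<close> only; Tietze extends it with the same
        bound.\<close>
      then obtain H where H: "continuous_on UNIV H" "\<And>z. z \<in> K \<Longrightarrow> H z = g (c z)" "\<And>z. norm (H z) \<le> B"
        using Tietze[of K "\<lambda>z. g (c z)" UNIV B] closedK B by auto
      have Hm: "H \<in> borel_measurable borel" using H(1) by (rule borel_measurable_continuous_onI)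
      have gm: "g \<in> borel_measurable borel" using g by (rule borel_measurable_continuous_onI)
      have "(\<integral>y. g y \<partial>\<nu>) = (\<integral>z. g (c' z) \<partial>Q)" unfolding \<nu>_def by (rule integral_distr[OF c'm gm])
      also have "\<dots> = (\<integral>z. H z \<partial>Q)"
      proof (rule integral_cong_AE)
        show "(\<lambda>z. g (c' z)) \<in> borel_measurable Q" using measurable_compose[OF c'm gm] .
        show "H \<in> borel_measurable Q" using Hm measurable_cong_sets[OF Q.events_eq_borel refl] by blast
        show "AE z in Q. g (c' z) = H z" using AEK by eventually_elim (simp add: c'_def H(2))
      qed
      finally have "(\<integral>y. g y \<partial>\<nu>) = (\<integral>z. H z \<partial>Q)" .
      moreover have "(\<lambda>y. H (e y)) = g" using H(2)[OF eK] c(2) by auto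
      ultimately show ?thesis using conv[OF H(1), of B] H(3) by simp
    qed
    have Tm: "T \<in> measurable \<nu> borel"
      using borel_measurable_continuous_onI[OF T] measurable_cong_sets[OF \<nu>(2) refl] by blast
    have "distr \<nu> borel T = \<nu>"
    proof (rule borel_measure_eqI_continuous)
      show "prob_space (distr \<nu> borel T)" by (rule prob_space.prob_space_distr[OF \<nu>(1) Tm])
      fix g :: "'a \<Rightarrow> real" assume g: "continuous_on UNIV g"
      have gT: "continuous_on UNIV (\<lambda>y. g (T y))" using continuous_on_compose2[OF g T] by auto
      obtain B where B: "\<And>y. \<bar>g y\<bar> \<le> B" using bdd[OF g] by auto
      have "(\<lambda>n. A (\<lambda>y. g (T y)) n - A g n) \<longlonglongrightarrow> 0"
        using orbit_average_shift[of "\<lambda>i. g ((T ^^ i) x)" B] B by (simp add: A_def)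
      then have "(\<lambda>n. A (\<lambda>y. g (T y)) (q n) - A g (q n)) \<longlonglongrightarrow> 0"
        using LIMSEQ_subseq_LIMSEQ[OF _ q] by (simp add: o_def)
      moreover have "(\<lambda>n. A (\<lambda>y. g (T y)) (q n) - A g (q n)) \<longlonglongrightarrow> (\<integral>y. g (T y) \<partial>\<nu>) - (\<integral>y. g y \<partial>\<nu>)"
        by (intro tendsto_diff conv\<nu> g gT)
      ultimately have "(\<integral>y. g (T y) \<partial>\<nu>) = (\<integral>y. g y \<partial>\<nu>)" using LIMSEQ_unique by fastforce
      moreover have "(\<integral>y. g y \<partial>distr \<nu> borel T) = (\<integral>y. g (T y) \<partial>\<nu>)"
        by (rule integral_distr[OF Tm borel_measurable_continuous_onI[OF g]])
      ultimately show "(\<integral>y. g y \<partial>distr \<nu> borel T) = (\<integral>y. g y \<partial>\<nu>)" by simp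
    qed (use \<nu> in auto)
    then have "\<nu> = \<mu>" using ue \<nu> by (auto simp: uniquely_ergodic_def invariant_prob_def)
    then have "(\<lambda>n. A h (q n)) \<longlonglongrightarrow> (\<integral>y. h y \<partial>\<mu>)" using conv\<nu>[OF h] by simp
    then have "\<forall>\<^sub>F n in sequentially. dist (A h (q n)) (\<integral>y. h y \<partial>\<mu>) < \<epsilon>" using \<epsilon>(1) by (rule tendstoD)
    then show False using s(2) by (auto simp: q_def eventually_sequentially)
  qed
  then show ?thesis unfolding A_def by (rule LIMSEQ_imp_Suc)
qed

section \<open>The derivatives of the log-moment generating function\<close>

lemma L_arg_bounds:
  fixes \<phi> u :: real
  assumes "\<phi> \<in> {0..1}"
  shows "exp (- \<bar>u\<bar>) \<le> \<phi> * exp u + (1 - \<phi>) * exp (- u)"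
    and "\<phi> * exp u + (1 - \<phi>) * exp (- u) \<le> exp \<bar>u\<bar>"
    and "0 < \<phi> * exp u + (1 - \<phi>) * exp (- u)"
proof -
  have "\<phi> * exp (- \<bar>u\<bar>) + (1 - \<phi>) * exp (- \<bar>u\<bar>) \<le> \<phi> * exp u + (1 - \<phi>) * exp (- u)"
    using assms by (intro add_mono mult_left_mono) auto
  then show 1: "exp (- \<bar>u\<bar>) \<le> \<phi> * exp u + (1 - \<phi>) * exp (- u)" by (simp add: algebra_simps)
  have "\<phi> * exp u + (1 - \<phi>) * exp (- u) \<le> \<phi> * exp \<bar>u\<bar> + (1 - \<phi>) * exp \<bar>u\<bar>"
    using assms by (intro add_mono mult_left_mono) auto
  then show "\<phi> * exp u + (1 - \<phi>) * exp (- u) \<le> exp \<bar>u\<bar>" by (simp add: algebra_simps)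
  show "0 < \<phi> * exp u + (1 - \<phi>) * exp (- u)" using 1 exp_gt_zero less_le_trans by blast
qed

lemma abs_L_fun_le: "\<phi> \<in> {0..1} \<Longrightarrow> \<bar>L_fun \<phi> u\<bar> \<le> \<bar>u\<bar>"
proof -
  assume "\<phi> \<in> {0..1}"
  note b = L_arg_bounds[OF this, of u]
  have "ln (exp (- \<bar>u\<bar>)) \<le> L_fun \<phi> u" unfolding L_fun_def using b by (subst ln_le_cancel_iff) auto
  moreover have "L_fun \<phi> u \<le> ln (exp \<bar>u\<bar>)" unfolding L_fun_def using b by (subst ln_le_cancel_iff) auto
  ultimately show ?thesis by (simp add: abs_le_iff)
qed

text \<open>The mean of a spin that equals 1 with probability \<open>\<phi>\<close> and -1
  otherwise, after tilting its law by \<open>exp (u * s)\<close>.\<close>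

definition tilted_mean :: "real \<Rightarrow> real \<Rightarrow> real" where
  "tilted_mean \<phi> u = (\<phi> * exp u - (1 - \<phi>) * exp (- u)) / (\<phi> * exp u + (1 - \<phi>) * exp (- u))"

lemma tilted_mean_0: "tilted_mean \<phi> 0 = 2 * \<phi> - 1"
  by (simp add: tilted_mean_def)

lemma abs_tilted_mean_le: "\<phi> \<in> {0..1} \<Longrightarrow> \<bar>tilted_mean \<phi> u\<bar> \<le> 1"
proof -
  assume \<phi>: "\<phi> \<in> {0..1}"
  have "\<bar>\<phi> * exp u - (1 - \<phi>) * exp (- u)\<bar> \<le> \<bar>\<phi> * exp u\<bar> + \<bar>(1 - \<phi>) * exp (- u)\<bar>" by (rule abs_triangle_ineq4)
  also have "\<dots> = \<phi> * exp u + (1 - \<phi>) * exp (- u)" using \<phi> by (simp add: abs_mult)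
  finally show ?thesis using L_arg_bounds(3)[OF \<phi>, of u] by (simp add: tilted_mean_def)
qed

lemma DERIV_L_fun:
  "\<phi> \<in> {0..1} \<Longrightarrow> (L_fun \<phi> has_real_derivative tilted_mean \<phi> u) (at u)"
  using L_arg_bounds(3)[of \<phi> u] unfolding L_fun_def[abs_def] tilted_mean_def
  by (auto intro!: derivative_eq_intros simp: field_simps)

text \<open>The derivative of a tilted mean is the tilted variance, and a spin with values +1 and -1
  has second moment 1.\<close>

lemma DERIV_tilted_mean:
  assumes "\<phi> \<in> {0..1}"
  shows "(tilted_mean \<phi> has_real_derivative 1 - (tilted_mean \<phi> u)\<^sup>2) (at u)"
proof -
  define p q where "p = \<phi> * exp u" and "q = (1 - \<phi>) * exp (- u)"
  have ne: "p + q \<noteq> 0" using L_arg_bounds(3)[OF assms, of u] by (simp add: p_def q_def)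
  have p: "((\<lambda>u. \<phi> * exp u) has_real_derivative p) (at u)"
    unfolding p_def by (auto intro!: derivative_eq_intros)
  have q: "((\<lambda>u. (1 - \<phi>) * exp (- u)) has_real_derivative - q) (at u)"
    unfolding q_def by (auto intro!: derivative_eq_intros simp: algebra_simps)
  have "(tilted_mean \<phi> has_real_derivative ((p + q) * (p + q) - (p - q) * (p - q)) / ((p + q) * (p + q))) (at u)"
    using DERIV_divide[OF DERIV_diff[OF p q] DERIV_add[OF p q]] ne
    unfolding tilted_mean_def[abs_def] p_def[symmetric] q_def[symmetric] by simp
  also have "((p + q) * (p + q) - (p - q) * (p - q)) / ((p + q) * (p + q)) = 1 - (tilted_mean \<phi> u)\<^sup>2"
    using ne unfolding tilted_mean_def p_def[symmetric] q_def[symmetric]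
    by (simp add: divide_simps power2_eq_square)
  finally show ?thesis .
qed

text \<open>Since \<open>\<tau> = \<partial>L/\<partial>s\<close> solves \<open>\<tau>' = 1 - \<tau>\<^sup>2\<close>, all higher derivatives of \<open>L\<close> in \<open>s\<close> are polynomials
  in \<open>\<tau>\<close>; \<open>L_poly j\<close> belongs to the derivative of order \<open>j + 1\<close>.\<close>

primrec L_poly :: "nat \<Rightarrow> real poly" where
  "L_poly 0 = [:0, 1:]"
| "L_poly (Suc j) = pderiv (L_poly j) * [:1, 0, - 1:]"

primrec L_deriv :: "nat \<Rightarrow> real \<Rightarrow> real \<Rightarrow> real" where
  "L_deriv 0 \<phi> u = L_fun \<phi> u"
| "L_deriv (Suc j) \<phi> u = poly (L_poly j) (tilted_mean \<phi> u)"

lemma degree_L_poly: "degree (L_poly j) \<le> Suc j"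
proof (induction j)
  case (Suc j)
  have "degree (L_poly (Suc j)) \<le> degree (pderiv (L_poly j)) + degree [:1, 0, - 1 :: real:]"
    by (simp only: L_poly.simps degree_mult_le)
  also have "\<dots> \<le> Suc (Suc j)" using Suc by (simp add: degree_pderiv)
  finally show ?case .
qed simp

lemma DERIV_L_deriv:
  assumes "\<phi> \<in> {0..1}"
  shows "(L_deriv j \<phi> has_real_derivative L_deriv (Suc j) \<phi> u) (at u)"
proof (cases j)
  case 0
  then show ?thesis using DERIV_L_fun[OF assms] by (simp add: L_deriv.simps(1)[abs_def])
next
  case (Suc i)
  have "((\<lambda>u. poly (L_poly i) (tilted_mean \<phi> u)) has_real_derivative
      poly (pderiv (L_poly i)) (tilted_mean \<phi> u) * (1 - (tilted_mean \<phi> u)\<^sup>2)) (at u)"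
    by (rule DERIV_chain2[OF poly_DERIV DERIV_tilted_mean[OF assms]])
  then show ?thesis by (simp add: Suc L_deriv.simps(2)[abs_def] algebra_simps power2_eq_square)
qed

text \<open>The polynomials are evaluated at tilted means, which stay in [-1, 1] for all parameters.
  Order 0 is left out because \<open>L_fun\<close> may grow linearly. Uniformity in
  \<open>\<phi>\<close> serves the integral over \<open>\<mu>\<close> and the orbit averages at
  once.\<close>

lemma bounded_L_deriv: "\<exists>C\<ge>0. \<forall>\<phi>\<in>{0..1}. \<forall>u. \<bar>L_deriv (Suc j) \<phi> u\<bar> \<le> C"
proof -
  have "compact (poly (L_poly j) ` {-1..1})"
    by (intro compact_continuous_image continuous_intros) auto
  then obtain C where C: "\<And>t. t \<in> {-1..1} \<Longrightarrow> \<bar>poly (L_poly j) t\<bar> \<le> C"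
    using compact_imp_bounded by (fastforce simp: bounded_iff)
  have "\<bar>L_deriv (Suc j) \<phi> u\<bar> \<le> C" if "\<phi> \<in> {0..1}" for \<phi> u
    using C[of "tilted_mean \<phi> u"] abs_tilted_mean_le[OF that, of u] by (simp add: abs_le_iff)
  moreover have "0 \<le> C" using C[of 0] by auto
  ultimately show ?thesis by blast
qed

lemma continuous_on_L_deriv: "continuous_on {0..1} (\<lambda>\<phi>. L_deriv j \<phi> u)"
proof (cases j)
  case 0
  show ?thesis unfolding 0 L_deriv.simps L_fun_def
    using L_arg_bounds(3)[of _ u] by (intro continuous_intros) (auto simp: less_imp_neq[symmetric])
next
  case (Suc i)
  have "continuous_on {0..1} (\<lambda>\<phi>. tilted_mean \<phi> u)"
    unfolding tilted_mean_def using L_arg_bounds(3)[of _ u]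
    by (intro continuous_intros) (auto simp: less_imp_neq[symmetric])
  then show ?thesis unfolding Suc L_deriv.simps by (intro continuous_intros)
qed

lemma dL_ds_eq: "\<phi> \<in> {0..1} \<Longrightarrow> dL_ds \<phi> s = L_deriv 1 \<phi> s"
  unfolding dL_ds_def by (intro DERIV_imp_deriv) (simp add: DERIV_L_fun)

text \<open>At the origin the tilted mean is the affine function 2 \<open>\<phi>\<close> - 1. This
  is why averages of powers of \<open>f\<close>, up to the order of the derivative, control the
  empirical derivatives at 0.\<close>

lemma L_deriv_0: "L_deriv (Suc j) \<phi> 0 = (\<Sum>i\<le>Suc j. coeff (L_poly j \<circ>\<^sub>p [:-1, 2:]) i * \<phi> ^ i)"
proof -
  have "L_deriv (Suc j) \<phi> 0 = poly (L_poly j \<circ>\<^sub>p [:-1, 2:]) \<phi>"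
    by (simp add: tilted_mean_0 poly_pcompose algebra_simps)
  also have "\<dots> = (\<Sum>i\<le>Suc j. coeff (L_poly j \<circ>\<^sub>p [:-1, 2:]) i * \<phi> ^ i)"
    unfolding poly_altdef using degree_L_poly[of j]
    by (intro sum.mono_neutral_left) (auto simp: degree_pcompose coeff_eq_0)
  finally show ?thesis .
qed

section \<open>Taylor bounds and the derivatives of G\<close>

lemma taylor_bound:
  fixes F :: "nat \<Rightarrow> real \<Rightarrow> real"
  assumes F: "\<And>j s. (F j has_real_derivative F (Suc j) s) (at s)"
    and C: "\<And>s. \<bar>F N s\<bar> \<le> C"
  shows "\<bar>F 0 (p + h) - (\<Sum>j<N. F j p / fact j * h ^ j)\<bar> \<le> C / fact N * \<bar>h\<bar> ^ N"
proof -
  have "\<exists>t. \<bar>t\<bar> \<le> \<bar>h\<bar> \<and> F 0 (p + h) =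
      (\<Sum>m<N. (F m (p + 0) / fact m) * h ^ m) + (F N (p + t) / fact N) * h ^ N"
    by (rule Maclaurin_all_le[of "\<lambda>j h. F j (p + h)"])
       (use F in \<open>auto simp: DERIV_shift[symmetric] add.commute\<close>)
  then obtain t where "F 0 (p + h) = (\<Sum>m<N. (F m (p + 0) / fact m) * h ^ m) + (F N (p + t) / fact N) * h ^ N"
    by blast
  then have "F 0 (p + h) - (\<Sum>m<N. F m p / fact m * h ^ m) = (F N (p + t) / fact N) * h ^ N" by simp
  then show ?thesis
    using C[of "p + t"] by (simp add: abs_mult power_abs divide_right_mono mult_right_mono)
qed

lemma lipschitz_from_DERIV:
  fixes F :: "real \<Rightarrow> real"
  assumes "\<And>s. (F has_real_derivative F' s) (at s)" "\<And>s. \<bar>F' s\<bar> \<le> C"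
  shows "\<bar>F s - F t\<bar> \<le> C * \<bar>s - t\<bar>"
proof -
  have "norm (F s - F t) \<le> C * norm (s - t)"
    by (rule field_differentiable_bound[of UNIV F F' C]) (use assms in \<open>auto intro: has_field_derivative_at_within\<close>)
  then show ?thesis by simp
qed

text \<open>\<open>G_deriv B l j\<close> is the \<open>j\<close>-th derivative of \<open>s \<mapsto> B s\<^sup>2 / 2 - l 0 (B s)\<close> when \<open>l j\<close> is that of
  \<open>l 0\<close>. It serves both \<open>G\<^sub>\<beta>\<close>, where \<open>B = \<beta> J\<close> and \<open>l 0 = \<Lambda>\<close>, and its empirical version.\<close>

definition G_deriv :: "real \<Rightarrow> (nat \<Rightarrow> real \<Rightarrow> real) \<Rightarrow> nat \<Rightarrow> real \<Rightarrow> real" where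
  "G_deriv B l j s =
     (if j = 0 then B / 2 * s\<^sup>2 else if j = 1 then B * s else if j = 2 then B else 0) - B ^ j * l j (B * s)"

lemma DERIV_G_deriv:
  assumes "\<And>j u. (l j has_real_derivative l (Suc j) u) (at u)"
  shows "(G_deriv B l j has_real_derivative G_deriv B l (Suc j) s) (at s)"
proof -
  have 1: "((\<lambda>s. B ^ j * l j (B * s)) has_real_derivative B ^ Suc j * l (Suc j) (B * s)) (at s)"
    by (rule derivative_eq_intros DERIV_chain2[OF assms] refl | simp)+
  have 2: "((\<lambda>s. if j = 0 then B / 2 * s\<^sup>2 else if j = 1 then B * s else if j = 2 then B else 0)
      has_real_derivative (if Suc j = 0 then B / 2 * s\<^sup>2 else if Suc j = 1 then B * s else if Suc j = 2 then B else 0)) (at s)"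
  proof -
    consider "j = 0" | "j = 1" | "j = 2" | "j > 2" by linarith
    then show ?thesis by cases (auto intro!: derivative_eq_intros)
  qed
  show ?thesis unfolding G_deriv_def[abs_def] using DERIV_diff[OF 2 1] by simp
qed

section \<open>Averages over the invariant measure\<close>

locale tilted_average = prob_space \<mu> for \<mu> :: "'a measure" +
  fixes f :: "'a \<Rightarrow> real"
  assumes f_meas [measurable]: "f \<in> borel_measurable \<mu>"
    and f_range: "\<And>y. f y \<in> {0..1}"
begin

definition Lambda_deriv :: "nat \<Rightarrow> real \<Rightarrow> real" where
  "Lambda_deriv j u = (\<integral>y. L_deriv j (f y) u \<partial>\<mu>)"

lemma Lambda_deriv_0: "Lambda_deriv 0 u = Lambda \<mu> f u"
  by (simp add: Lambda_deriv_def Lambda_def)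

lemma measurable_L_deriv [measurable]: "(\<lambda>y. L_deriv j (f y) u) \<in> borel_measurable \<mu>"
proof -
  \<comment> \<open>Continuity in \<open>\<phi>\<close> is available on \<open>{0..1}\<close>;
    cutting off outside the range of \<open>f\<close> gives a Borel function on the line.\<close>
  have "(\<lambda>\<phi>. indicator {0..1} \<phi> *\<^sub>R L_deriv j \<phi> u) \<in> borel_measurable borel"
    by (rule borel_measurable_continuous_on_indicator[OF _ continuous_on_L_deriv]) simp
  from measurable_compose[OF f_meas this] show ?thesis using f_range by simp
qed

lemma integrable_L_deriv [simp]: "integrable \<mu> (\<lambda>y. L_deriv j (f y) u)"
proof (cases j)
  case 0
  then show ?thesis using abs_L_fun_le[OF f_range, of _ u] measurable_L_deriv[of 0 u]
    by (intro integrable_const_bound[of _ "\<bar>u\<bar>"]) auto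
next
  case (Suc i)
  obtain C where "\<And>y. \<bar>L_deriv (Suc i) (f y) u\<bar> \<le> C" using bounded_L_deriv[of i] f_range by blast
  then show ?thesis unfolding Suc by (intro integrable_const_bound[of _ C] measurable_L_deriv) (simp del: L_deriv.simps)
qed

lemma abs_Lambda_deriv_le:
  assumes "\<And>\<phi>. \<phi> \<in> {0..1} \<Longrightarrow> \<bar>L_deriv j \<phi> u\<bar> \<le> C"
  shows "\<bar>Lambda_deriv j u\<bar> \<le> C"
proof -
  have "\<bar>Lambda_deriv j u\<bar> \<le> (\<integral>y. \<bar>L_deriv j (f y) u\<bar> \<partial>\<mu>)"
    unfolding Lambda_deriv_def by (rule integral_abs_bound)
  also have "\<dots> \<le> (\<integral>y. C \<partial>\<mu>)" using assms f_range by (intro integral_mono) auto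
  finally show ?thesis by (simp add: prob_space)
qed

text \<open>Differentiation under the integral sign through Taylor's formula: the derivative of
  order \<open>j + 2\<close> has a bound uniform in \<open>y\<close> and \<open>u\<close>, so the
  pointwise remainder is at most C h^2 and so is its integral.\<close>

lemma DERIV_Lambda_deriv: "(Lambda_deriv j has_real_derivative Lambda_deriv (Suc j) u) (at u)"
proof -
  obtain C where C: "C \<ge> 0" "\<And>\<phi> u. \<phi> \<in> {0..1} \<Longrightarrow> \<bar>L_deriv (Suc (Suc j)) \<phi> u\<bar> \<le> C"
    using bounded_L_deriv[of "Suc j"] by blast
  have rem: "\<bar>Lambda_deriv j (u + h) - Lambda_deriv j u - h * Lambda_deriv (Suc j) u\<bar> \<le> C * h\<^sup>2" for h
  proof -
    have pt: "\<bar>L_deriv j (f y) (u + h) - L_deriv j (f y) u - h * L_deriv (Suc j) (f y) u\<bar> \<le> C * h\<^sup>2" for y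
    proof -
      have "\<bar>L_deriv (0 + j) (f y) (u + h) - (\<Sum>i<2. L_deriv (i + j) (f y) u / fact i * h ^ i)\<bar> \<le> C / fact 2 * \<bar>h\<bar> ^ 2"
        by (rule taylor_bound[of "\<lambda>i. L_deriv (i + j) (f y)" 2 C u h])
           (use C(2)[OF f_range] DERIV_L_deriv[OF f_range] in \<open>auto simp: numeral_2_eq_2 simp del: L_deriv.simps\<close>)
      moreover have "C / fact 2 * \<bar>h\<bar> ^ 2 \<le> C * h\<^sup>2" using C(1) by (simp add: mult_right_mono)
      ultimately show ?thesis by (simp add: numeral_2_eq_2 algebra_simps del: L_deriv.simps)
    qed
    have "Lambda_deriv j (u + h) - Lambda_deriv j u - h * Lambda_deriv (Suc j) u =
        (\<integral>y. L_deriv j (f y) (u + h) - L_deriv j (f y) u - h * L_deriv (Suc j) (f y) u \<partial>\<mu>)"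
      unfolding Lambda_deriv_def by (simp del: L_deriv.simps)
    also have "\<bar>\<dots>\<bar> \<le> (\<integral>y. \<bar>L_deriv j (f y) (u + h) - L_deriv j (f y) u - h * L_deriv (Suc j) (f y) u\<bar> \<partial>\<mu>)"
      by (rule integral_abs_bound)
    also have "\<dots> \<le> (\<integral>y. C * h\<^sup>2 \<partial>\<mu>)" using pt by (intro integral_mono) (auto simp del: L_deriv.simps)
    finally show ?thesis by (simp add: prob_space)
  qed
  have "((\<lambda>h. (Lambda_deriv j (u + h) - Lambda_deriv j u) / h - Lambda_deriv (Suc j) u) \<longlongrightarrow> 0) (at 0)"
  proof (rule Lim_null_comparison)
    show "\<forall>\<^sub>F h in at 0. norm ((Lambda_deriv j (u + h) - Lambda_deriv j u) / h - Lambda_deriv (Suc j) u) \<le> C * \<bar>h\<bar>"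
      unfolding eventually_at_filter
    proof (intro always_eventually allI impI)
      fix h :: real assume h: "h \<noteq> 0"
      define R where "R = Lambda_deriv j (u + h) - Lambda_deriv j u - h * Lambda_deriv (Suc j) u"
      have "(Lambda_deriv j (u + h) - Lambda_deriv j u) / h - Lambda_deriv (Suc j) u = R / h"
        using h by (simp add: R_def field_simps)
      moreover have "\<bar>R / h\<bar> \<le> C * h\<^sup>2 / \<bar>h\<bar>"
        unfolding abs_divide using rem[of h] by (intro divide_right_mono) (auto simp: R_def)
      moreover have "C * h\<^sup>2 / \<bar>h\<bar> = C * \<bar>h\<bar>"
      proof -
        have "C * h\<^sup>2 / \<bar>h\<bar> = C * (\<bar>h\<bar> * \<bar>h\<bar>) / \<bar>h\<bar>" by (simp add: power2_eq_square)
        then show ?thesis using h by (simp del: abs_mult_self_eq)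
      qed
      ultimately show "norm ((Lambda_deriv j (u + h) - Lambda_deriv j u) / h - Lambda_deriv (Suc j) u) \<le> C * \<bar>h\<bar>"
        by simp
    qed
    show "((\<lambda>h. C * \<bar>h\<bar>) \<longlongrightarrow> 0) (at 0)" by (auto intro!: tendsto_eq_intros)
  qed
  then show ?thesis unfolding DERIV_def by (subst (asm) LIM_zero_iff)
qed

end

section \<open>The Gaussian identity for Gibbs expectations\<close>

lemma finite_configs: "finite (configs n)"
  unfolding configs_def by (intro finite_PiE) auto

lemma abs_magnetization_le: "\<sigma> \<in> configs n \<Longrightarrow> \<bar>magnetization n \<sigma>\<bar> \<le> real n"
proof -
  assume \<sigma>: "\<sigma> \<in> configs n"
  have "\<bar>magnetization n \<sigma>\<bar> \<le> (\<Sum>i=1..n. \<bar>\<sigma> i\<bar>)" unfolding magnetization_def by (rule sum_abs)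
  also have "\<dots> \<le> (\<Sum>i=1..n. 1)"
    using \<sigma> by (intro sum_mono) (force simp: configs_def PiE_iff)
  finally show ?thesis by simp
qed

text \<open>Without the quadratic term the spins are independent, so the Laplace transform of the
  magnetization factors over the sites.\<close>

lemma sum_configs_exp:
  "(\<Sum>\<sigma>\<in>configs n. exp (\<theta> * magnetization n \<sigma>) * (\<Prod>i=1..n. site_prob T f x i (\<sigma> i)))
     = (\<Prod>i=1..n. f ((T ^^ i) x) * exp \<theta> + (1 - f ((T ^^ i) x)) * exp (- \<theta>))"
proof -
  have "(\<Prod>i=1..n. f ((T ^^ i) x) * exp \<theta> + (1 - f ((T ^^ i) x)) * exp (- \<theta>)) =
      (\<Prod>i=1..n. \<Sum>s\<in>{-1, 1}. site_prob T f x i s * exp (\<theta> * s))"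
    by (simp add: site_prob_def add.commute)
  also have "\<dots> = (\<Sum>\<sigma>\<in>configs n. \<Prod>i=1..n. site_prob T f x i (\<sigma> i) * exp (\<theta> * \<sigma> i))"
    unfolding configs_def by (rule prod_sum_PiE) auto
  also have "\<dots> = (\<Sum>\<sigma>\<in>configs n. exp (\<theta> * magnetization n \<sigma>) * (\<Prod>i=1..n. site_prob T f x i (\<sigma> i)))"
    by (simp add: prod.distrib magnetization_def exp_sum[symmetric] sum_distrib_left mult.commute)
  finally show ?thesis ..
qed

definition emp_Lambda_deriv :: "(nat \<Rightarrow> real) \<Rightarrow> nat \<Rightarrow> nat \<Rightarrow> real \<Rightarrow> real" where
  "emp_Lambda_deriv \<phi> n j u = (\<Sum>i=1..n. L_deriv j (\<phi> i) u) / real n"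

lemma DERIV_emp_Lambda_deriv:
  assumes "\<And>i. \<phi> i \<in> {0..1}"
  shows "(emp_Lambda_deriv \<phi> n j has_real_derivative emp_Lambda_deriv \<phi> n (Suc j) u) (at u)"
  unfolding emp_Lambda_deriv_def[abs_def]
  by (intro DERIV_cdivide DERIV_sum DERIV_L_deriv assms)

lemma abs_emp_Lambda_deriv_le:
  assumes "\<And>i. \<bar>L_deriv j (\<phi> i) u\<bar> \<le> C" "0 \<le> C"
  shows "\<bar>emp_Lambda_deriv \<phi> n j u\<bar> \<le> C"
proof -
  have "\<bar>\<Sum>i=1..n. L_deriv j (\<phi> i) u\<bar> \<le> (\<Sum>i=1..n. C)"
    by (rule order_trans[OF sum_abs sum_mono]) (rule assms)
  then show ?thesis using assms(2)
    by (cases "n = 0") (auto simp: emp_Lambda_deriv_def divide_le_eq mult.commute)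
qed

lemma prod_eq_exp_emp_Lambda:
  assumes "\<And>i. \<phi> i \<in> {0..1}" "n \<ge> 1"
  shows "(\<Prod>i=1..n. \<phi> i * exp u + (1 - \<phi> i) * exp (- u)) = exp (real n * emp_Lambda_deriv \<phi> n 0 u)"
  using assms L_arg_bounds(3)[of _ u] by (simp add: emp_Lambda_deriv_def exp_sum L_fun_def)

definition G_emp :: "(nat \<Rightarrow> real) \<Rightarrow> real \<Rightarrow> nat \<Rightarrow> nat \<Rightarrow> real \<Rightarrow> real" where
  "G_emp \<phi> B n j = G_deriv B (emp_Lambda_deriv \<phi> n) j"

lemma DERIV_G_emp:
  assumes "\<And>i. \<phi> i \<in> {0..1}"
  shows "(G_emp \<phi> B n j has_real_derivative G_emp \<phi> B n (Suc j) s) (at s)"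
  unfolding G_emp_def by (intro DERIV_G_deriv DERIV_emp_Lambda_deriv assms)

lemma G_emp_0: "G_emp \<phi> B n 0 s = B / 2 * s\<^sup>2 - emp_Lambda_deriv \<phi> n 0 (B * s)"
  by (simp add: G_emp_def G_deriv_def)

text \<open>Completing the square: 1/(n B) is the variance for which the terms in
  \<open>m\<^sup>2\<close> cancel, which leaves an exponent linear in \<open>m\<close>.\<close>

lemma hubbard_stratonovich_density:
  assumes "n \<ge> 1" "B > 0"
  shows "exp (B / (2 * real n) * m\<^sup>2) * normal_density (m / real n) (1 / sqrt (real n * B)) s =
    sqrt (real n * B / (2 * pi)) * (exp (- real n * (B / 2 * s\<^sup>2)) * exp (B * s * m))"
proof -
  have "exp (B / (2 * real n) * m\<^sup>2) * exp (- (s - m / real n)\<^sup>2 / (2 * (1 / sqrt (real n * B))\<^sup>2)) =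
      exp (- real n * (B / 2 * s\<^sup>2)) * exp (B * s * m)"
    unfolding exp_add[symmetric] using assms
    by (intro arg_cong[of _ _ exp]) (simp add: power_divide field_simps power2_eq_square)
  moreover have "1 / sqrt (2 * pi * (1 / sqrt (real n * B))\<^sup>2) = sqrt (real n * B / (2 * pi))"
    using assms by (simp add: power_divide real_sqrt_divide)
  ultimately show ?thesis unfolding normal_density_def by (simp add: mult_ac)
qed

text \<open>After smearing, the exponent is linear in the magnetization at each fixed
  \<open>s\<close>, so the sum over configurations is the product computed in
  \<open>sum_configs_exp\<close>, and this is what turns \<open>\<Lambda>\<close> into its empirical
  version. Integrability is inherited from a finite sum of Gaussian terms.\<close>

lemma hubbard_stratonovich:
  fixes F :: "real \<Rightarrow> real"
  assumes f: "\<And>y. f y \<in> {0..1}" and n: "n \<ge> 1" and B: "\<beta> * J > 0"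
    and F [measurable]: "F \<in> borel_measurable borel" and bd: "\<And>s. \<bar>F s\<bar> \<le> K"
  shows "(\<Sum>\<sigma>\<in>configs n. gibbs_weight T f J \<beta> n x \<sigma> *
           (\<integral>s. normal_density (magnetization n \<sigma> / real n) (1 / sqrt (real n * (\<beta> * J))) s * F s \<partial>lborel)) =
     sqrt (real n * (\<beta> * J) / (2 * pi)) *
       (\<integral>s. F s * exp (- real n * G_emp (\<lambda>i. f ((T ^^ i) x)) (\<beta> * J) n 0 s) \<partial>lborel)"
    and "integrable lborel (\<lambda>s. F s * exp (- real n * G_emp (\<lambda>i. f ((T ^^ i) x)) (\<beta> * J) n 0 s))"
proof -
  define B where "B = \<beta> * J"
  have B: "B > 0" using assms by (simp add: B_def)
  define c where "c = sqrt (real n * B / (2 * pi))"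
  have c: "c > 0" using n B by (simp add: c_def)
  define N where "N \<sigma> s = normal_density (magnetization n \<sigma> / real n) (1 / sqrt (real n * B)) s" for \<sigma> s
  define w where "w = gibbs_weight T f J \<beta> n x"
  have sd: "1 / sqrt (real n * B) > 0" using n B by simp
  have intN: "integrable lborel (\<lambda>s. N \<sigma> s * F s)" for \<sigma>
  proof (rule Bochner_Integration.integrable_bound)
    show "integrable lborel (\<lambda>s. K * N \<sigma> s)"
      unfolding N_def using sd by (intro integrable_mult_right integrable_normal_density)
    show "AE s in lborel. norm (N \<sigma> s * F s) \<le> norm (K * N \<sigma> s)"
    proof (rule AE_I2)
      fix s
      have "\<bar>F s\<bar> \<le> \<bar>K\<bar>" using bd[of s] by linarith
      then show "norm (N \<sigma> s * F s) \<le> norm (K * N \<sigma> s)"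
        by (simp add: abs_mult mult.commute mult_right_mono)
    qed
  qed (simp add: N_def)
  have pt: "(\<Sum>\<sigma>\<in>configs n. w \<sigma> * (N \<sigma> s * F s)) =
      c * (F s * exp (- real n * G_emp (\<lambda>i. f ((T ^^ i) x)) B n 0 s))" for s
  proof -
    have "w \<sigma> * (N \<sigma> s * F s) = c * F s * exp (- real n * (B / 2 * s\<^sup>2)) *
        (exp ((B * s) * magnetization n \<sigma>) * (\<Prod>i=1..n. site_prob T f x i (\<sigma> i)))" for \<sigma>
    proof -
      have "w \<sigma> * (N \<sigma> s * F s) = (exp (B / (2 * real n) * (magnetization n \<sigma>)\<^sup>2) * N \<sigma> s) *
          ((\<Prod>i=1..n. site_prob T f x i (\<sigma> i)) * F s)"
        by (simp add: w_def gibbs_weight_def B_def mult_ac)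
      then show ?thesis
        unfolding N_def hubbard_stratonovich_density[OF n B] c_def by (simp add: mult_ac)
    qed
    then have "(\<Sum>\<sigma>\<in>configs n. w \<sigma> * (N \<sigma> s * F s)) = c * F s * exp (- real n * (B / 2 * s\<^sup>2)) *
        (\<Prod>i=1..n. f ((T ^^ i) x) * exp (B * s) + (1 - f ((T ^^ i) x)) * exp (- (B * s)))"
      unfolding sum_configs_exp[symmetric] sum_distrib_left by (intro sum.cong refl)
    also have "\<dots> = c * F s * (exp (- real n * (B / 2 * s\<^sup>2)) * exp (real n * emp_Lambda_deriv (\<lambda>i. f ((T ^^ i) x)) n 0 (B * s)))"
      using prod_eq_exp_emp_Lambda[of "\<lambda>i. f ((T ^^ i) x)" n "B * s"] f n by simp
    also have "\<dots> = c * (F s * exp (- real n * G_emp (\<lambda>i. f ((T ^^ i) x)) B n 0 s))"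
      unfolding exp_add[symmetric] by (simp add: G_emp_0 algebra_simps)
    finally show ?thesis .
  qed
  have "(\<Sum>\<sigma>\<in>configs n. w \<sigma> * (\<integral>s. N \<sigma> s * F s \<partial>lborel)) = (\<integral>s. (\<Sum>\<sigma>\<in>configs n. w \<sigma> * (N \<sigma> s * F s)) \<partial>lborel)"
    using intN by (simp add: integrable_mult_right)
  then show "(\<Sum>\<sigma>\<in>configs n. gibbs_weight T f J \<beta> n x \<sigma> *
           (\<integral>s. normal_density (magnetization n \<sigma> / real n) (1 / sqrt (real n * (\<beta> * J))) s * F s \<partial>lborel)) =
     sqrt (real n * (\<beta> * J) / (2 * pi)) *
       (\<integral>s. F s * exp (- real n * G_emp (\<lambda>i. f ((T ^^ i) x)) (\<beta> * J) n 0 s) \<partial>lborel)"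
    unfolding pt by (simp add: w_def N_def c_def B_def)
  have "integrable lborel (\<lambda>s. \<Sum>\<sigma>\<in>configs n. w \<sigma> * (N \<sigma> s * F s))"
    using intN by (intro Bochner_Integration.integrable_sum integrable_mult_right)
  then show "integrable lborel (\<lambda>s. F s * exp (- real n * G_emp (\<lambda>i. f ((T ^^ i) x)) (\<beta> * J) n 0 s))"
    unfolding pt using c by (simp add: B_def)
qed

section \<open>Gibbs expectations against smeared expectations\<close>

lemma gibbs_weight_nonneg:
  assumes "\<And>y. f y \<in> {0..1}"
  shows "gibbs_weight T f J \<beta> n x \<sigma> \<ge> 0"
  unfolding gibbs_weight_def site_prob_def using assms by (intro mult_nonneg_nonneg prod_nonneg) auto

text \<open>The interaction exponent is nonnegative, so the partition function is at least its value
  without interaction, which is the total mass 1 of a product law.\<close>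

lemma partition_function_pos:
  assumes f: "\<And>y. f y \<in> {0..1}" and B: "\<beta> * J \<ge> 0"
  shows "(\<Sum>\<sigma>\<in>configs n. gibbs_weight T f J \<beta> n x \<sigma>) > 0"
proof -
  have "1 = (\<Sum>\<sigma>\<in>configs n. \<Prod>i=1..n. site_prob T f x i (\<sigma> i))"
    using sum_configs_exp[of 0 n T f x] by simp
  also have "\<dots> \<le> (\<Sum>\<sigma>\<in>configs n. gibbs_weight T f J \<beta> n x \<sigma>)"
  proof (rule sum_mono)
    fix \<sigma>
    have "1 * (\<Prod>i=1..n. site_prob T f x i (\<sigma> i)) \<le> gibbs_weight T f J \<beta> n x \<sigma>"
      unfolding gibbs_weight_def using f B
      by (intro mult_right_mono prod_nonneg) (auto simp: site_prob_def)
    then show "(\<Prod>i=1..n. site_prob T f x i (\<sigma> i)) \<le> gibbs_weight T f J \<beta> n x \<sigma>" by simp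
  qed
  finally show ?thesis by simp
qed

lemma integral_gibbs:
  fixes g :: "(nat \<Rightarrow> real) \<Rightarrow> real"
  assumes f: "\<And>y. f y \<in> {0..1}"
  shows "(\<integral>\<sigma>. g \<sigma> \<partial>gibbs T f J \<beta> n x) =
    (\<Sum>\<sigma>\<in>configs n. gibbs_weight T f J \<beta> n x \<sigma> * g \<sigma>) / (\<Sum>\<sigma>\<in>configs n. gibbs_weight T f J \<beta> n x \<sigma>)"
  unfolding gibbs_def using gibbs_weight_nonneg[OF f]
  by (subst lebesgue_integral_point_measure_finite)
     (auto simp: finite_configs sum_divide_distrib intro!: divide_nonneg_nonneg sum_nonneg)

lemma prob_space_gibbs:
  assumes f: "\<And>y. f y \<in> {0..1}" and B: "\<beta> * J \<ge> 0"
  shows "prob_space (gibbs T f J \<beta> n x)"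
proof
  define W where "W = (\<Sum>\<sigma>\<in>configs n. gibbs_weight T f J \<beta> n x \<sigma>)"
  have W: "W > 0" unfolding W_def using partition_function_pos[of f \<beta> J] f B by blast
  have "emeasure (gibbs T f J \<beta> n x) (space (gibbs T f J \<beta> n x)) =
      (\<Sum>\<sigma>\<in>configs n. ennreal (gibbs_weight T f J \<beta> n x \<sigma> / W))"
    unfolding gibbs_def space_point_measure W_def
    by (rule emeasure_point_measure_finite[OF finite_configs order_refl])
  also have "\<dots> = ennreal (\<Sum>\<sigma>\<in>configs n. gibbs_weight T f J \<beta> n x \<sigma> / W)"
    using gibbs_weight_nonneg[of f] f W by (intro sum_ennreal) (auto intro!: divide_nonneg_pos)
  also have "(\<Sum>\<sigma>\<in>configs n. gibbs_weight T f J \<beta> n x \<sigma> / W) = 1"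
    using W by (simp add: sum_divide_distrib[symmetric] W_def[symmetric])
  finally show "emeasure (gibbs T f J \<beta> n x) (space (gibbs T f J \<beta> n x)) = 1" by simp
qed

text \<open>The ratio of integrals is the Gibbs expectation of the smeared \<open>F\<close>. The
  modulus is quadratic because its Gaussian average is then \<open>\<epsilon>\<close> plus
  \<open>C\<close> times the variance 1/(n \<open>\<beta>\<close> \<open>J\<close>). Only base
  points \<open>y\<close> in [-1, 1] occur, since the magnetization is at most \<open>n\<close> in
  absolute value.\<close>

lemma gibbs_expectation_approx:
  fixes F :: "real \<Rightarrow> real" and T :: "'a \<Rightarrow> 'a" and f :: "'a \<Rightarrow> real" and x :: 'a
  assumes f: "\<And>y. f y \<in> {0..1}" and n: "n \<ge> 1" and B: "\<beta> * J > 0"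
    and F [measurable]: "F \<in> borel_measurable borel" and bd: "\<And>s. \<bar>F s\<bar> \<le> K"
    and mod: "\<And>y z. \<bar>y\<bar> \<le> 1 \<Longrightarrow> \<bar>F z - F y\<bar> \<le> \<epsilon> + C * (z - y)\<^sup>2"
  defines "E \<equiv> \<lambda>s. exp (- real n * G_emp (\<lambda>i. f ((T ^^ i) x)) (\<beta> * J) n 0 s)"
  shows "\<bar>(\<integral>\<sigma>. F (magnetization n \<sigma> / real n) \<partial>gibbs T f J \<beta> n x) - (\<integral>s. F s * E s \<partial>lborel) / (\<integral>s. E s \<partial>lborel)\<bar>
    \<le> \<epsilon> + C / (real n * (\<beta> * J))"
proof -
  define w where "w = gibbs_weight T f J \<beta> n x"
  define W where "W = (\<Sum>\<sigma>\<in>configs n. w \<sigma>)"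
  define v where "v = 1 / sqrt (real n * (\<beta> * J))"
  define c where "c = sqrt (real n * (\<beta> * J) / (2 * pi))"
  define y where "y \<sigma> = magnetization n \<sigma> / real n" for \<sigma>
  define KF where "KF \<sigma> = (\<integral>s. normal_density (y \<sigma>) v s * F s \<partial>lborel)" for \<sigma>
  have v: "v > 0" "v\<^sup>2 = 1 / (real n * (\<beta> * J))" using n B by (auto simp: v_def power_divide)
  have c: "c > 0" using n B by (simp add: c_def)
  have W: "W > 0" unfolding W_def w_def using partition_function_pos[of f \<beta> J] f B by (meson less_imp_le)
  have w: "w \<sigma> \<ge> 0" for \<sigma> unfolding w_def by (rule gibbs_weight_nonneg[OF f])
  have 1: "(\<Sum>\<sigma>\<in>configs n. w \<sigma> * KF \<sigma>) = c * (\<integral>s. F s * E s \<partial>lborel)"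
    unfolding w_def KF_def c_def v_def y_def E_def by (rule hubbard_stratonovich(1)[OF f n B F bd])
  have 2: "W = c * (\<integral>s. E s \<partial>lborel)"
    using hubbard_stratonovich(1)[OF f n B, where F = "\<lambda>_. 1" and K = 1 and x = x and T = T] v(1)
    unfolding W_def w_def c_def v_def y_def E_def by simp
  have ratio: "(\<integral>s. F s * E s \<partial>lborel) / (\<integral>s. E s \<partial>lborel) = (\<Sum>\<sigma>\<in>configs n. w \<sigma> * KF \<sigma>) / W"
    unfolding 1 2 using c by simp
  have KF: "\<bar>F (y \<sigma>) - KF \<sigma>\<bar> \<le> \<epsilon> + C * v\<^sup>2" if \<sigma>: "\<sigma> \<in> configs n" for \<sigma>
  proof -
    define N where "N = normal_density (y \<sigma>) v"
    have y1: "\<bar>y \<sigma>\<bar> \<le> 1" using abs_magnetization_le[OF \<sigma>] n by (simp add: y_def)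
    have iN: "integrable lborel N" "(\<integral>s. N s \<partial>lborel) = 1" using v(1) by (auto simp: N_def)
    have iN2: "integrable lborel (\<lambda>s. N s * (s - y \<sigma>)\<^sup>2)" "(\<integral>s. N s * (s - y \<sigma>)\<^sup>2 \<partial>lborel) = v\<^sup>2"
      using integrable_normal_moment[OF v(1), of "y \<sigma>" 2] integral_normal_moment_even[OF v(1), of "y \<sigma>" 1]
      by (auto simp: N_def fact_numeral)
    have iNF: "integrable lborel (\<lambda>s. N s * F s)"
    proof (rule Bochner_Integration.integrable_bound)
      show "integrable lborel (\<lambda>s. K * N s)" by (intro integrable_mult_right iN)
      show "AE s in lborel. norm (N s * F s) \<le> norm (K * N s)"
      proof (rule AE_I2)
        fix s
        have "\<bar>F s\<bar> \<le> \<bar>K\<bar>" using bd[of s] by linarith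
        then show "norm (N s * F s) \<le> norm (K * N s)"
          by (simp add: abs_mult mult.commute mult_right_mono)
      qed
    qed (simp add: N_def)
    have iC: "integrable lborel (\<lambda>s. \<epsilon> * N s + C * (N s * (s - y \<sigma>)\<^sup>2))"
      by (intro Bochner_Integration.integrable_add integrable_mult_right iN iN2)
    have iD: "integrable lborel (\<lambda>s. N s * F s - F (y \<sigma>) * N s)"
      by (intro Bochner_Integration.integrable_diff integrable_mult_right iN iNF)
    have "KF \<sigma> - F (y \<sigma>) = (\<integral>s. N s * F s - F (y \<sigma>) * N s \<partial>lborel)"
      using iN iNF by (simp add: KF_def N_def[symmetric])
    also have "\<bar>\<dots>\<bar> \<le> (\<integral>s. \<bar>N s * F s - F (y \<sigma>) * N s\<bar> \<partial>lborel)" by (rule integral_abs_bound)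
    also have "\<dots> \<le> (\<integral>s. \<epsilon> * N s + C * (N s * (s - y \<sigma>)\<^sup>2) \<partial>lborel)"
    proof (rule integral_mono[OF integrable_abs[OF iD] iC])
      fix s
      have "\<bar>N s * F s - F (y \<sigma>) * N s\<bar> = N s * \<bar>F s - F (y \<sigma>)\<bar>"
      proof -
        have "N s * F s - F (y \<sigma>) * N s = N s * (F s - F (y \<sigma>))" by (simp add: algebra_simps)
        then show ?thesis by (simp add: abs_mult N_def)
      qed
      also have "\<dots> \<le> N s * (\<epsilon> + C * (s - y \<sigma>)\<^sup>2)"
        by (intro mult_left_mono mod y1) (simp add: N_def)
      finally show "\<bar>N s * F s - F (y \<sigma>) * N s\<bar> \<le> \<epsilon> * N s + C * (N s * (s - y \<sigma>)\<^sup>2)"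
        by (simp add: algebra_simps)
    qed
    also have "\<dots> = \<epsilon> + C * v\<^sup>2" using iN iN2 by simp
    finally show ?thesis by (simp add: abs_minus_commute)
  qed
  have "(\<integral>\<sigma>. F (y \<sigma>) \<partial>gibbs T f J \<beta> n x) - (\<integral>s. F s * E s \<partial>lborel) / (\<integral>s. E s \<partial>lborel) =
      (\<Sum>\<sigma>\<in>configs n. w \<sigma> * (F (y \<sigma>) - KF \<sigma>)) / W"
    unfolding ratio integral_gibbs[OF f] w_def[symmetric] W_def[symmetric]
    by (simp add: right_diff_distrib sum_subtractf diff_divide_distrib)
  moreover have "\<bar>\<Sum>\<sigma>\<in>configs n. w \<sigma> * (F (y \<sigma>) - KF \<sigma>)\<bar> \<le> (\<Sum>\<sigma>\<in>configs n. w \<sigma> * (\<epsilon> + C * v\<^sup>2))"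
    by (rule order_trans[OF sum_abs sum_mono]) (simp add: abs_mult w KF mult_left_mono)
  ultimately have "\<bar>(\<integral>\<sigma>. F (y \<sigma>) \<partial>gibbs T f J \<beta> n x) - (\<integral>s. F s * E s \<partial>lborel) / (\<integral>s. E s \<partial>lborel)\<bar>
      \<le> (W * (\<epsilon> + C * v\<^sup>2)) / W"
    using W by (simp add: sum_distrib_right[symmetric] W_def[symmetric] pos_divide_le_eq mult.commute)
  then show ?thesis using W v(2) by (simp add: y_def)
qed

section \<open>Laplace's method\<close>

lemma lipschitz_pointwise_imp_uniform:
  fixes H :: "nat \<Rightarrow> real \<Rightarrow> real"
  assumes D: "compact D" and lip: "\<And>n s t. \<bar>H n s - H n t\<bar> \<le> L * \<bar>s - t\<bar>"
    and conv: "\<And>s. (\<lambda>n. H n s) \<longlonglongrightarrow> h s" and \<epsilon>: "\<epsilon> > 0"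
  shows "\<forall>\<^sub>F n in sequentially. \<forall>s\<in>D. \<bar>H n s - h s\<bar> < \<epsilon>"
proof -
  have L: "L \<ge> 0" using lip[of 0 1 0] by simp
  have liph: "\<bar>h s - h t\<bar> \<le> L * \<bar>s - t\<bar>" for s t
  proof (rule tendsto_upperbound)
    show "(\<lambda>n. \<bar>H n s - H n t\<bar>) \<longlonglongrightarrow> \<bar>h s - h t\<bar>" by (intro tendsto_intros conv)
  qed (auto simp: lip)
  define \<rho> where "\<rho> = \<epsilon> / (4 * (L + 1))"
  have \<rho>: "\<rho> > 0" "L * \<rho> \<le> \<epsilon> / 4" using L \<epsilon> by (auto simp: \<rho>_def field_simps)
  obtain P where P: "finite P" "D \<subseteq> (\<Union>t\<in>P. ball t \<rho>)"
    using D \<rho>(1) unfolding compact_eq_totally_bounded by blast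
  have "\<forall>\<^sub>F n in sequentially. \<bar>H n t - h t\<bar> < \<epsilon> / 4" for t
    using tendstoD[OF conv[of t], of "\<epsilon> / 4"] \<epsilon> by (simp add: dist_real_def)
  then have "\<forall>\<^sub>F n in sequentially. \<forall>t\<in>P. \<bar>H n t - h t\<bar> < \<epsilon> / 4"
    using P(1) by (simp add: eventually_ball_finite)
  then show ?thesis
  proof eventually_elim
    case (elim n)
    show ?case
    proof
      fix s assume "s \<in> D"
      then obtain t where t: "t \<in> P" "\<bar>t - s\<bar> < \<rho>" using P(2) by (auto simp: dist_real_def)
      have "L * \<bar>s - t\<bar> \<le> \<epsilon> / 4" using t \<rho> L mult_left_mono[of "\<bar>s - t\<bar>" \<rho> L] by linarith
      then show "\<bar>H n s - h s\<bar> < \<epsilon>"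
        using lip[of n s t] liph[of s t] bspec[OF elim t(1)] \<epsilon> by linarith
    qed
  qed
qed

text \<open>Far out, the quadratic term beats the linear growth of \<open>H\<close>, uniformly in
  \<open>n\<close>; on the remaining compact set there is a positive gap, which survives uniform
  convergence. The term \<open>(s - p)\<^sup>2\<close> in the conclusion later provides Gaussian
  domination of the tails.\<close>

lemma quadratic_minus_lipschitz_tail:
  fixes H :: "nat \<Rightarrow> real \<Rightarrow> real"
  assumes B: "B > 0" and lip: "\<And>n s t. \<bar>H n s - H n t\<bar> \<le> B * \<bar>s - t\<bar>" and H0: "\<And>n. H n 0 = 0"
    and conv: "\<And>s. (\<lambda>n. H n s) \<longlonglongrightarrow> h s"
    and S: "closed S" and min: "\<And>s. s \<in> S \<Longrightarrow> s \<noteq> p \<Longrightarrow> B / 2 * p\<^sup>2 - h p < B / 2 * s\<^sup>2 - h s"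
    and \<delta>: "\<delta> > 0"
  shows "\<exists>\<eta>>0. \<forall>\<^sub>F n in sequentially. \<forall>s\<in>S. \<delta> \<le> \<bar>s - p\<bar> \<longrightarrow>
           B / 2 * p\<^sup>2 - H n p + \<eta> * (1 + (s - p)\<^sup>2) \<le> B / 2 * s\<^sup>2 - H n s"
proof -
  define G where "G s = B / 2 * s\<^sup>2 - h s" for s
  define Gn where "Gn n s = B / 2 * s\<^sup>2 - H n s" for n s
  have liph: "\<bar>h s - h t\<bar> \<le> B * \<bar>s - t\<bar>" for s t
  proof (rule tendsto_upperbound)
    show "(\<lambda>n. \<bar>H n s - H n t\<bar>) \<longlonglongrightarrow> \<bar>h s - h t\<bar>" by (intro tendsto_intros conv)
  qed (auto simp: lip)
  have conth: "continuous_on UNIV h"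
  proof -
    have "B-lipschitz_on UNIV h" using B liph by (auto simp: lipschitz_on_def dist_real_def)
    then show ?thesis by (rule lipschitz_on_continuous_on)
  qed
  \<comment> \<open>Of \<open>B / 2 * s\<^sup>2\<close>, one quarter (that is,
    \<open>B / 8 * s\<^sup>2\<close>) pays for \<open>H\<close>, one quarter for \<open>Q\<close>,
    and one half for the part of \<open>B / 8 * (s - p)\<^sup>2\<close> that depends on
    \<open>s\<close>; the rest of that square and the constants are collected in \<open>Q\<close>.
    The 8 in \<open>R\<close> makes \<open>\<bar>s\<bar>\<close> at most
    \<open>s\<^sup>2 / 8\<close>.\<close>
  define Q where "Q = \<bar>G p\<bar> + 1 + B / 8 + B / 4 * p\<^sup>2"
  define R where "R = 8 + Q / B"
  have Q: "Q \<ge> 0" using B by (simp add: Q_def)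
  have R: "R \<ge> 8" using Q B by (simp add: R_def)
  have far: "G p + 1 + B / 8 * (1 + (s - p)\<^sup>2) \<le> Gn n s" if "R \<le> \<bar>s\<bar>" for n s
  proof -
    have "H n s \<le> B * \<bar>s\<bar>" using lip[of n s 0] H0[of n] by simp
    moreover have "B * \<bar>s\<bar> \<le> B * (s\<^sup>2 / 8)"
    proof (rule mult_left_mono)
      have "8 * \<bar>s\<bar> \<le> \<bar>s\<bar> * \<bar>s\<bar>" using that R by (intro mult_right_mono) auto
      then show "\<bar>s\<bar> \<le> s\<^sup>2 / 8" by (simp add: power2_eq_square)
    qed (use B in simp)
    moreover have "Q \<le> B * \<bar>s\<bar>"
    proof -
      have "B * R \<le> B * \<bar>s\<bar>" using that B by simp
      moreover have "B * R = 8 * B + Q" using B by (simp add: R_def field_simps)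
      ultimately show ?thesis using B by linarith
    qed
    moreover have "B / 8 * (s - p)\<^sup>2 \<le> B / 4 * s\<^sup>2 + B / 4 * p\<^sup>2"
    proof -
      have "(s - p)\<^sup>2 \<le> 2 * s\<^sup>2 + 2 * p\<^sup>2"
        using zero_le_power2[of "s + p"] by (simp add: power2_eq_square algebra_simps)
      then have "B / 8 * (s - p)\<^sup>2 \<le> B / 8 * (2 * s\<^sup>2 + 2 * p\<^sup>2)" using B by (intro mult_left_mono) auto
      then show ?thesis by (simp add: algebra_simps)
    qed
    ultimately have "G p + 1 + B / 8 + B / 8 * (s - p)\<^sup>2 \<le> B / 2 * s\<^sup>2 - H n s"
      unfolding Q_def using abs_ge_self[of "G p"] by linarith
    then show ?thesis by (simp add: Gn_def distrib_left)
  qed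
  define D where "D = S \<inter> {s. \<delta> \<le> \<bar>s - p\<bar>} \<inter> cball 0 R"
  have "closed {s. \<delta> \<le> \<bar>s - p\<bar>}" by (intro closed_Collect_le continuous_intros)
  then have D: "compact D" unfolding D_def using S
    by (metis closed_Int_compact closed_Int compact_cball)
  \<comment> \<open>A quarter of the gap: the approximation errors at \<open>p\<close> and at
    \<open>s\<close> and the growth term cost at most one \<open>\<theta>\<close> each.\<close>
  obtain \<theta> where \<theta>: "\<theta> > 0" "\<And>s. s \<in> D \<Longrightarrow> G p + 4 * \<theta> \<le> G s"
  proof (cases "D = {}")
    case True then show ?thesis using that[of 1] by auto
  next
    case False
    have "continuous_on D G" unfolding G_def
      by (intro continuous_intros continuous_on_subset[OF conth]) auto
    from continuous_attains_inf[OF D False this] obtain s0 where s0: "s0 \<in> D" "\<And>s. s \<in> D \<Longrightarrow> G s0 \<le> G s" by blast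
    have "G p < G s0" using s0(1) \<delta> min[of s0] by (auto simp: D_def G_def)
    then show ?thesis using s0(2) by (intro that[of "(G s0 - G p) / 4"]) (auto simp: field_simps)
  qed
  define \<eta> where "\<eta> = min (B / 8) (\<theta> / (1 + (R + \<bar>p\<bar>)\<^sup>2))"
  have pos: "1 + (R + \<bar>p\<bar>)\<^sup>2 > 0" using zero_le_power2[of "R + \<bar>p\<bar>"] by linarith
  have \<eta>8: "\<eta> \<le> B / 8" unfolding \<eta>_def by (rule min.cobounded1)
  have \<eta>: "\<eta> > 0" using B \<theta> pos by (simp add: \<eta>_def)
  have "\<forall>\<^sub>F n in sequentially. \<forall>s\<in>insert p D. \<bar>H n s - h s\<bar> < min \<theta> 1"
    using \<theta>(1) by (intro lipschitz_pointwise_imp_uniform[OF _ lip conv] compact_insert D) auto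
  then have "\<forall>\<^sub>F n in sequentially. \<forall>s\<in>S. \<delta> \<le> \<bar>s - p\<bar> \<longrightarrow> Gn n p + \<eta> * (1 + (s - p)\<^sup>2) \<le> Gn n s"
  proof eventually_elim
    case (elim n)
    have p: "Gn n p \<le> G p + \<theta>" "Gn n p \<le> G p + 1" using elim by (auto simp: Gn_def G_def)
    show ?case
    proof (intro ballI impI)
      fix s assume s: "s \<in> S" "\<delta> \<le> \<bar>s - p\<bar>"
      show "Gn n p + \<eta> * (1 + (s - p)\<^sup>2) \<le> Gn n s"
      proof (cases "R \<le> \<bar>s\<bar>")
        case True
        have "\<eta> * (1 + (s - p)\<^sup>2) \<le> B / 8 * (1 + (s - p)\<^sup>2)" 
          using \<eta>8 by (intro mult_right_mono) auto
        then show ?thesis using far[OF True, of n] p by linarith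
      next
        case False
        then have "s \<in> D" using s by (simp add: D_def)
        then have "G p + 3 * \<theta> \<le> Gn n s" using \<theta>(2)[of s] elim by (force simp: Gn_def G_def)
        moreover have "\<eta> * (1 + (s - p)\<^sup>2) \<le> \<theta> / (1 + (R + \<bar>p\<bar>)\<^sup>2) * (1 + (R + \<bar>p\<bar>)\<^sup>2)"
        proof (rule mult_mono)
          have "\<bar>s - p\<bar> \<le> R + \<bar>p\<bar>" using False by linarith
          then show "1 + (s - p)\<^sup>2 \<le> 1 + (R + \<bar>p\<bar>)\<^sup>2" using power_mono[of "\<bar>s - p\<bar>" _ 2] by simp
        qed (use \<theta> pos in \<open>auto simp: \<eta>_def\<close>)
        ultimately show ?thesis using p pos \<theta>(1) by simp
      qed
    qed
  qed
  then show ?thesis using \<eta> unfolding Gn_def by blast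
qed

section \<open>Rescaling near the minimum\<close>

lemma integrable_gaussian: "c > 0 \<Longrightarrow> integrable lborel (\<lambda>t::real. exp (- c * t\<^sup>2))"
proof -
  assume c: "c > 0"
  define \<sigma> where "\<sigma> = 1 / sqrt (2 * c)"
  have \<sigma>: "\<sigma> > 0" "2 * \<sigma>\<^sup>2 = 1 / c" using c by (auto simp: \<sigma>_def power_divide)
  have "integrable lborel (\<lambda>t. sqrt (2 * pi * \<sigma>\<^sup>2) * normal_density 0 \<sigma> t)"
    using \<sigma> by (intro integrable_mult_right integrable_normal_density)
  moreover have "sqrt (2 * pi * \<sigma>\<^sup>2) * normal_density 0 \<sigma> t = exp (- c * t\<^sup>2)" for t
    using \<sigma> c unfolding normal_density_def by (simp add: field_simps)
  ultimately show ?thesis by simp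
qed

lemma abs_power_le_one_plus_even_power:
  fixes t :: real
  assumes "j \<le> 2 * k"
  shows "\<bar>t\<bar> ^ j \<le> 1 + t ^ (2 * k)"
proof (cases "\<bar>t\<bar> \<le> 1")
  case True
  then have "\<bar>t\<bar> ^ j \<le> 1" by (simp add: power_le_one)
  moreover have "t ^ (2 * k) \<ge> 0" by (simp add: zero_le_even_power)
  ultimately show ?thesis by linarith
next
  case False
  then have "\<bar>t\<bar> ^ j \<le> \<bar>t\<bar> ^ (2 * k)" using assms by (intro power_increasing) auto
  then show ?thesis by (simp add: power_even_abs)
qed


text \<open>\<open>F n j\<close> is the \<open>j\<close>-th derivative of \<open>F n 0\<close>. Substituting \<open>s = p + t n\<^sup>-\<^sup>1\<^sup>/\<^sup>(\<^sup>2\<^sup>k\<^sup>)\<close> turns the Taylor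
  coefficients at \<open>p\<close> into the sequences of \<open>coeff\<close> and \<open>lead\<close>.\<close>

lemma laplace_asymptotics:
  fixes F :: "nat \<Rightarrow> nat \<Rightarrow> real \<Rightarrow> real" and g :: "nat \<Rightarrow> real \<Rightarrow> real"
  assumes k: "k \<ge> 1"
    and F: "\<And>n j s. (F n j has_real_derivative F n (Suc j) s) (at s)"
    and C: "\<And>n s. \<bar>F n (2 * k + 1) s\<bar> \<le> C"
    and coeff: "\<And>j. 1 \<le> j \<Longrightarrow> j < 2 * k \<Longrightarrow>
      (\<lambda>n. real n powr (1 - real j / real (2 * k)) * F n j p) \<longlonglongrightarrow> 0"
    and lead: "(\<lambda>n. F n (2 * k) p) \<longlonglongrightarrow> l" and l: "l > 0"
    and tail: "\<And>\<delta>. \<delta> > 0 \<Longrightarrow> \<exists>\<eta>>0. \<forall>\<^sub>F n in sequentially. \<forall>s\<in>S. \<delta> \<le> \<bar>s - p\<bar> \<longrightarrow>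
      F n 0 p + \<eta> * (1 + (s - p)\<^sup>2) \<le> F n 0 s"
    and S: "S \<in> sets borel" "p \<in> interior S"
    and g: "\<And>n. g n \<in> borel_measurable borel" "\<And>n t. \<bar>g n t\<bar> \<le> K" "\<And>t. (\<lambda>n. g n t) \<longlonglongrightarrow> g' t"
  shows "(\<lambda>n. real n powr (1 / real (2 * k)) * exp (real n * F n 0 p) *
      (\<integral>s. indicator S s * g n (real n powr (1 / real (2 * k)) * (s - p)) * exp (- real n * F n 0 s) \<partial>lborel))
    \<longlonglongrightarrow> (\<integral>t. g' t * exp (- l * t ^ (2 * k) / fact (2 * k)) \<partial>lborel)"
proof -
  define \<kappa> where "\<kappa> = 1 / real (2 * k)"
  define r where "r n = real n powr \<kappa>" for n :: nat
  have \<kappa>: "\<kappa> > 0" "\<kappa> \<le> 1 / 2" "real (2 * k) * \<kappa> = 1" using k by (auto simp: \<kappa>_def field_simps)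
  have r_pos: "r n > 0" if "n \<ge> 1" for n using that by (simp add: r_def)
  have r_inv: "(\<lambda>n. c / r n) \<longlonglongrightarrow> 0" for c
  proof -
    have "(\<lambda>n. c * real n powr - \<kappa>) \<longlonglongrightarrow> c * 0"
      using \<kappa>(1) by (intro tendsto_intros tendsto_neg_powr filterlim_real_sequentially) auto
    then show ?thesis by (simp add: r_def powr_minus divide_inverse)
  qed
  define \<psi> where "\<psi> n t = real n * (F n 0 (p + t / r n) - F n 0 p)" for n t
  define e where "e n j = real n powr (1 - real j * \<kappa>) * F n j p" for n j
  have e0: "(\<lambda>n. e n j) \<longlonglongrightarrow> 0" if "1 \<le> j" "j < 2 * k" for j
    using coeff[OF that] by (simp add: e_def \<kappa>_def)
  have el: "(\<lambda>n. e n (2 * k)) \<longlonglongrightarrow> l"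
  proof (rule Lim_transform_eventually[OF lead])
    show "\<forall>\<^sub>F n in sequentially. F n (2 * k) p = e n (2 * k)"
      using eventually_ge_at_top[of 1] by eventually_elim (simp add: e_def \<kappa>(3)[simplified])
  qed
  have C0: "C \<ge> 0" using order_trans[OF abs_ge_zero C] .
  have pow: "real n * (t / r n) ^ j = real n powr (1 - real j * \<kappa>) * t ^ j" if "n \<ge> 1" for n j t
    using that by (simp add: r_def power_divide powr_diff powr_power mult.commute)
  have taylor: "\<bar>\<psi> n t - (\<Sum>j=1..2*k. e n j / fact j * t ^ j)\<bar> \<le> C * \<bar>t\<bar> ^ (2 * k + 1) / r n"
    if n: "n \<ge> 1" for n t
  proof -
    define h where "h = t / r n"
    have "\<bar>F n 0 (p + h) - (\<Sum>j<2*k+1. F n j p / fact j * h ^ j)\<bar> \<le> C / fact (2 * k + 1) * \<bar>h\<bar> ^ (2 * k + 1)"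
      by (rule taylor_bound[OF F C])
    also have "\<dots> \<le> C / 1 * \<bar>h\<bar> ^ (2 * k + 1)"
    proof -
      have "(1::real) \<le> fact m" for m by (rule fact_ge_1)
      then have "C / fact m \<le> C / 1" for m using C0 by (intro divide_left_mono) auto
      then show ?thesis by (rule mult_right_mono) simp
    qed
    also have "(\<Sum>j<2*k+1. F n j p / fact j * h ^ j) = F n 0 p + (\<Sum>j=1..2*k. F n j p / fact j * h ^ j)"
      by (simp add: lessThan_Suc_atMost atMost_atLeast0 sum.atLeast_Suc_atMost)
    finally have "real n * \<bar>F n 0 (p + h) - (F n 0 p + (\<Sum>j=1..2*k. F n j p / fact j * h ^ j))\<bar>
        \<le> real n * (C * \<bar>h\<bar> ^ (2 * k + 1))" by (intro mult_left_mono) auto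
    moreover have "real n * \<bar>F n 0 (p + h) - (F n 0 p + (\<Sum>j=1..2*k. F n j p / fact j * h ^ j))\<bar> =
        \<bar>\<psi> n t - (\<Sum>j=1..2*k. real n * (F n j p / fact j * h ^ j))\<bar>"
      by (subst abs_of_nonneg[of "real n", symmetric], simp, subst abs_mult[symmetric])
         (simp add: \<psi>_def h_def sum_distrib_left algebra_simps)
    moreover have "real n * (F n j p / fact j * h ^ j) = e n j / fact j * t ^ j" for j
      using pow[OF n, of t j] by (simp add: e_def h_def)
    moreover have "real n * (C * \<bar>h\<bar> ^ (2 * k + 1)) = C * \<bar>t\<bar> ^ (2 * k + 1) / r n"
    proof -
      have "real n * \<bar>h\<bar> ^ (2 * k + 1) = real n powr (1 - real (2 * k + 1) * \<kappa>) * \<bar>t\<bar> ^ (2 * k + 1)"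
        using pow[OF n, of "\<bar>t\<bar>" "2 * k + 1"] r_pos[OF n] by (simp add: h_def abs_divide)
      moreover have m\<kappa>: "1 - real (2 * k + 1) * \<kappa> = - \<kappa>" using \<kappa>(3) by (simp add: algebra_simps)
      ultimately have "real n * \<bar>h\<bar> ^ (2 * k + 1) = \<bar>t\<bar> ^ (2 * k + 1) / r n"
        unfolding m\<kappa> by (simp only: r_def powr_minus divide_inverse mult.commute)
      then have "C * (real n * \<bar>h\<bar> ^ (2 * k + 1)) = C * (\<bar>t\<bar> ^ (2 * k + 1) / r n)" by (rule arg_cong)
      then show ?thesis by (simp only: times_divide_eq_right mult.left_commute[of C])
    qed
    ultimately show ?thesis by simp
  qed
  have \<psi>_lim: "(\<lambda>n. \<psi> n t) \<longlonglongrightarrow> l / fact (2 * k) * t ^ (2 * k)" for t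
  proof -
    have split: "{1..2*k} = insert (2*k) {1..<2*k}" using k by auto
    have "(\<lambda>n. \<Sum>j\<in>{1..<2*k}. e n j / fact j * t ^ j) \<longlonglongrightarrow> (\<Sum>j\<in>{1..<2*k}. 0 / fact j * t ^ j)"
      by (intro tendsto_sum tendsto_mult tendsto_divide tendsto_const e0) auto
    then have "(\<lambda>n. e n (2*k) / fact (2*k) * t ^ (2*k) + (\<Sum>j\<in>{1..<2*k}. e n j / fact j * t ^ j))
        \<longlonglongrightarrow> l / fact (2*k) * t ^ (2*k) + 0"
      by (intro tendsto_add tendsto_mult tendsto_divide tendsto_const el) auto
    then have 1: "(\<lambda>n. \<Sum>j=1..2*k. e n j / fact j * t ^ j) \<longlonglongrightarrow> l / fact (2*k) * t ^ (2*k)"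
      unfolding split by simp
    have "(\<lambda>n. \<psi> n t - (\<Sum>j=1..2*k. e n j / fact j * t ^ j)) \<longlonglongrightarrow> 0"
    proof (rule Lim_null_comparison[OF _ r_inv])
      show "\<forall>\<^sub>F n in sequentially. norm (\<psi> n t - (\<Sum>j=1..2*k. e n j / fact j * t ^ j)) \<le> C * \<bar>t\<bar> ^ (2 * k + 1) / r n"
        using eventually_ge_at_top[of 1] by eventually_elim (use taylor in simp)
    qed
    from tendsto_add[OF this 1] show ?thesis by simp
  qed
  define q0 where "q0 = l / fact (2 * k)"
  have q0: "q0 > 0" using l by (simp add: q0_def)
  \<comment> \<open>Budget for a lower bound on \<open>\<psi>\<close>, with P = t^(2k): three
    quarters of \<open>q0\<close> P survive the convergence of the leading coefficient; the
    intermediate terms, fewer than 2k of them with coefficients within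
    \<open>q0 / (8 * real k)\<close>, cost at most a quarter of \<open>q0\<close> (1 + P); for
    displacements below \<open>\<delta>\<close> the Taylor remainder costs at most another quarter
    of \<open>q0\<close> P.\<close>
  define \<delta> where "\<delta> = q0 / (4 * (C + 1))"
  have \<delta>: "\<delta> > 0" "C * \<delta> \<le> q0 / 4" using q0 C0 by (auto simp: \<delta>_def field_simps)
  obtain \<eta> where \<eta>: "\<eta> > 0" and tail\<eta>: "\<forall>\<^sub>F n in sequentially. \<forall>s\<in>S. \<delta> \<le> \<bar>s - p\<bar> \<longrightarrow>
      F n 0 p + \<eta> * (1 + (s - p)\<^sup>2) \<le> F n 0 s" using tail[OF \<delta>(1)] by blast
  define c where "c = min (q0 / 4) \<eta>"
  have c: "c > 0" "c \<le> q0 / 4" "c \<le> \<eta>" using q0 \<eta> by (auto simp: c_def)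
  have "\<forall>\<^sub>F n in sequentially. \<forall>j\<in>{1..<2*k}. \<bar>e n j\<bar> < q0 / (8 * real k)"
  proof (rule eventually_ball_finite)
    show "\<forall>j\<in>{1..<2*k}. \<forall>\<^sub>F n in sequentially. \<bar>e n j\<bar> < q0 / (8 * real k)"
    proof
      fix j assume "j \<in> {1..<2*k}"
      then have "(\<lambda>n. e n j) \<longlonglongrightarrow> 0" by (intro e0) auto
      moreover have "q0 / (8 * real k) > 0" using q0 k by simp
      ultimately show "\<forall>\<^sub>F n in sequentially. \<bar>e n j\<bar> < q0 / (8 * real k)"
        using tendstoD by fastforce
    qed
  qed simp
  moreover have "(\<lambda>n. e n (2*k) / fact (2*k)) \<longlonglongrightarrow> q0"
    unfolding q0_def by (intro tendsto_divide el tendsto_const) simp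
  then have "\<forall>\<^sub>F n in sequentially. 3 / 4 * q0 < e n (2*k) / fact (2*k)"
    by (rule order_tendstoD) (use q0 in simp)
  \<comment> \<open>One Gaussian bound for both regions. It is quadratic in \<open>t\<close> and not
    of degree 2k, since far from \<open>p\<close> only quadratic growth is available.\<close>
  ultimately have low: "\<forall>\<^sub>F n in sequentially. n \<ge> 1 \<and> (\<forall>t. p + t / r n \<in> S \<longrightarrow> c * t\<^sup>2 - q0 / 2 \<le> \<psi> n t)"
    using tail\<eta> eventually_ge_at_top[of 1]
  proof eventually_elim
    case (elim n)
    note n = elim(4)
    have rn: "r n > 0" using n by (rule r_pos)
    have "c * t\<^sup>2 - q0 / 2 \<le> \<psi> n t" if t: "p + t / r n \<in> S" for t
    proof (cases "\<delta> \<le> \<bar>t / r n\<bar>")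
      case True
      \<comment> \<open>This uses 1/(2k) <= 1/2: the tail growth
        \<open>\<eta> * (t / r n)\<^sup>2\<close>, multiplied by \<open>n\<close>, is then at least
        \<open>\<eta> * t\<^sup>2\<close>.\<close>
      have "(r n)\<^sup>2 \<le> real n"
      proof -
        have "(r n)\<^sup>2 = real n powr (2 * \<kappa>)" using n by (simp add: r_def powr_power mult.commute)
        also have "\<dots> \<le> real n powr 1" using \<kappa>(2) n by (intro powr_mono) auto
        finally show ?thesis using n by simp
      qed
      then have "1 \<le> real n / (r n)\<^sup>2" using rn by (simp add: le_divide_eq)
      then have "\<eta> * t\<^sup>2 * 1 \<le> \<eta> * t\<^sup>2 * (real n / (r n)\<^sup>2)" using \<eta> by (intro mult_left_mono) auto
      then have "\<eta> * t\<^sup>2 \<le> real n * (\<eta> * (t / r n)\<^sup>2)" by (simp add: power_divide mult_ac)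
      also have "\<dots> \<le> real n * (\<eta> * (1 + (t / r n)\<^sup>2))" using \<eta> by (intro mult_left_mono) auto
      also have "\<dots> \<le> \<psi> n t" unfolding \<psi>_def using elim(3) t True by (intro mult_left_mono) force+
      finally have "\<eta> * t\<^sup>2 \<le> \<psi> n t" .
      moreover have "c * t\<^sup>2 \<le> \<eta> * t\<^sup>2" using c by (intro mult_right_mono) auto
      ultimately show ?thesis using q0 by linarith
    next
      case False
      define P where "P = t ^ (2 * k)"
      have P: "P \<ge> 0" by (simp add: P_def zero_le_even_power)
      have "C * \<bar>t\<bar> ^ (2 * k + 1) / r n = C * \<bar>t / r n\<bar> * P"
        using rn by (simp add: P_def abs_divide power_even_abs mult_ac)
      also have "\<dots> \<le> C * \<delta> * P" using False C0 P by (intro mult_right_mono mult_left_mono) auto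
      also have "\<dots> \<le> q0 / 4 * P" using \<delta> P by (intro mult_right_mono)
      finally have R: "C * \<bar>t\<bar> ^ (2 * k + 1) / r n \<le> q0 / 4 * P" .
      have "\<bar>\<Sum>j\<in>{1..<2*k}. e n j / fact j * t ^ j\<bar> \<le> (\<Sum>j\<in>{1..<2*k}. q0 / (8 * real k) * (1 + P))"
      proof (rule order_trans[OF sum_abs sum_mono])
        fix j assume j: "j \<in> {1..<2*k}"
        have "\<bar>e n j / fact j\<bar> \<le> \<bar>e n j\<bar> / 1"
          unfolding abs_divide by (simp add: divide_le_eq mult_le_cancel_left1 fact_ge_1)
        then have "\<bar>e n j / fact j\<bar> \<le> q0 / (8 * real k)" using elim(1) j by fastforce
        then have "\<bar>e n j / fact j\<bar> * \<bar>t\<bar> ^ j \<le> q0 / (8 * real k) * (1 + P)"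
          unfolding P_def using abs_power_le_one_plus_even_power[of j k t] j q0 by (intro mult_mono) auto
        then show "\<bar>e n j / fact j * t ^ j\<bar> \<le> q0 / (8 * real k) * (1 + P)" by (simp add: abs_mult power_abs)
      qed
      also have "\<dots> = real (2 * k - 1) * (q0 / (8 * real k) * (1 + P))" by simp
      also have "\<dots> \<le> real (2 * k) * (q0 / (8 * real k) * (1 + P))"
        using q0 P by (intro mult_right_mono) auto
      also have "\<dots> = q0 / 4 * (1 + P)" using k by (simp add: field_simps)
      finally have M: "\<bar>\<Sum>j\<in>{1..<2*k}. e n j / fact j * t ^ j\<bar> \<le> q0 / 4 * (1 + P)" .
      have split: "{1..2*k} = insert (2*k) {1..<2*k}" using k by auto
      have "(\<Sum>j=1..2*k. e n j / fact j * t ^ j) = e n (2*k) / fact (2*k) * P + (\<Sum>j\<in>{1..<2*k}. e n j / fact j * t ^ j)"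
        unfolding split by (simp add: P_def)
      moreover have "3 / 4 * q0 * P \<le> e n (2*k) / fact (2*k) * P" using elim(2) P by (intro mult_right_mono) auto
      ultimately have "3 / 4 * q0 * P - q0 / 4 * (1 + P) - q0 / 4 * P \<le> \<psi> n t"
        using taylor[OF n, of t] R M by linarith
      then have "q0 / 4 * (1 + P) - q0 / 2 \<le> \<psi> n t" by (simp add: field_simps)
      moreover have "c * t\<^sup>2 \<le> q0 / 4 * (1 + P)"
        using abs_power_le_one_plus_even_power[of 2 k t] k c P q0 unfolding P_def by (intro mult_mono) auto
      ultimately show ?thesis by linarith
    qed
    then show ?case using n by blast
  qed
  then obtain N where N: "\<And>n. n \<ge> N \<Longrightarrow> n \<ge> 1"
      "\<And>n t. n \<ge> N \<Longrightarrow> p + t / r n \<in> S \<Longrightarrow> c * t\<^sup>2 - q0 / 2 \<le> \<psi> n t"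
    unfolding eventually_sequentially by blast
  define u where "u n t = indicator S (p + t / r n) * g n t * exp (- \<psi> n t)" for n t
  have Fm [measurable]: "F n 0 \<in> borel_measurable borel" for n
    using DERIV_isCont[OF F[of n 0]] by (intro borel_measurable_continuous_onI) (simp add: continuous_on_eq_continuous_at)
  note [measurable] = g(1) S(1)
  have g'm [measurable]: "g' \<in> borel_measurable borel"
    by (rule borel_measurable_LIMSEQ_real[OF g(3)]) simp_all
  \<comment> \<open>Dominated convergence asks for the bound at every index, while
    \<open>low\<close> holds from \<open>N\<close> on; hence the shift.\<close>
  have "(\<lambda>n. \<integral>t. u (n + N) t \<partial>lborel) \<longlonglongrightarrow> (\<integral>t. g' t * exp (- (l / fact (2 * k) * t ^ (2 * k))) \<partial>lborel)"
  proof (rule integral_dominated_convergence[where w = "\<lambda>t. K * exp (q0 / 2) * exp (- c * t\<^sup>2)"])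
    show "u (n + N) \<in> borel_measurable lborel" for n unfolding u_def \<psi>_def by measurable
    show "integrable lborel (\<lambda>t. K * exp (q0 / 2) * exp (- c * t\<^sup>2))"
      by (intro integrable_mult_right integrable_gaussian c)
    show "AE t in lborel. (\<lambda>n. u (n + N) t) \<longlonglongrightarrow> g' t * exp (- (l / fact (2 * k) * t ^ (2 * k)))"
    proof (rule AE_I2)
      fix t
      have "(\<lambda>n. p + t / r n) \<longlonglongrightarrow> p + 0" by (intro tendsto_intros r_inv)
      then have "\<forall>\<^sub>F n in sequentially. p + t / r n \<in> interior S"
        using S(2) by (intro topological_tendstoD) auto
      then have "\<forall>\<^sub>F n in sequentially. indicator S (p + t / r n) = (1::real)"
        by eventually_elim (use interior_subset in \<open>auto simp: indicator_def\<close>)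
      then have "(\<lambda>n. indicator S (p + t / r n) :: real) \<longlonglongrightarrow> 1" by (rule tendsto_eventually)
      then have "(\<lambda>n. u n t) \<longlonglongrightarrow> 1 * g' t * exp (- (l / fact (2 * k) * t ^ (2 * k)))"
        unfolding u_def by (intro tendsto_intros g \<psi>_lim)
      then show "(\<lambda>n. u (n + N) t) \<longlonglongrightarrow> g' t * exp (- (l / fact (2 * k) * t ^ (2 * k)))"
        by (intro LIMSEQ_ignore_initial_segment) simp
    qed
    show "AE t in lborel. norm (u (n + N) t) \<le> K * exp (q0 / 2) * exp (- c * t\<^sup>2)" for n
    proof (rule AE_I2)
      fix t
      have K: "K \<ge> 0" using order_trans[OF abs_ge_zero g(2)] .
      show "norm (u (n + N) t) \<le> K * exp (q0 / 2) * exp (- c * t\<^sup>2)"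
      proof (cases "p + t / r (n + N) \<in> S")
        case True
        have "exp (- \<psi> (n + N) t) \<le> exp (q0 / 2 - c * t\<^sup>2)" using N(2)[OF _ True] by simp
        then have "\<bar>g (n + N) t\<bar> * exp (- \<psi> (n + N) t) \<le> K * exp (q0 / 2 - c * t\<^sup>2)"
          using g(2) K by (intro mult_mono) auto
        also have "\<dots> = K * exp (q0 / 2) * exp (- c * t\<^sup>2)"
          by (simp add: exp_add[symmetric] mult.assoc)
        finally show ?thesis using True by (simp add: u_def abs_mult)
      next
        case False then show ?thesis using K by (simp add: u_def)
      qed
    qed
  qed measurable
  then have "(\<lambda>n. \<integral>t. u n t \<partial>lborel) \<longlonglongrightarrow> (\<integral>t. g' t * exp (- (l / fact (2 * k) * t ^ (2 * k))) \<partial>lborel)"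
    by (rule LIMSEQ_offset)
  moreover have "\<forall>\<^sub>F n in sequentially. (\<integral>t. u n t \<partial>lborel) = r n * exp (real n * F n 0 p) *
      (\<integral>s. indicator S s * g n (r n * (s - p)) * exp (- real n * F n 0 s) \<partial>lborel)"
    using eventually_ge_at_top[of 1]
  proof eventually_elim
    case (elim n)
    have rn: "r n > 0" using elim by (rule r_pos)
    have "(\<integral>s. indicator S s * g n (r n * (s - p)) * exp (- real n * F n 0 s) \<partial>lborel) =
        \<bar>1 / r n\<bar> *\<^sub>R (\<integral>t. indicator S (p + 1 / r n * t) * g n (r n * (p + 1 / r n * t - p)) *
            exp (- real n * F n 0 (p + 1 / r n * t)) \<partial>lborel)"
      using rn by (intro lborel_integral_real_affine) simp
    also have "\<dots> = 1 / r n * (\<integral>t. exp (- real n * F n 0 p) * u n t \<partial>lborel)"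
    proof -
      have "indicator S (p + 1 / r n * t) * g n (r n * (p + 1 / r n * t - p)) * exp (- real n * F n 0 (p + 1 / r n * t)) =
          exp (- real n * F n 0 p) * u n t" for t
      proof -
        have "exp (- real n * F n 0 (p + t / r n)) = exp (- real n * F n 0 p) * exp (- \<psi> n t)"
          unfolding exp_add[symmetric] by (simp add: \<psi>_def algebra_simps)
        then show ?thesis using rn by (simp add: u_def mult_ac)
      qed
      then show ?thesis using rn by simp
    qed
    finally show ?case using rn by (simp add: exp_minus field_simps)
  qed
  ultimately show ?thesis
    unfolding r_def \<kappa>_def by (simp add: tendsto_cong)
qed

section \<open>The functions \<open>G\<^sub>\<beta>\<close> under concavity of \<open>\<Lambda>'\<close>\<close>

text \<open>Just to the right of \<open>p\<close> the first nonzero Taylor term beats the remainder.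
  It is applied to G for positivity and to -G to produce negative values of G.\<close>

lemma leading_taylor_coefficient_pos:
  fixes F :: "nat \<Rightarrow> real \<Rightarrow> real"
  assumes F: "\<And>j s. (F j has_real_derivative F (Suc j) s) (at s)"
    and C: "\<And>s. \<bar>F (Suc N) s\<bar> \<le> C"
    and zero: "\<And>j. j < N \<Longrightarrow> F j p = 0" and pos: "F N p > 0"
  shows "\<exists>\<delta>>0. \<forall>h. 0 < h \<and> h < \<delta> \<longrightarrow> F 0 (p + h) > 0"
proof -
  define q where "q = F N p / fact N"
  have q: "q > 0" using pos by (simp add: q_def)
  have C0: "C \<ge> 0" using order_trans[OF abs_ge_zero C] .
  have "F 0 (p + h) > 0" if h: "0 < h" "h < q / (C + 1)" for h
  proof -
    have "(\<Sum>j<Suc N. F j p / fact j * h ^ j) = q * h ^ N" using zero by (simp add: q_def)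
    then have "\<bar>F 0 (p + h) - q * h ^ N\<bar> \<le> C / fact (Suc N) * h ^ Suc N"
      using taylor_bound[of F, OF F C, of p h] h by simp
    also have "\<dots> \<le> C * h ^ Suc N"
    proof -
      have "(1::real) \<le> fact m" for m by (rule fact_ge_1)
      then have "C / fact m \<le> C / 1" for m using C0 by (intro divide_left_mono) auto
      then have "C / fact m \<le> C" for m by simp
      then show ?thesis using h by (intro mult_right_mono) (auto simp del: fact_Suc)
    qed
    also have "\<dots> < q * h ^ N"
    proof -
      have "h * (C + 1) < q" using h(2) C0 by (simp add: pos_less_divide_eq)
      then have "C * h < q" using h(1) by (simp add: algebra_simps)
      then show ?thesis using h(1) by (simp add: mult.assoc[symmetric])
    qed
    finally show ?thesis by linarith
  qed
  then show ?thesis using q C0 by (intro exI[of _ "q / (C + 1)"]) auto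
qed

context tilted_average
begin

lemma G_fun_eq_G_deriv: "G_fun \<mu> f J \<beta> = G_deriv (\<beta> * J) Lambda_deriv 0"
  by (intro ext) (simp add: G_fun_def G_deriv_def Lambda_deriv_0)

lemma DERIV_G:
  "(G_deriv B Lambda_deriv j has_real_derivative G_deriv B Lambda_deriv (Suc j) s) (at s)"
  by (rule DERIV_G_deriv) (rule DERIV_Lambda_deriv)

text \<open>Type and strength are phrased with iterated \<open>deriv\<close>; this gives them the
  explicit derivatives used in the estimates.\<close>

lemma higher_deriv_G_fun: "(deriv ^^ j) (G_fun \<mu> f J \<beta>) = G_deriv (\<beta> * J) Lambda_deriv j"
proof (induction j)
  case 0 then show ?case by (simp add: G_fun_eq_G_deriv)
next
  case (Suc j)
  have "deriv (G_deriv (\<beta> * J) Lambda_deriv j) = G_deriv (\<beta> * J) Lambda_deriv (Suc j)"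
    by (intro ext DERIV_imp_deriv DERIV_G)
  then show ?case using Suc by simp
qed

lemma deriv_Lambda: "deriv (Lambda \<mu> f) = Lambda_deriv 1"
proof -
  have "Lambda \<mu> f = Lambda_deriv 0" by (intro ext) (simp add: Lambda_deriv_0)
  then show ?thesis using DERIV_imp_deriv[OF DERIV_Lambda_deriv[of 0]] by auto
qed

lemma bounded_Lambda_deriv: "\<exists>C. \<forall>u. \<bar>Lambda_deriv (Suc j) u\<bar> \<le> C"
  using bounded_L_deriv[of j] abs_Lambda_deriv_le[of "Suc j"] by metis

lemma bounded_G_deriv:
  assumes "j \<ge> 3"
  shows "\<exists>C. \<forall>s. \<bar>G_deriv B Lambda_deriv j s\<bar> \<le> C"
proof -
  obtain i where i: "j = Suc i" using assms by (cases j) auto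
  obtain C where "\<And>u. \<bar>Lambda_deriv j u\<bar> \<le> C" using bounded_Lambda_deriv[of i] i by blast
  then have "\<bar>G_deriv B Lambda_deriv j s\<bar> \<le> \<bar>B ^ j\<bar> * C" for s
    using assms by (simp add: G_deriv_def abs_mult mult_left_mono)
  then show ?thesis by blast
qed

lemma Lambda_deriv_at_0: "Lambda_deriv 0 0 = 0"
  by (simp add: Lambda_deriv_def L_fun_def)

lemma G_at_0: "G_deriv B Lambda_deriv 0 0 = 0"
  by (simp add: G_deriv_def Lambda_deriv_at_0)

lemma integrable_f_power: "integrable \<mu> (\<lambda>y. f y ^ i)"
  using f_range by (intro integrable_const_bound[of _ 1]) (auto simp: power_le_one abs_le_iff)

lemma Lambda_deriv2_at_0: "Lambda_deriv 2 0 = (\<integral>y. 4 * f y * (1 - f y) \<partial>\<mu>)"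
  unfolding Lambda_deriv_def numeral_2_eq_2
  by (intro Bochner_Integration.integral_cong refl) (simp add: tilted_mean_0 algebra_simps pderiv_pCons)

end

section \<open>Consequences of symmetry and concavity\<close>

locale concave_tilted_average = tilted_average +
  fixes a :: real
  assumes f_mean: "(\<integral>y. f y \<partial>\<mu>) = 1 / 2"
    and a_eq: "a = (\<integral>y. 4 * f y * (1 - f y) \<partial>\<mu>)" and a_pos: "a > 0"
    and even: "\<And>u. Lambda \<mu> f (- u) = Lambda \<mu> f u"
    and concave: "concave_on {0<..} (deriv (Lambda \<mu> f))"
begin

lemma Lambda_deriv1_at_0: "Lambda_deriv 1 0 = 0"
proof -
  have "Lambda_deriv 1 0 = (\<integral>y. 2 * f y - 1 \<partial>\<mu>)"
    by (simp add: Lambda_deriv_def tilted_mean_0)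
  also have "\<dots> = 2 * (\<integral>y. f y \<partial>\<mu>) - 1" using integrable_f_power[of 1] by (simp add: prob_space)
  finally show ?thesis by (simp add: f_mean)
qed

lemma Lambda_deriv2_at_0_eq: "Lambda_deriv 2 0 = a"
  unfolding Lambda_deriv2_at_0 a_eq ..

lemma Lambda_deriv_tangent:
  assumes "v > 0" "w > 0"
  shows "Lambda_deriv 1 v \<le> Lambda_deriv 1 w + Lambda_deriv 2 w * (v - w)"
proof -
  have "convex_on {0<..} (\<lambda>u. - Lambda_deriv 1 u)"
    using concave by (simp add: concave_on_def deriv_Lambda)
  moreover have "((\<lambda>u. - Lambda_deriv 1 u) has_real_derivative - Lambda_deriv 2 w) (at w within {0<..})"
    using DERIV_minus[OF DERIV_Lambda_deriv[of 1 w]]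
    by (simp add: numeral_2_eq_2 has_field_derivative_at_within)
  ultimately have "- Lambda_deriv 2 w * (v - w) \<le> - Lambda_deriv 1 v - - Lambda_deriv 1 w"
    using assms by (intro convex_on_imp_above_tangent) (auto simp: interior_open)
  then show ?thesis by simp
qed

lemma isCont_Lambda_deriv: "isCont (Lambda_deriv j) u"
  using DERIV_isCont[OF DERIV_Lambda_deriv] .

text \<open>Concavity is given on the open half-line, so the tangent at 0, of slope
  \<open>a\<close>, is reached as the limit of tangents at \<open>w\<close> tending to 0 from the
  right.\<close>

lemma Lambda_deriv1_le:
  assumes v: "v \<ge> 0"
  shows "Lambda_deriv 1 v \<le> a * v"
proof (cases "v = 0")
  case True then show ?thesis using Lambda_deriv1_at_0 by simp
next
  case False
  have "(Lambda_deriv j \<longlongrightarrow> Lambda_deriv j 0) (at_right 0)" for j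
    using isCont_Lambda_deriv[where j = j and u = 0] unfolding isCont_def by (rule tendsto_within_subset) simp
  then have "((\<lambda>w. Lambda_deriv 1 w + Lambda_deriv 2 w * (v - w)) \<longlongrightarrow>
      Lambda_deriv 1 0 + Lambda_deriv 2 0 * (v - 0)) (at_right 0)"
    by (intro tendsto_intros)
  then have "Lambda_deriv 1 v \<le> Lambda_deriv 1 0 + Lambda_deriv 2 0 * (v - 0)"
  proof (rule tendsto_lowerbound)
    show "\<forall>\<^sub>F w in at_right 0. Lambda_deriv 1 v \<le> Lambda_deriv 1 w + Lambda_deriv 2 w * (v - w)"
      using v False Lambda_deriv_tangent by (auto simp: eventually_at_filter)
  qed simp
  then show ?thesis using Lambda_deriv1_at_0 by (simp add: Lambda_deriv2_at_0_eq)
qed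

lemma Lambda_deriv_even: "Lambda_deriv 0 (- u) = Lambda_deriv 0 u"
  using even by (simp add: Lambda_deriv_0)

lemma Lambda_deriv1_odd: "Lambda_deriv 1 (- u) = - Lambda_deriv 1 u"
proof -
  have "((\<lambda>u. Lambda_deriv 0 (- u)) has_real_derivative Lambda_deriv 1 (- u) * - 1) (at u)"
    by (rule DERIV_chain2[OF DERIV_Lambda_deriv[of 0, simplified One_nat_def[symmetric]]])
       (auto intro!: derivative_eq_intros)
  then have "(Lambda_deriv 0 has_real_derivative Lambda_deriv 1 (- u) * - 1) (at u)"
    by (simp add: Lambda_deriv_even)
  from DERIV_unique[OF this DERIV_Lambda_deriv] show ?thesis by simp
qed

lemma Lambda_deriv2_even: "Lambda_deriv 2 (- u) = Lambda_deriv 2 u"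
proof -
  have "((\<lambda>u. Lambda_deriv 1 (- u)) has_real_derivative Lambda_deriv 2 (- u) * - 1) (at u)"
    by (rule DERIV_chain2[OF DERIV_Lambda_deriv[of 1, simplified Suc_1]])
       (auto intro!: derivative_eq_intros)
  then have "((\<lambda>u. - Lambda_deriv 1 u) has_real_derivative Lambda_deriv 2 (- u) * - 1) (at u)"
    unfolding Lambda_deriv1_odd .
  from DERIV_unique[OF this DERIV_minus[OF DERIV_Lambda_deriv[of 1]]]
  show ?thesis by (simp add: numeral_2_eq_2)
qed

lemma G_even: "G_deriv B Lambda_deriv 0 (- s) = G_deriv B Lambda_deriv 0 s"
  using Lambda_deriv_even[of "B * s"] by (simp add: G_deriv_def)

text \<open>The derivative of G at u is B (u - \<open>\<Lambda>\<close>'(B u)), which is nonnegative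
  because \<open>\<Lambda>\<close>' lies below its tangent at 0.\<close>

lemma G_mono:
  assumes B: "B > 0" "B * a \<le> 1" and s: "0 \<le> s" "s \<le> t"
  shows "G_deriv B Lambda_deriv 0 s \<le> G_deriv B Lambda_deriv 0 t"
proof (rule DERIV_nonneg_imp_nondecreasing[OF s(2)])
  fix u assume u: "s \<le> u" "u \<le> t"
  have "Lambda_deriv 1 (B * u) \<le> a * (B * u)" using B u s by (intro Lambda_deriv1_le) auto
  also have "\<dots> = (B * a) * u" by simp
  also have "\<dots> \<le> 1 * u" using B u s by (intro mult_right_mono) auto
  finally have "B * Lambda_deriv 1 (B * u) \<le> B * u" using B by simp
  then have "0 \<le> G_deriv B Lambda_deriv (Suc 0) u" by (simp add: G_deriv_def)
  then show "\<exists>y. (G_deriv B Lambda_deriv 0 has_real_derivative y) (at u) \<and> 0 \<le> y"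
    using DERIV_G[of B 0 u] by blast
qed

lemma G_nonneg:
  assumes "B > 0" "B * a \<le> 1"
  shows "G_deriv B Lambda_deriv 0 s \<ge> 0"
proof -
  have "G_deriv B Lambda_deriv 0 0 \<le> G_deriv B Lambda_deriv 0 \<bar>s\<bar>"
    by (rule G_mono) (use assms in auto)
  moreover have "G_deriv B Lambda_deriv 0 \<bar>s\<bar> = G_deriv B Lambda_deriv 0 s"
    using G_even[of B s] by (cases "s \<ge> 0") auto
  ultimately show ?thesis by (simp add: G_at_0)
qed

lemma G_deriv1_at_0: "G_deriv B Lambda_deriv 1 0 = 0"
  by (simp add: G_deriv_def Lambda_deriv1_at_0[simplified])

text \<open>G and G' vanish at 0 and G''(0) = B (1 - B a) is negative, so G dips below 0 next to the
  origin.\<close>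

lemma G_negative:
  assumes B: "B > 0" "B * a > 1"
  shows "\<exists>s. G_deriv B Lambda_deriv 0 s < 0"
proof -
  define F where "F j s = - G_deriv B Lambda_deriv j s" for j s
  obtain C where C: "\<And>s. \<bar>G_deriv B Lambda_deriv 3 s\<bar> \<le> C" using bounded_G_deriv[of 3 B] by auto
  have "\<exists>\<delta>>0. \<forall>h. 0 < h \<and> h < \<delta> \<longrightarrow> F 0 (0 + h) > 0"
  proof (rule leading_taylor_coefficient_pos[of F 2 C 0])
    show "(F j has_real_derivative F (Suc j) s) (at s)" for j s
      unfolding F_def[abs_def] by (intro DERIV_minus DERIV_G)
    show "\<bar>F (Suc 2) s\<bar> \<le> C" for s using C[of s] by (simp add: F_def)
    show "F j 0 = 0" if "j < 2" for j
      using that G_at_0 G_deriv1_at_0 by (cases "j = 0") (auto simp: F_def less_2_cases_iff)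
    have "B * 1 < B * (B * a)" using B by (intro mult_strict_left_mono) auto
    then show "0 < F 2 0"
      by (simp add: F_def G_deriv_def Lambda_deriv2_at_0_eq power2_eq_square)
  qed
  then obtain \<delta> where "\<delta> > 0" "\<And>h. 0 < h \<Longrightarrow> h < \<delta> \<Longrightarrow> F 0 h > 0" by auto
  from this(2)[of "\<delta> / 2"] this(1) show ?thesis by (auto simp: F_def)
qed

text \<open>The sign of G''(0) decides everything: concavity makes its nonnegativity sufficient for
  G >= 0, so the admissible \<open>\<beta>\<close> form an interval with right end 1/(J a).\<close>

lemma beta_c_eq:
  assumes J: "J > 0"
  shows "beta_c \<mu> f J = 1 / (J * a)"
proof -
  have "(\<beta> > 0 \<and> (\<forall>s. G_fun \<mu> f J \<beta> s \<ge> 0)) \<longleftrightarrow> \<beta> \<in> {0<..1 / (J * a)}" for \<beta>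
  proof (cases "\<beta> > 0")
    case True
    then have B: "\<beta> * J > 0" using J by simp
    have "\<beta> \<le> 1 / (J * a) \<longleftrightarrow> (\<beta> * J) * a \<le> 1" using J a_pos by (simp add: pos_le_divide_eq mult.assoc)
    then show ?thesis
      using True G_nonneg[OF B] G_negative[OF B] unfolding G_fun_eq_G_deriv
      by (auto simp: not_le[symmetric])
  qed auto
  then have "{\<beta>. \<beta> > 0 \<and> (\<forall>s. G_fun \<mu> f J \<beta> s \<ge> 0)} = {0<..1 / (J * a)}" by blast
  then show ?thesis using J a_pos by (simp add: beta_c_def)
qed

text \<open>A negative leading coefficient would contradict G >= 0, which settles the sign that
  \<open>has_type_strength\<close> leaves open. Strict positivity close to 0 then spreads to the
  right by monotonicity and to the left by evenness.\<close>

lemma G_critical_pos: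
  assumes B: "B > 0" "B * a = 1" and N: "N \<ge> 3"
    and zero: "\<And>j. 1 \<le> j \<Longrightarrow> j < N \<Longrightarrow> G_deriv B Lambda_deriv j 0 = 0"
    and nz: "G_deriv B Lambda_deriv N 0 \<noteq> 0"
  shows "G_deriv B Lambda_deriv N 0 > 0" and "s \<noteq> 0 \<Longrightarrow> G_deriv B Lambda_deriv 0 s > 0"
proof -
  obtain C where C: "\<And>s. \<bar>G_deriv B Lambda_deriv (Suc N) s\<bar> \<le> C" using bounded_G_deriv[of "Suc N" B] N by auto
  have zero': "G_deriv B Lambda_deriv j 0 = 0" if "j < N" for j
    using zero[of j] that G_at_0 by (cases "j = 0") auto
  show pos: "G_deriv B Lambda_deriv N 0 > 0"
  proof (rule ccontr)
    assume neg: "\<not> ?thesis"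
    define F where "F j s = - G_deriv B Lambda_deriv j s" for j s
    have "\<exists>\<delta>>0. \<forall>h. 0 < h \<and> h < \<delta> \<longrightarrow> F 0 (0 + h) > 0"
    proof (rule leading_taylor_coefficient_pos[of F N C 0])
      show "(F j has_real_derivative F (Suc j) s) (at s)" for j s
        unfolding F_def[abs_def] by (intro DERIV_minus DERIV_G)
    qed (use C zero' nz neg in \<open>auto simp: F_def\<close>)
    then obtain \<delta> where "\<delta> > 0" "\<And>h. 0 < h \<Longrightarrow> h < \<delta> \<Longrightarrow> F 0 h > 0" by auto
    from this(2)[of "\<delta> / 2"] this(1) have "G_deriv B Lambda_deriv 0 (\<delta> / 2) < 0" by (simp add: F_def)
    then show False using G_nonneg[of B "\<delta> / 2"] B by simp
  qed
  have "\<exists>\<delta>>0. \<forall>h. 0 < h \<and> h < \<delta> \<longrightarrow> G_deriv B Lambda_deriv 0 (0 + h) > 0"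
    by (rule leading_taylor_coefficient_pos[of "G_deriv B Lambda_deriv", OF DERIV_G C zero' pos])
  then obtain \<delta> where \<delta>: "\<delta> > 0" "\<And>h. 0 < h \<Longrightarrow> h < \<delta> \<Longrightarrow> G_deriv B Lambda_deriv 0 h > 0" by auto
  show "G_deriv B Lambda_deriv 0 s > 0" if s: "s \<noteq> 0"
  proof -
    define h where "h = min \<bar>s\<bar> (\<delta> / 2)"
    have "0 < h" "h < \<delta>" "h \<le> \<bar>s\<bar>" using s \<delta>(1) by (auto simp: h_def)
    then have "0 < G_deriv B Lambda_deriv 0 \<bar>s\<bar>"
      using \<delta>(2)[of h] G_mono[of B h "\<bar>s\<bar>"] B by auto
    then show ?thesis using G_even[of B s] by (cases "s \<ge> 0") auto
  qed
qed

lemma G_min_deriv: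
  assumes min: "\<And>t. G_deriv B Lambda_deriv 0 s \<le> G_deriv B Lambda_deriv 0 t"
  shows "G_deriv B Lambda_deriv 1 s = 0"
  using DERIV_local_min[OF DERIV_G[of B 0 s], of 1] min by auto

lemma G_deriv2_even: "G_deriv B Lambda_deriv 2 (- s) = G_deriv B Lambda_deriv 2 s"
  using Lambda_deriv2_even[of "B * s"] by (simp add: G_deriv_def)

text \<open>If \<open>G''(m) \<le> 0\<close> held, the tangent of the concave function \<open>\<Lambda>'\<close> at \<open>B m\<close> would keep \<open>\<Lambda>'(v) \<le> v / B\<close>
  for all small \<open>v\<close>, against \<open>\<Lambda>''(0) = a > 1 / B\<close>.\<close>

lemma G_deriv2_pos:
  assumes B: "B > 0" "B * a > 1" and m: "m > 0" and crit: "G_deriv B Lambda_deriv 1 m = 0"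
  shows "G_deriv B Lambda_deriv 2 m > 0"
proof (rule ccontr)
  assume "\<not> ?thesis"
  then have "B * 1 \<le> B * (B * Lambda_deriv 2 (B * m))"
    by (simp add: G_deriv_def power2_eq_square)
  then have 2: "1 / B \<le> Lambda_deriv 2 (B * m)" using B by (simp add: pos_divide_le_eq mult.commute)
  have 1: "Lambda_deriv 1 (B * m) = m" using crit B by (simp add: G_deriv_def)
  have le: "Lambda_deriv 1 v \<le> v / B" if v: "0 < v" "v < B * m" for v
  proof -
    have "Lambda_deriv 1 v \<le> m + Lambda_deriv 2 (B * m) * (v - B * m)"
      using Lambda_deriv_tangent[of v "B * m"] v 1 by simp
    also have "\<dots> \<le> m + 1 / B * (v - B * m)"
      using 2 v by (intro add_left_mono mult_right_mono_neg) auto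
    also have "\<dots> = v / B" using B by (simp add: field_simps)
    finally show ?thesis .
  qed
  have "((\<lambda>v. v / B - Lambda_deriv 1 v) has_real_derivative 1 / B - Lambda_deriv 2 0) (at 0)"
    using DERIV_Lambda_deriv[of 1 0] B by (intro derivative_eq_intros) (auto simp: numeral_2_eq_2)
  moreover have "1 / B - Lambda_deriv 2 0 < 0"
    using B by (simp add: Lambda_deriv2_at_0_eq pos_divide_less_eq mult.commute)
  ultimately obtain d where d: "d > 0" "\<And>h. 0 < h \<Longrightarrow> h < d \<Longrightarrow>
      (0 + h) / B - Lambda_deriv 1 (0 + h) < 0 / B - Lambda_deriv 1 0"
    using DERIV_neg_dec_right by blast
  define h where "h = min (d / 2) (B * m / 2)"
  have "0 < B * m" using B m by simp
  then have "0 < h" "h < d" "h < B * m" using d(1) by (auto simp: h_def)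
  then show False using d(2)[of h] le[of h] by (simp add: Lambda_deriv1_at_0[simplified])
qed

end

section \<open>Gibbs expectations as ratios of Laplace integrals\<close>

lemma exp_neg_even_power:
  fixes l :: real
  assumes l: "l > 0" and k: "k \<ge> 1"
  shows "integrable lborel (\<lambda>t. exp (- l * t ^ (2 * k) / fact (2 * k)))"
    and "(\<integral>t. exp (- l * t ^ (2 * k) / fact (2 * k)) \<partial>lborel) > 0"
proof -
  define c where "c = l / fact (2 * k)"
  have c: "c > 0" using l by (simp add: c_def)
  define w where "w t = exp (- c * t ^ (2 * k))" for t :: real
  have w: "w = (\<lambda>t. exp (- l * t ^ (2 * k) / fact (2 * k)))" by (rule ext) (simp add: w_def c_def)
  have "integrable lborel w"
  proof (rule Bochner_Integration.integrable_bound)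
    show "integrable lborel (\<lambda>t. exp c * exp (- c * t\<^sup>2))"
      by (intro integrable_mult_right integrable_gaussian c)
    show "AE t in lborel. norm (w t) \<le> norm (exp c * exp (- c * t\<^sup>2))"
    proof (rule AE_I2)
      fix t :: real
      have "t\<^sup>2 \<le> 1 + t ^ (2 * k)" using abs_power_le_one_plus_even_power[of 2 k t] k by simp
      then have "c * t\<^sup>2 \<le> c * (1 + t ^ (2 * k))" using c by (intro mult_left_mono) auto
      then have "- c * t ^ (2 * k) \<le> c + - c * t\<^sup>2" by (simp add: distrib_left)
      then show "norm (w t) \<le> norm (exp c * exp (- c * t\<^sup>2))" by (simp add: w_def exp_add[symmetric])
    qed
  qed (simp add: w_def[abs_def])
  then show int: "integrable lborel (\<lambda>t. exp (- l * t ^ (2 * k) / fact (2 * k)))" unfolding w .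
  have "(\<integral>t. indicator {0..1::real} t * exp (- c) \<partial>lborel) \<le> (\<integral>t. w t \<partial>lborel)"
  proof (rule integral_mono)
    show "integrable lborel (\<lambda>t. indicator {0..1::real} t * exp (- c) :: real)" by (intro integrable_mult_left integrable_real_indicator) auto
    show "indicator {0..1} t * exp (- c) \<le> w t" for t :: real
    proof (cases "t \<in> {0..1}")
      case True
      then have "c * t ^ (2 * k) \<le> c * 1" using c by (intro mult_left_mono power_le_one) auto
      then show ?thesis using True by (simp add: w_def)
    qed (simp add: w_def)
  qed (use int in \<open>simp add: w\<close>)
  then have "exp (- c) \<le> (\<integral>t. w t \<partial>lborel)" by simp
  then show "(\<integral>t. exp (- l * t ^ (2 * k) / fact (2 * k)) \<partial>lborel) > 0"
    unfolding w[symmetric] using exp_gt_zero[of "- c"] by linarith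
qed

section \<open>Test functions, their moduli and ratios of integrals\<close>

lemma cts_step_bounds:
  assumes "a < b"
  shows "\<bar>cts_step a b t\<bar> \<le> 1" and "\<bar>cts_step a b s - cts_step a b t\<bar> \<le> 1 / (b - a) * \<bar>s - t\<bar>"
proof -
  define d where "d t = (b - t) / (b - a)" for t
  \<comment> \<open>A clamped affine function; clamping does not increase distances, so the slope is
    a Lipschitz constant.\<close>
  have eq: "cts_step a b t = max 0 (min 1 (d t))" for t
    using assms by (auto simp: cts_step_def d_def max_def min_def field_simps)
  show "\<bar>cts_step a b t\<bar> \<le> 1" unfolding eq by auto
  have "\<bar>cts_step a b s - cts_step a b t\<bar> \<le> \<bar>d s - d t\<bar>" unfolding eq by linarith
  also have "d s - d t = 1 / (b - a) * (t - s)" by (simp add: d_def diff_divide_distrib[symmetric])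
  finally show "\<bar>cts_step a b s - cts_step a b t\<bar> \<le> 1 / (b - a) * \<bar>s - t\<bar>"
    using assms by (simp add: abs_mult abs_minus_commute)
qed

lemma continuous_cts_step: "a < b \<Longrightarrow> continuous_on UNIV (cts_step a b)"
  by (rule uniformly_continuous_imp_continuous[OF cts_step_uniformly_continuous])

text \<open>Close points are handled by uniform continuity on [-2, 2], where \<open>d\<close> at
  most 1 keeps \<open>z\<close>; at distance at least \<open>d\<close> the quadratic term exceeds
  the oscillation 2K.\<close>

lemma continuous_modulus:
  fixes h :: "real \<Rightarrow> real"
  assumes h: "continuous_on UNIV h" and K: "\<And>s. \<bar>h s\<bar> \<le> K" and \<epsilon>: "\<epsilon> > 0"
  obtains C where "\<And>y z. \<bar>y\<bar> \<le> 1 \<Longrightarrow> \<bar>h z - h y\<bar> \<le> \<epsilon> + C * (z - y)\<^sup>2"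
proof -
  have "uniformly_continuous_on {-2..2} h"
    by (intro compact_uniformly_continuous continuous_on_subset[OF h]) auto
  then obtain \<delta> where \<delta>: "\<delta> > 0" "\<And>y z. y \<in> {-2..2} \<Longrightarrow> z \<in> {-2..2} \<Longrightarrow> \<bar>z - y\<bar> < \<delta> \<Longrightarrow> \<bar>h z - h y\<bar> < \<epsilon>"
    using \<epsilon> unfolding uniformly_continuous_on_def dist_real_def by metis
  define d where "d = min \<delta> 1"
  have d: "d > 0" "d \<le> \<delta>" "d \<le> 1" using \<delta>(1) by (auto simp: d_def)
  have K0: "K \<ge> 0" using order_trans[OF abs_ge_zero K] .
  show thesis
  proof
    fix y z :: real assume y: "\<bar>y\<bar> \<le> 1"
    show "\<bar>h z - h y\<bar> \<le> \<epsilon> + (2 * K / d\<^sup>2) * (z - y)\<^sup>2"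
    proof (cases "\<bar>z - y\<bar> < d")
      case True
      then have "\<bar>h z - h y\<bar> < \<epsilon>" using \<delta>(2)[of y z] y d by (auto simp: abs_le_iff abs_less_iff)
      moreover have "0 \<le> (2 * K / d\<^sup>2) * (z - y)\<^sup>2" using K0 by simp
      ultimately show ?thesis by linarith
    next
      case False
      then have "d\<^sup>2 \<le> (z - y)\<^sup>2" using d power_mono[of d "\<bar>z - y\<bar>" 2] by simp
      then have "(2 * K / d\<^sup>2) * d\<^sup>2 \<le> (2 * K / d\<^sup>2) * (z - y)\<^sup>2" using K0 by (intro mult_left_mono) auto
      moreover have "(2 * K / d\<^sup>2) * d\<^sup>2 = 2 * K" using d by simp
      ultimately show ?thesis using K[of z] K[of y] \<epsilon> by linarith
    qed
  qed
qed

text \<open>\<open>F\<close> and \<open>C\<close> depend on \<open>n\<close> so that test functions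
  of the rescaled magnetization are covered: they get steeper with \<open>n\<close>, and
  \<open>C\<close> may grow as long as it is o(n).\<close>

lemma gibbs_expectation_laplace_ratio:
  fixes F :: "nat \<Rightarrow> real \<Rightarrow> real" and T :: "'a \<Rightarrow> 'a" and f :: "'a \<Rightarrow> real" and x :: 'a
  assumes f: "\<And>y. f y \<in> {0..1}" and B: "\<beta> * J > 0"
    and F: "\<And>n. F n \<in> borel_measurable borel" and bd: "\<And>n s. \<bar>F n s\<bar> \<le> K"
    and mod: "\<And>\<epsilon>. \<epsilon> > 0 \<Longrightarrow> \<exists>C. (\<forall>n y z. \<bar>y\<bar> \<le> 1 \<longrightarrow> \<bar>F n z - F n y\<bar> \<le> \<epsilon> + C n * (z - y)\<^sup>2) \<and>
      (\<lambda>n. C n / real n) \<longlonglongrightarrow> 0"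
  defines "E \<equiv> \<lambda>n s. exp (- real n * G_emp (\<lambda>i. f ((T ^^ i) x)) (\<beta> * J) n 0 s)"
  shows "(\<lambda>n. (\<integral>\<sigma>. F n (magnetization n \<sigma> / real n) \<partial>gibbs T f J \<beta> n x)
    - (\<integral>s. F n s * E n s \<partial>lborel) / (\<integral>s. E n s \<partial>lborel)) \<longlonglongrightarrow> 0"
proof (rule tendstoI)
  fix \<epsilon> :: real assume \<epsilon>: "\<epsilon> > 0"
  obtain C where C: "\<And>n y z. \<bar>y\<bar> \<le> 1 \<Longrightarrow> \<bar>F n z - F n y\<bar> \<le> \<epsilon> / 2 + C n * (z - y)\<^sup>2"
      and lim: "(\<lambda>n. C n / real n) \<longlonglongrightarrow> 0"
    using mod[of "\<epsilon> / 2"] \<epsilon> by auto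
  have "(\<lambda>n. C n / real n * (1 / (\<beta> * J))) \<longlonglongrightarrow> 0 * (1 / (\<beta> * J))"
    by (intro tendsto_mult lim tendsto_const)
  then have "\<forall>\<^sub>F n in sequentially. C n / real n * (1 / (\<beta> * J)) < \<epsilon> / 2"
    by (rule order_tendstoD) (use \<epsilon> in simp)
  then show "\<forall>\<^sub>F n in sequentially. dist ((\<integral>\<sigma>. F n (magnetization n \<sigma> / real n) \<partial>gibbs T f J \<beta> n x)
    - (\<integral>s. F n s * E n s \<partial>lborel) / (\<integral>s. E n s \<partial>lborel)) 0 < \<epsilon>"
    using eventually_ge_at_top[of 1]
  proof eventually_elim
    case (elim n)
    have "\<bar>(\<integral>\<sigma>. F n (magnetization n \<sigma> / real n) \<partial>gibbs T f J \<beta> n x)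
      - (\<integral>s. F n s * E n s \<partial>lborel) / (\<integral>s. E n s \<partial>lborel)\<bar> \<le> \<epsilon> / 2 + C n / (real n * (\<beta> * J))"
      unfolding E_def by (rule gibbs_expectation_approx[where K = K, OF f elim(2) B F bd C])
    moreover have "C n / (real n * (\<beta> * J)) < \<epsilon> / 2" using elim(1) by simp
    ultimately show ?case unfolding dist_real_def diff_0_right by linarith
  qed
qed

text \<open>Young's inequality. The Lipschitz constant enters squared, which is where the condition
  that the squared scaling factor be o(n) comes from.\<close>

lemma lipschitz_quadratic_modulus:
  fixes L :: real
  assumes "\<epsilon> > 0"
  shows "L * \<bar>u\<bar> \<le> \<epsilon> + L\<^sup>2 / (4 * \<epsilon>) * u\<^sup>2"
proof -
  have "0 \<le> (2 * \<epsilon> - L * \<bar>u\<bar>)\<^sup>2 / (4 * \<epsilon>)" using assms by simp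
  also have "\<dots> = \<epsilon> + L\<^sup>2 / (4 * \<epsilon>) * u\<^sup>2 - L * \<bar>u\<bar>"
    using assms by (simp add: power2_diff power_mult_distrib field_simps power2_eq_square)
  finally show ?thesis by simp
qed

lemma class_C_average:
  assumes "q \<in> class_C T \<mu> \<alpha>" "prob_space \<mu>"
  shows "(\<lambda>n. real n powr (1 - \<alpha>) * ((\<Sum>i=1..n. q ((T ^^ i) x)) / real n - (\<integral>y. q y \<partial>\<mu>))) \<longlonglongrightarrow> 0"
proof -
  define S where "S n = (\<Sum>i=1..n. (q ((T ^^ i) x) - (\<integral>y. q y \<partial>\<mu>)))" for n
  have "(\<lambda>n. \<bar>S n\<bar>) \<in> o(\<lambda>n. real n powr \<alpha>)" using assms(1) by (simp add: class_C_def S_def)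
  then have "(\<lambda>n. \<bar>S n\<bar> / real n powr \<alpha>) \<longlonglongrightarrow> 0" by (rule smalloD_tendsto)
  then have "(\<lambda>n. \<bar>S n / real n powr \<alpha>\<bar>) \<longlonglongrightarrow> 0" by (simp add: abs_divide)
  then have lim: "(\<lambda>n. S n / real n powr \<alpha>) \<longlonglongrightarrow> 0" by (rule tendsto_rabs_zero_cancel)
  show ?thesis
  proof (rule Lim_transform_eventually[OF lim])
    show "\<forall>\<^sub>F n in sequentially. S n / real n powr \<alpha> =
        real n powr (1 - \<alpha>) * ((\<Sum>i=1..n. q ((T ^^ i) x)) / real n - (\<integral>y. q y \<partial>\<mu>))"
      using eventually_ge_at_top[of 1]
      by eventually_elim (simp add: S_def sum_subtractf powr_diff field_simps)
  qed
qed

text \<open>The weights \<open>u\<close> and \<open>v\<close> need not converge, even after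
  normalization, so the limit is taken of a difference. Normalized weights lie in [0, 1], which
  keeps all errors small uniformly.\<close>

lemma weighted_ratio_limit:
  fixes X Y X1 Y1 u v :: "nat \<Rightarrow> real"
  assumes c: "c > 0" and X: "X \<longlonglongrightarrow> c * p" "Y \<longlonglongrightarrow> c * q" "X1 \<longlonglongrightarrow> c" "Y1 \<longlonglongrightarrow> c"
    and uv: "\<And>n. u n > 0" "\<And>n. v n > 0"
  shows "(\<lambda>n. (u n * X n + v n * Y n) / (u n * X1 n + v n * Y1 n) - (u n * p + v n * q) / (u n + v n)) \<longlonglongrightarrow> 0"
proof -
  define w where "w n = u n / (u n + v n)" for n
  define w' where "w' n = v n / (u n + v n)" for n
  have w: "\<bar>w n\<bar> \<le> 1" "\<bar>w' n\<bar> \<le> 1" and sum1: "w n + w' n = 1" for n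
    using uv[of n] by (auto simp: w_def w'_def add_divide_distrib[symmetric])
  have bz: "(\<lambda>n. z n * y n) \<longlonglongrightarrow> 0" if y: "y \<longlonglongrightarrow> 0" and z: "\<And>n. \<bar>z n\<bar> \<le> K" for z y :: "nat \<Rightarrow> real" and K
  proof (rule Lim_null_comparison)
    show "\<forall>\<^sub>F n in sequentially. norm (z n * y n) \<le> K * \<bar>y n\<bar>"
      using z by (auto simp: abs_mult mult_right_mono)
    show "(\<lambda>n. K * \<bar>y n\<bar>) \<longlonglongrightarrow> 0" using tendsto_mult[OF tendsto_const[of K] tendsto_rabs_zero[OF y]] by simp
  qed
  define N where "N n = w n * X n + w' n * Y n" for n
  define D where "D n = w n * X1 n + w' n * Y1 n" for n
  define V where "V n = w n * p + w' n * q" for n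
  have "(\<lambda>n. w n * (X n - c * p) + w' n * (Y n - c * q)) \<longlonglongrightarrow> 0 + 0"
    by (intro tendsto_add bz[where K = 1] w X[THEN LIM_zero])
  then have N: "(\<lambda>n. N n - c * V n) \<longlonglongrightarrow> 0"
    by (simp add: N_def V_def algebra_simps)
  have "(\<lambda>n. w n * (X1 n - c) + w' n * (Y1 n - c)) \<longlonglongrightarrow> 0 + 0"
    by (intro tendsto_add bz[where K = 1] w X[THEN LIM_zero])
  moreover have "w n * (X1 n - c) + w' n * (Y1 n - c) = D n - c * (w n + w' n)" for n
    by (simp add: D_def algebra_simps)
  ultimately have D: "(\<lambda>n. D n - c) \<longlonglongrightarrow> 0" by (simp add: sum1)
  have V: "\<bar>V n\<bar> \<le> \<bar>p\<bar> + \<bar>q\<bar>" for n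
  proof -
    have "\<bar>V n\<bar> \<le> \<bar>w n\<bar> * \<bar>p\<bar> + \<bar>w' n\<bar> * \<bar>q\<bar>" unfolding V_def by (metis abs_mult abs_triangle_ineq)
    also have "\<dots> \<le> 1 * \<bar>p\<bar> + 1 * \<bar>q\<bar>" by (intro add_mono mult_right_mono w) auto
    finally show ?thesis by simp
  qed
  have Dc: "D \<longlonglongrightarrow> c" using D by (rule LIM_zero_cancel)
  \<comment> \<open>This quotient is N/D - V: the two terms c V cancel in the numerator.\<close>
  have "(\<lambda>n. ((N n - c * V n) - V n * (D n - c)) / D n) \<longlonglongrightarrow> (0 - 0) / c"
    by (intro tendsto_divide tendsto_diff N bz[OF D V] Dc) (use c in simp)
  moreover have "\<forall>\<^sub>F n in sequentially. ((N n - c * V n) - V n * (D n - c)) / D n =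
      (u n * X n + v n * Y n) / (u n * X1 n + v n * Y1 n) - (u n * p + v n * q) / (u n + v n)"
    using order_tendstoD(1)[OF Dc c]
  proof eventually_elim
    case (elim n)
    have s: "u n + v n > 0" using uv[of n] by simp
    have "N n / D n = (u n * X n + v n * Y n) / (u n * X1 n + v n * Y1 n)"
    proof -
      have "N n = (u n * X n + v n * Y n) / (u n + v n)" "D n = (u n * X1 n + v n * Y1 n) / (u n + v n)"
        by (simp_all add: N_def D_def w_def w'_def add_divide_distrib)
      then show ?thesis using s by simp
    qed
    moreover have "V n = (u n * p + v n * q) / (u n + v n)"
      by (simp add: V_def w_def w'_def add_divide_distrib)
    moreover have "((N n - c * V n) - V n * (D n - c)) / D n = N n / D n - V n"
      using elim by (simp add: field_simps)
    ultimately show ?case by simp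
  qed
  ultimately show ?thesis by (simp add: tendsto_cong)
qed

lemma equivalent_seqI:
  assumes "(\<lambda>n. u n - v n) \<longlonglongrightarrow> 0"
  shows "equivalent_seq u v"
  unfolding equivalent_seq_def
proof (intro conjI impI assms)
  assume "\<exists>c>0. \<forall>\<^sub>F n in sequentially. \<bar>v n\<bar> \<ge> c"
  then obtain c where c: "c > 0" "\<forall>\<^sub>F n in sequentially. \<bar>v n\<bar> \<ge> c" by blast
  have "(\<lambda>n. (u n - v n) / v n) \<longlonglongrightarrow> 0"
  proof (rule Lim_null_comparison)
    show "\<forall>\<^sub>F n in sequentially. norm ((u n - v n) / v n) \<le> \<bar>u n - v n\<bar> / c"
      using c(2) by eventually_elim (use c(1) in \<open>auto intro: divide_left_mono\<close>)
    show "(\<lambda>n. \<bar>u n - v n\<bar> / c) \<longlonglongrightarrow> 0"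
      using tendsto_divide[OF tendsto_rabs_zero[OF assms] tendsto_const[of c]] c(1) by simp
  qed
  then have "(\<lambda>n. 1 + (u n - v n) / v n) \<longlonglongrightarrow> 1 + 0" by (intro tendsto_add tendsto_const)
  moreover have "\<forall>\<^sub>F n in sequentially. 1 + (u n - v n) / v n = u n / v n"
    using c(2) by eventually_elim (use c(1) in \<open>auto simp: field_simps\<close>)
  ultimately have "(\<lambda>n. u n / v n) \<longlonglongrightarrow> 1" by (simp add: tendsto_cong)
  then show "u \<sim>[sequentially] v" by (rule asymp_equivI')
qed

section \<open>Laplace's method along an orbit\<close>

locale empirical_average = tilted_average +
  fixes \<phi> :: "nat \<Rightarrow> real"
  assumes \<phi>_range: "\<And>i. \<phi> i \<in> {0..1}"
    and emp_conv: "\<And>j u. (\<lambda>n. emp_Lambda_deriv \<phi> n j u) \<longlonglongrightarrow> Lambda_deriv j u"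
begin

lemma G_emp_conv: "(\<lambda>n. G_emp \<phi> B n j s) \<longlonglongrightarrow> G_deriv B Lambda_deriv j s"
  unfolding G_emp_def G_deriv_def by (intro tendsto_diff tendsto_mult tendsto_const emp_conv)

lemma bounded_G_emp:
  assumes "j \<ge> 3"
  obtains C where "\<And>n s. \<bar>G_emp \<phi> B n j s\<bar> \<le> C"
proof -
  obtain i where i: "j = Suc i" using assms by (cases j) auto
  obtain C where C: "C \<ge> 0" "\<And>\<psi> u. \<psi> \<in> {0..1} \<Longrightarrow> \<bar>L_deriv j \<psi> u\<bar> \<le> C" using bounded_L_deriv[of i] i by blast
  have "\<bar>emp_Lambda_deriv \<phi> n j u\<bar> \<le> C" for n u
    using C \<phi>_range by (intro abs_emp_Lambda_deriv_le) auto
  then have "\<bar>G_emp \<phi> B n j s\<bar> \<le> \<bar>B ^ j\<bar> * C" for n s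
    using assms by (simp add: G_emp_def G_deriv_def abs_mult mult_left_mono)
  then show ?thesis using that by blast
qed

text \<open>Tilted means are at most 1 in absolute value, so the empirical \<open>\<Lambda>\<close>
  at B s has Lipschitz constant B in s, matching the quadratic coefficient B/2.\<close>

lemma G_emp_tail:
  assumes B: "B > 0" and S: "closed S" and \<delta>: "\<delta> > 0"
    and min: "\<And>s. s \<in> S \<Longrightarrow> s \<noteq> p \<Longrightarrow> G_deriv B Lambda_deriv 0 p < G_deriv B Lambda_deriv 0 s"
  shows "\<exists>\<eta>>0. \<forall>\<^sub>F n in sequentially. \<forall>s\<in>S. \<delta> \<le> \<bar>s - p\<bar> \<longrightarrow>
      G_emp \<phi> B n 0 p + \<eta> * (1 + (s - p)\<^sup>2) \<le> G_emp \<phi> B n 0 s"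
  unfolding G_emp_0
proof (rule quadratic_minus_lipschitz_tail[where h = "\<lambda>s. Lambda_deriv 0 (B * s)"])
  show "B / 2 * p\<^sup>2 - Lambda_deriv 0 (B * p) < B / 2 * s\<^sup>2 - Lambda_deriv 0 (B * s)" if "s \<in> S" "s \<noteq> p" for s
    using min[OF that] by (simp add: G_deriv_def)
  show "emp_Lambda_deriv \<phi> n 0 (B * 0) = 0" for n by (simp add: emp_Lambda_deriv_def L_fun_def)
  show "\<bar>emp_Lambda_deriv \<phi> n 0 (B * s) - emp_Lambda_deriv \<phi> n 0 (B * t)\<bar> \<le> B * \<bar>s - t\<bar>" for n s t
  proof -
    have "\<bar>emp_Lambda_deriv \<phi> n 0 (B * s) - emp_Lambda_deriv \<phi> n 0 (B * t)\<bar> \<le> 1 * \<bar>B * s - B * t\<bar>"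
      using \<phi>_range abs_tilted_mean_le
      by (intro lipschitz_from_DERIV[OF DERIV_emp_Lambda_deriv] abs_emp_Lambda_deriv_le) auto
    then show ?thesis using B by (simp add: right_diff_distrib[symmetric] abs_mult)
  qed
qed (use assms emp_conv in auto)

text \<open>\<open>S\<close> is the whole line at the critical point and a half-line above it.
  Strict minimality is asked on the closure because the gap argument of \<open>G_emp_tail\<close>
  needs a closed set, and one half-line is open.\<close>

lemma laplace_G_emp:
  assumes k: "k \<ge> 1" and B: "B > 0"
    and coeff: "\<And>j. 1 \<le> j \<Longrightarrow> j < 2 * k \<Longrightarrow>
      (\<lambda>n. real n powr (1 - real j / real (2 * k)) * G_emp \<phi> B n j p) \<longlonglongrightarrow> 0"
    and l: "G_deriv B Lambda_deriv (2 * k) p = l" "l > 0"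
    and S: "S \<in> sets borel" "p \<in> interior S"
    and min: "\<And>s. s \<in> closure S \<Longrightarrow> s \<noteq> p \<Longrightarrow> G_deriv B Lambda_deriv 0 p < G_deriv B Lambda_deriv 0 s"
    and g: "\<And>n. g n \<in> borel_measurable borel" "\<And>n t. \<bar>g n t\<bar> \<le> K" "\<And>t. (\<lambda>n. g n t) \<longlonglongrightarrow> g' t"
  shows "(\<lambda>n. real n powr (1 / real (2 * k)) * exp (real n * G_emp \<phi> B n 0 p) *
      (\<integral>s. indicator S s * g n (real n powr (1 / real (2 * k)) * (s - p)) * exp (- real n * G_emp \<phi> B n 0 s) \<partial>lborel))
    \<longlonglongrightarrow> (\<integral>t. g' t * exp (- l * t ^ (2 * k) / fact (2 * k)) \<partial>lborel)"
proof -
  obtain C where C: "\<And>n s. \<bar>G_emp \<phi> B n (2 * k + 1) s\<bar> \<le> C"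
    using bounded_G_emp[of "2 * k + 1" B] k by auto
  show ?thesis
  proof (rule laplace_asymptotics[OF k DERIV_G_emp C coeff])
    show "(\<lambda>n. G_emp \<phi> B n (2 * k) p) \<longlonglongrightarrow> l" using G_emp_conv[of B "2 * k" p] l(1) by simp
    show "\<exists>\<eta>>0. \<forall>\<^sub>F n in sequentially. \<forall>s\<in>S. \<delta> \<le> \<bar>s - p\<bar> \<longrightarrow>
      G_emp \<phi> B n 0 p + \<eta> * (1 + (s - p)\<^sup>2) \<le> G_emp \<phi> B n 0 s" if \<delta>: "\<delta> > 0" for \<delta>
    proof -
      obtain \<eta> where \<eta>: "\<eta> > 0" "\<forall>\<^sub>F n in sequentially. \<forall>s\<in>closure S. \<delta> \<le> \<bar>s - p\<bar> \<longrightarrow>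
          G_emp \<phi> B n 0 p + \<eta> * (1 + (s - p)\<^sup>2) \<le> G_emp \<phi> B n 0 s"
        using G_emp_tail[OF B closed_closure \<delta> min] by blast
      have "\<forall>\<^sub>F n in sequentially. \<forall>s\<in>S. \<delta> \<le> \<bar>s - p\<bar> \<longrightarrow>
          G_emp \<phi> B n 0 p + \<eta> * (1 + (s - p)\<^sup>2) \<le> G_emp \<phi> B n 0 s"
        using \<eta>(2) by eventually_elim (use closure_subset[of S] in blast)
      then show ?thesis using \<eta>(1) by blast
    qed
  qed (use \<phi>_range l S g in auto)
qed

end

section \<open>The limit theorems\<close>

locale ergodic_curie_weiss = concave_tilted_average \<mu> f a
  for \<mu> :: "'a::metric_space measure" and f :: "'a \<Rightarrow> real" and a :: real +
  fixes T :: "'a \<Rightarrow> 'a" and x :: 'a and J :: real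
  assumes compact_E: "compact (UNIV :: 'a set)" and T_cont: "continuous_on UNIV T"
    and ue: "uniquely_ergodic T \<mu>" and f_cont: "continuous_on UNIV f" and J_pos: "J > 0"
begin

abbreviation \<phi> :: "nat \<Rightarrow> real" where "\<phi> i \<equiv> f ((T ^^ i) x)"

sublocale empirical_average \<mu> f \<phi>
proof
  show "\<phi> i \<in> {0..1}" for i by (rule f_range)
  show "(\<lambda>n. emp_Lambda_deriv \<phi> n j u) \<longlonglongrightarrow> Lambda_deriv j u" for j u
  proof -
    have "continuous_on UNIV (\<lambda>y. L_deriv j (f y) u)"
      by (rule continuous_on_compose2[OF continuous_on_L_deriv f_cont]) (use f_range in auto)
    from uniquely_ergodic_averages[OF compact_E T_cont ue this]
    show ?thesis by (simp add: emp_Lambda_deriv_def Lambda_deriv_def)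
  qed
qed

definition E :: "real \<Rightarrow> nat \<Rightarrow> real \<Rightarrow> real" where
  "E \<beta> n s = exp (- real n * G_emp \<phi> (\<beta> * J) n 0 s)"

section \<open>The critical point\<close>

lemma critical_coefficients:
  assumes k: "k \<ge> 1"
    and classC: "\<And>j. j \<in> {1..2 * k} \<Longrightarrow> (\<lambda>y. f y ^ j) \<in> class_C T \<mu> (real j / real (2 * k))"
    and j: "1 \<le> j" "j < 2 * k" and zero: "G_deriv B Lambda_deriv j 0 = 0"
  shows "(\<lambda>n. real n powr (1 - real j / real (2 * k)) * G_emp \<phi> B n j 0) \<longlonglongrightarrow> 0"
proof -
  obtain i where i: "j = Suc i" using j by (cases j) auto
  define c where "c m = coeff (L_poly i \<circ>\<^sub>p [:-1, 2:]) m" for m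
  define d where "d n m = (\<Sum>i=1..n. \<phi> i ^ m) / real n - (\<integral>y. f y ^ m \<partial>\<mu>)" for n m
  have L: "L_deriv j \<psi> 0 = (\<Sum>m\<le>j. c m * \<psi> ^ m)" for \<psi> unfolding i L_deriv_0 c_def ..
  have lim: "(\<lambda>n. real n powr (1 - real j / real (2 * k)) * d n m) \<longlonglongrightarrow> 0" if m: "m \<le> j" for m
  \<comment> \<open>The class assumptions start at exponent 1; the constant term needs none, as its
    average is exact for n >= 1.\<close>
  proof (cases "m = 0")
    case True
    have "\<forall>\<^sub>F n in sequentially. 0 = real n powr (1 - real j / real (2 * k)) * d n m"
      using eventually_ge_at_top[of 1] by eventually_elim (simp add: True d_def prob_space)
    then show ?thesis by (rule Lim_transform_eventually[OF tendsto_const])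
  next
    case False
    \<comment> \<open>Lower powers come with a better rate: for m <= j the factor n^(1 - m/(2k)) is
      at least n^(1 - j/(2k)).\<close>
    have "(\<lambda>n. real n powr (1 - real m / real (2 * k)) * d n m) \<longlonglongrightarrow> 0"
      unfolding d_def using False m j by (intro class_C_average classC prob_space_axioms) auto
    then have "(\<lambda>n. \<bar>real n powr (1 - real m / real (2 * k)) * d n m\<bar>) \<longlonglongrightarrow> 0" by (rule tendsto_rabs_zero)
    moreover have "\<forall>\<^sub>F n in sequentially. norm (real n powr (1 - real j / real (2 * k)) * d n m)
        \<le> \<bar>real n powr (1 - real m / real (2 * k)) * d n m\<bar>"
      using eventually_ge_at_top[of 1]
    proof eventually_elim
      case (elim n)
      have "real n powr (1 - real j / real (2 * k)) \<le> real n powr (1 - real m / real (2 * k))"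
        using elim m by (intro powr_mono) (auto simp: divide_right_mono)
      then show ?case by (simp add: abs_mult mult_right_mono)
    qed
    ultimately show ?thesis by (rule Lim_null_comparison[rotated])
  qed
  have "(\<lambda>n. - (B ^ j) * (\<Sum>m\<le>j. c m * (real n powr (1 - real j / real (2 * k)) * d n m))) \<longlonglongrightarrow>
      - (B ^ j) * (\<Sum>m\<le>j. c m * 0)"
    by (intro tendsto_mult tendsto_const tendsto_sum lim) simp
  moreover have "real n powr (1 - real j / real (2 * k)) * G_emp \<phi> B n j 0 =
      - (B ^ j) * (\<Sum>m\<le>j. c m * (real n powr (1 - real j / real (2 * k)) * d n m))" for n
  proof -
    have "Lambda_deriv j 0 = (\<Sum>m\<le>j. c m * (\<integral>y. f y ^ m \<partial>\<mu>))"
      unfolding Lambda_deriv_def L using integrable_f_power by simp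
    moreover have "emp_Lambda_deriv \<phi> n j 0 = (\<Sum>m\<le>j. c m * ((\<Sum>i=1..n. \<phi> i ^ m) / real n))"
    proof -
      have "(\<Sum>i=1..n. \<Sum>m\<le>j. c m * \<phi> i ^ m) = (\<Sum>m\<le>j. c m * (\<Sum>i=1..n. \<phi> i ^ m))"
        unfolding sum_distrib_left by (rule sum.swap)
      then have "emp_Lambda_deriv \<phi> n j 0 = (\<Sum>m\<le>j. c m * (\<Sum>i=1..n. \<phi> i ^ m)) / real n"
        unfolding emp_Lambda_deriv_def L by (rule arg_cong)
      then show ?thesis by (simp only: sum_divide_distrib[of _ "{..j}"] times_divide_eq_right)
    qed
    ultimately have "emp_Lambda_deriv \<phi> n j 0 - Lambda_deriv j 0 = (\<Sum>m\<le>j. c m * d n m)"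
      by (simp add: d_def sum_subtractf[symmetric] right_diff_distrib)
    \<comment> \<open>G and its empirical version share the quadratic part, so a vanishing
      derivative of G leaves only the deviation of the averages.\<close>
    moreover have "G_emp \<phi> B n j 0 = - (B ^ j) * (emp_Lambda_deriv \<phi> n j 0 - Lambda_deriv j 0)"
      using zero unfolding G_emp_def G_deriv_def by (simp add: algebra_simps)
    ultimately show ?thesis by (simp add: sum_distrib_left mult_ac)
  qed
  ultimately show ?thesis by simp
qed

lemma G_emp_at_0: "G_emp \<phi> B n 0 0 = 0"
  by (simp add: G_emp_0 emp_Lambda_deriv_def L_fun_def)

text \<open>Both limit laws in one statement: \<open>\<rho>\<close> = 1 and \<open>\<theta>\<close>
  = 0 give M_n/n, while \<open>\<rho>\<close> = n^(1/(2k)) and \<open>\<theta>\<close> = 1 give the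
  fluctuations. The condition that \<open>\<rho>\<close>^2 be o(n) makes the Gaussian smearing
  negligible at the chosen scale.\<close>

lemma critical_expectation_limit:
  assumes k: "k \<ge> 2"
    and type: "has_type_strength (G_fun \<mu> f J (beta_c \<mu> f J)) 0 (2 * k) l"
    and classC: "\<And>j. j \<in> {1..2 * k} \<Longrightarrow> (\<lambda>y. f y ^ j) \<in> class_C T \<mu> (real j / real (2 * k))"
    and \<rho>: "(\<lambda>n. (\<rho> n)\<^sup>2 / real n) \<longlonglongrightarrow> 0" "(\<lambda>n. \<rho> n / real n powr (1 / real (2 * k))) \<longlonglongrightarrow> \<theta>"
    and uv: "u < v"
  defines "w \<equiv> \<lambda>t. exp (- l * t ^ (2 * k) / fact (2 * k))"
  shows "l > 0" and "(\<lambda>n. \<integral>\<sigma>. cts_step u v (\<rho> n * (magnetization n \<sigma> / real n)) \<partial>gibbs T f J (beta_c \<mu> f J) n x)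
    \<longlonglongrightarrow> (\<integral>t. cts_step u v (\<theta> * t) * w t \<partial>lborel) / (\<integral>t. w t \<partial>lborel)"
proof -
  define \<beta> where "\<beta> = beta_c \<mu> f J"
  define B where "B = \<beta> * J"
  have "\<beta> = 1 / (J * a)" unfolding \<beta>_def by (rule beta_c_eq[OF J_pos])
  then have B: "B > 0" "B * a = 1" using J_pos a_pos by (auto simp: B_def)
  have zero: "G_deriv B Lambda_deriv j 0 = 0" if "1 \<le> j" "j < 2 * k" for j
    using type that unfolding has_type_strength_def higher_deriv_G_fun \<beta>_def[symmetric] B_def by blast
  have nz: "G_deriv B Lambda_deriv (2 * k) 0 \<noteq> 0" "G_deriv B Lambda_deriv (2 * k) 0 = l"
    using type unfolding has_type_strength_def higher_deriv_G_fun \<beta>_def[symmetric] B_def by auto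
  have k3: "2 * k \<ge> 3" and k1: "k \<ge> 1" using k by auto
  have crit: "G_deriv B Lambda_deriv (2 * k) 0 > 0" "\<And>s. s \<noteq> 0 \<Longrightarrow> G_deriv B Lambda_deriv 0 s > 0"
    using G_critical_pos[OF B k3 _ nz(1)] zero by blast+
  show l: "l > 0" using crit(1) nz(2) by simp
  define \<kappa> where "\<kappa> = 1 / real (2 * k)"
  define r where "r n = real n powr \<kappa>" for n :: nat
  have laplace: "(\<lambda>n. r n * (\<integral>s. g n (r n * s) * E \<beta> n s \<partial>lborel)) \<longlonglongrightarrow> (\<integral>t. g' t * w t \<partial>lborel)"
    if g: "\<And>n. g n \<in> borel_measurable borel" "\<And>n t. \<bar>g n t\<bar> \<le> 1" "\<And>t. (\<lambda>n. g n t) \<longlonglongrightarrow> g' t" for g g'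
  proof -
    have "(\<lambda>n. real n powr (1 / real (2 * k)) * exp (real n * G_emp \<phi> B n 0 0) *
        (\<integral>s. indicator UNIV s * g n (real n powr (1 / real (2 * k)) * (s - 0)) * exp (- real n * G_emp \<phi> B n 0 s) \<partial>lborel))
      \<longlonglongrightarrow> (\<integral>t. g' t * exp (- l * t ^ (2 * k) / fact (2 * k)) \<partial>lborel)"
    proof (rule laplace_G_emp[OF k1 B(1) _ nz(2) l])
      show "(\<lambda>n. real n powr (1 - real j / real (2 * k)) * G_emp \<phi> B n j 0) \<longlonglongrightarrow> 0" if "1 \<le> j" "j < 2 * k" for j
        by (rule critical_coefficients[OF k1 classC that zero[OF that]])
      show "G_deriv B Lambda_deriv 0 0 < G_deriv B Lambda_deriv 0 s" if "s \<noteq> 0" for s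
        using crit(2)[OF that] by (simp add: G_at_0)
    qed (use g in auto)
    then show ?thesis by (simp add: G_emp_at_0 r_def \<kappa>_def w_def E_def B_def)
  qed
  have wpos: "(\<integral>t. w t \<partial>lborel) > 0" unfolding w_def using exp_neg_even_power(2)[OF l k1] .
  define F where "F n s = cts_step u v (\<rho> n * s)" for n s
  have contF: "continuous_on UNIV (\<lambda>s. cts_step u v (c * s))" for c
    by (rule continuous_on_compose2[OF continuous_cts_step[OF uv]]) (auto intro!: continuous_intros)
  note Fm = borel_measurable_continuous_onI[OF contF]
  \<comment> \<open>Writing \<open>\<rho> n * s\<close> as a multiple of \<open>r n * s\<close> puts
    the test function in the Laplace variable.\<close>
  have "(\<lambda>n. r n * (\<integral>s. cts_step u v (\<rho> n / r n * (r n * s)) * E \<beta> n s \<partial>lborel)) \<longlonglongrightarrow> (\<integral>t. cts_step u v (\<theta> * t) * w t \<partial>lborel)"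
  proof (rule laplace[of "\<lambda>n t. cts_step u v (\<rho> n / r n * t)"])
    show "(\<lambda>n. cts_step u v (\<rho> n / r n * t)) \<longlonglongrightarrow> cts_step u v (\<theta> * t)" for t
    proof (rule isCont_tendsto_compose[where g = "cts_step u v"])
      show "isCont (cts_step u v) (\<theta> * t)"
        using continuous_cts_step[OF uv] by (simp add: continuous_on_eq_continuous_at)
      show "(\<lambda>n. \<rho> n / r n * t) \<longlonglongrightarrow> \<theta> * t" unfolding r_def \<kappa>_def by (intro tendsto_intros \<rho>(2))
    qed
  qed (rule Fm cts_step_bounds(1)[OF uv])+
  moreover have "(\<lambda>n. r n * (\<integral>s. 1 * E \<beta> n s \<partial>lborel)) \<longlonglongrightarrow> (\<integral>t. 1 * w t \<partial>lborel)"
    by (rule laplace[of "\<lambda>_ _. 1"]) auto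
  ultimately have "(\<lambda>n. (r n * (\<integral>s. cts_step u v (\<rho> n / r n * (r n * s)) * E \<beta> n s \<partial>lborel)) / (r n * (\<integral>s. 1 * E \<beta> n s \<partial>lborel)))
      \<longlonglongrightarrow> (\<integral>t. cts_step u v (\<theta> * t) * w t \<partial>lborel) / (\<integral>t. 1 * w t \<partial>lborel)"
    using wpos by (intro tendsto_divide) auto
  moreover have "\<forall>\<^sub>F n in sequentially.
      (r n * (\<integral>s. cts_step u v (\<rho> n / r n * (r n * s)) * E \<beta> n s \<partial>lborel)) / (r n * (\<integral>s. 1 * E \<beta> n s \<partial>lborel)) =
      (\<integral>s. F n s * E \<beta> n s \<partial>lborel) / (\<integral>s. E \<beta> n s \<partial>lborel)"
    using eventually_ge_at_top[of 1]
  proof eventually_elim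
    case (elim n)
    then have "r n > 0" by (simp add: r_def)
    then show ?case by (simp add: F_def)
  qed
  ultimately have ratio: "(\<lambda>n. (\<integral>s. F n s * E \<beta> n s \<partial>lborel) / (\<integral>s. E \<beta> n s \<partial>lborel))
      \<longlonglongrightarrow> (\<integral>t. cts_step u v (\<theta> * t) * w t \<partial>lborel) / (\<integral>t. w t \<partial>lborel)"
    by (simp add: tendsto_cong)
  have "(\<lambda>n. (\<integral>\<sigma>. F n (magnetization n \<sigma> / real n) \<partial>gibbs T f J \<beta> n x)
    - (\<integral>s. F n s * exp (- real n * G_emp \<phi> (\<beta> * J) n 0 s) \<partial>lborel) / (\<integral>s. exp (- real n * G_emp \<phi> (\<beta> * J) n 0 s) \<partial>lborel)) \<longlonglongrightarrow> 0"
  proof (rule gibbs_expectation_laplace_ratio[OF f_range])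
    show "\<beta> * J > 0" using B by (simp add: B_def)
    show "F n \<in> borel_measurable borel" for n unfolding F_def[abs_def] by (rule Fm)
    show "\<bar>F n s\<bar> \<le> 1" for n s unfolding F_def by (rule cts_step_bounds(1)[OF uv])
    fix \<epsilon> :: real assume \<epsilon>: "\<epsilon> > 0"
    \<comment> \<open>The Lipschitz constant of \<open>F n\<close> is the slope 1/(v - u) times
      \<open>\<bar>\<rho> n\<bar>\<close>.\<close>
    define C where "C n = (1 / (v - u) * \<bar>\<rho> n\<bar>)\<^sup>2 / (4 * \<epsilon>)" for n
    have "\<bar>F n z - F n y\<bar> \<le> \<epsilon> + C n * (z - y)\<^sup>2" for n y z
    proof -
      have "\<bar>F n z - F n y\<bar> \<le> 1 / (v - u) * \<bar>\<rho> n * z - \<rho> n * y\<bar>"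
        unfolding F_def by (rule cts_step_bounds(2)[OF uv])
      also have "\<dots> = 1 / (v - u) * \<bar>\<rho> n\<bar> * \<bar>z - y\<bar>" by (simp add: right_diff_distrib[symmetric] abs_mult)
      also have "\<dots> \<le> \<epsilon> + C n * (z - y)\<^sup>2" unfolding C_def by (rule lipschitz_quadratic_modulus[OF \<epsilon>])
      finally show ?thesis .
    qed
    moreover have "(\<lambda>n. C n / real n) \<longlonglongrightarrow> 0"
    proof -
      have "(\<lambda>n. (1 / (v - u))\<^sup>2 / (4 * \<epsilon>) * ((\<rho> n)\<^sup>2 / real n)) \<longlonglongrightarrow> (1 / (v - u))\<^sup>2 / (4 * \<epsilon>) * 0"
        by (intro tendsto_mult tendsto_const \<rho>(1))
      then show ?thesis by (simp add: C_def power_mult_distrib power_divide mult_ac)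
    qed
    ultimately show "\<exists>C. (\<forall>n y z. \<bar>y\<bar> \<le> 1 \<longrightarrow> \<bar>F n z - F n y\<bar> \<le> \<epsilon> + C n * (z - y)\<^sup>2) \<and> (\<lambda>n. C n / real n) \<longlonglongrightarrow> 0"
      by blast
  qed
  from tendsto_add[OF this[folded E_def] ratio]
  show "(\<lambda>n. \<integral>\<sigma>. cts_step u v (\<rho> n * (magnetization n \<sigma> / real n)) \<partial>gibbs T f J (beta_c \<mu> f J) n x)
    \<longlonglongrightarrow> (\<integral>t. cts_step u v (\<theta> * t) * w t \<partial>lborel) / (\<integral>t. w t \<partial>lborel)"
    by (simp add: F_def \<beta>_def)
qed

lemma real_distribution_gibbs:
  assumes "\<beta> * J \<ge> 0"
  shows "real_distribution (distr (gibbs T f J \<beta> n x) borel g)"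
  by (rule prob_space.real_distribution_distr[OF prob_space_gibbs[OF f_range assms]])
     (simp add: gibbs_def)

lemma integral_distr_gibbs:
  "h \<in> borel_measurable borel \<Longrightarrow> (\<integral>z. h z \<partial>distr (gibbs T f J \<beta> n x) borel g) = (\<integral>\<sigma>. h (g \<sigma>) \<partial>gibbs T f J \<beta> n x)"
  for h g :: "_ \<Rightarrow> real"
  by (rule integral_distr) (simp_all add: gibbs_def)

text \<open>Ramps suffice for weak convergence on the line, and being Lipschitz they keep a
  controlled modulus when their argument is stretched by n^(1/(2k)).\<close>

lemma critical_weak_conv:
  assumes k: "k \<ge> 2"
    and type: "has_type_strength (G_fun \<mu> f J (beta_c \<mu> f J)) 0 (2 * k) l"
    and classC: "\<And>j. j \<in> {1..2 * k} \<Longrightarrow> (\<lambda>y. f y ^ j) \<in> class_C T \<mu> (real j / real (2 * k))"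
  shows "weak_conv_m (\<lambda>n. distr (gibbs T f J (beta_c \<mu> f J) n x) borel (\<lambda>\<sigma>. magnetization n \<sigma> / real n)) (return borel 0)"
    and "weak_conv_m (\<lambda>n. distr (gibbs T f J (beta_c \<mu> f J) n x) borel
           (\<lambda>\<sigma>. magnetization n \<sigma> / real n powr (1 - 1 / real (2 * k)))) (limit_Z k l)"
proof -
  define \<beta> where "\<beta> = beta_c \<mu> f J"
  define \<kappa> where "\<kappa> = 1 / real (2 * k)"
  \<comment> \<open>Here the type enters: 2k >= 4 gives 2/(2k) < 1, so the fluctuation scale
    dominates the Gaussian width. With k = 1 both would be of the same order.\<close>
  have \<kappa>: "\<kappa> > 0" "2 * \<kappa> < 1" using k by (auto simp: \<kappa>_def field_simps)
  have k1: "k \<ge> 1" using k by simp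
  have \<beta>J: "\<beta> * J \<ge> 0" using beta_c_eq[OF J_pos] J_pos a_pos by (simp add: \<beta>_def)
  define w where "w t = exp (- l * t ^ (2 * k) / fact (2 * k))" for t
  have inv_n: "(\<lambda>n. 1 / real n) \<longlonglongrightarrow> 0" by (rule lim_1_over_n)
  have neg: "(\<lambda>n. real n powr - s) \<longlonglongrightarrow> 0" if "s > 0" for s
    using that by (intro tendsto_neg_powr filterlim_real_sequentially) auto
  have 0: "(\<lambda>n. 1\<^sup>2 / real n) \<longlonglongrightarrow> 0" "(\<lambda>n. 1 / real n powr (1 / real (2 * k))) \<longlonglongrightarrow> 0"
    using inv_n neg[OF \<kappa>(1)] unfolding powr_minus_divide \<kappa>_def by simp_all
  \<comment> \<open>Positivity of the strength does not depend on the ramp; 0 and 1 are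
    placeholders.\<close>
  have l: "l > 0" using critical_expectation_limit(1)[OF k type classC 0, of 0 1] by simp
  have wi: "integrable lborel w" and wpos: "(\<integral>t. w t \<partial>lborel) > 0"
    unfolding w_def[abs_def] using exp_neg_even_power[OF l k1] by auto
  have w0: "w t \<ge> 0" for t by (simp add: w_def)
  have ctsm: "cts_step u v \<in> borel_measurable borel" if "u < v" for u v
    using continuous_cts_step[OF that] by (rule borel_measurable_continuous_onI)
  interpret R: real_distribution "return borel (0::real)"
    by (auto simp: real_distribution_def real_distribution_axioms_def intro: prob_space_return)
  show "weak_conv_m (\<lambda>n. distr (gibbs T f J (beta_c \<mu> f J) n x) borel (\<lambda>\<sigma>. magnetization n \<sigma> / real n)) (return borel 0)"
  proof (rule integral_cts_step_conv_imp_weak_conv)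
    show "real_distribution (distr (gibbs T f J (beta_c \<mu> f J) n x) borel (\<lambda>\<sigma>. magnetization n \<sigma> / real n))" for n
      using real_distribution_gibbs[OF \<beta>J] by (simp add: \<beta>_def)
    fix u v :: real assume uv: "u < v"
    \<comment> \<open>With \<open>\<theta>\<close> = 0 the ramp is frozen at its value at 0, so the
      ratio is its integral against the point mass.\<close>
    have "(\<lambda>n. \<integral>\<sigma>. cts_step u v (1 * (magnetization n \<sigma> / real n)) \<partial>gibbs T f J (beta_c \<mu> f J) n x)
      \<longlonglongrightarrow> (\<integral>t. cts_step u v (0 * t) * w t \<partial>lborel) / (\<integral>t. w t \<partial>lborel)"
      unfolding w_def by (rule critical_expectation_limit(2)[OF k type classC 0 uv])
    then show "(\<lambda>n. integral\<^sup>L (distr (gibbs T f J (beta_c \<mu> f J) n x) borel (\<lambda>\<sigma>. magnetization n \<sigma> / real n)) (cts_step u v))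
        \<longlonglongrightarrow> integral\<^sup>L (return borel 0) (cts_step u v)"
      using wpos ctsm[OF uv] by (simp add: integral_distr_gibbs integral_return)
  qed (rule R.real_distribution_axioms)
  have Z: "limit_Z k l = density lborel (\<lambda>s. ennreal (1 / (\<integral>t. w t \<partial>lborel) * w s))"
    by (simp add: limit_Z_def Let_def w_def[abs_def])
  have intZ: "(\<integral>s. h s \<partial>limit_Z k l) = (\<integral>s. h s * w s \<partial>lborel) / (\<integral>t. w t \<partial>lborel)"
    if "h \<in> borel_measurable borel" for h :: "real \<Rightarrow> real"
  proof -
    have "(\<integral>s. h s \<partial>limit_Z k l) = (\<integral>s. (1 / (\<integral>t. w t \<partial>lborel) * w s) *\<^sub>R h s \<partial>lborel)"
      unfolding Z using that wpos by (intro integral_density) (auto simp: w_def)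
    then show ?thesis by (simp add: mult.commute)
  qed
  have Zd: "real_distribution (limit_Z k l)"
  proof -
    have "emeasure (limit_Z k l) (space (limit_Z k l)) = (\<integral>\<^sup>+s. ennreal (1 / (\<integral>t. w t \<partial>lborel) * w s) \<partial>lborel)"
      unfolding Z by (subst emeasure_density) (auto simp: w_def[abs_def])
    also have "\<dots> = ennreal (\<integral>s. 1 / (\<integral>t. w t \<partial>lborel) * w s \<partial>lborel)"
      by (rule nn_integral_eq_integral[OF integrable_mult_right[OF wi]]) (use wpos w0 in simp)
    also have "\<dots> = 1" using wpos by simp
    finally show ?thesis
      by (auto simp: real_distribution_def real_distribution_axioms_def Z intro: prob_spaceI)
  qed
  have \<kappa>lim: "(\<lambda>n. (real n powr \<kappa>)\<^sup>2 / real n) \<longlonglongrightarrow> 0" "(\<lambda>n. real n powr \<kappa> / real n powr (1 / real (2 * k))) \<longlonglongrightarrow> 1"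
  proof -
    have ev: "\<forall>\<^sub>F n in sequentially. real n powr - (1 - 2 * \<kappa>) = (real n powr \<kappa>)\<^sup>2 / real n"
      using eventually_ge_at_top[of 1]
      by eventually_elim (simp add: powr_power powr_diff mult.commute)
    have "(\<lambda>n. real n powr - (1 - 2 * \<kappa>)) \<longlonglongrightarrow> 0" by (rule neg) (use \<kappa>(2) in simp)
    from Lim_transform_eventually[OF this ev] show "(\<lambda>n. (real n powr \<kappa>)\<^sup>2 / real n) \<longlonglongrightarrow> 0" .
    have "\<forall>\<^sub>F n in sequentially. 1 = real n powr \<kappa> / real n powr (1 / real (2 * k))"
      using eventually_ge_at_top[of 1] by eventually_elim (simp add: \<kappa>_def)
    then show "(\<lambda>n. real n powr \<kappa> / real n powr (1 / real (2 * k))) \<longlonglongrightarrow> 1"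
      by (rule Lim_transform_eventually[OF tendsto_const])
  qed
  show "weak_conv_m (\<lambda>n. distr (gibbs T f J (beta_c \<mu> f J) n x) borel
           (\<lambda>\<sigma>. magnetization n \<sigma> / real n powr (1 - 1 / real (2 * k)))) (limit_Z k l)"
  proof (rule integral_cts_step_conv_imp_weak_conv[OF _ Zd])
    show "real_distribution (distr (gibbs T f J (beta_c \<mu> f J) n x) borel (\<lambda>\<sigma>. magnetization n \<sigma> / real n powr (1 - 1 / real (2 * k))))" for n
      using real_distribution_gibbs[OF \<beta>J] by (simp add: \<beta>_def)
    fix u v :: real assume uv: "u < v"
    have "(\<lambda>n. \<integral>\<sigma>. cts_step u v (real n powr \<kappa> * (magnetization n \<sigma> / real n)) \<partial>gibbs T f J (beta_c \<mu> f J) n x)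
      \<longlonglongrightarrow> (\<integral>t. cts_step u v (1 * t) * w t \<partial>lborel) / (\<integral>t. w t \<partial>lborel)"
      unfolding w_def by (rule critical_expectation_limit(2)[OF k type classC \<kappa>lim uv])
    moreover have "\<forall>\<^sub>F n in sequentially.
        (\<integral>\<sigma>. cts_step u v (real n powr \<kappa> * (magnetization n \<sigma> / real n)) \<partial>gibbs T f J (beta_c \<mu> f J) n x) =
        integral\<^sup>L (distr (gibbs T f J (beta_c \<mu> f J) n x) borel (\<lambda>\<sigma>. magnetization n \<sigma> / real n powr (1 - 1 / real (2 * k)))) (cts_step u v)"
      using eventually_ge_at_top[of 1]
    proof eventually_elim
      case (elim n)
      then have "real n powr \<kappa> * (m / real n) = m / real n powr (1 - 1 / real (2 * k))" for m
        by (simp add: \<kappa>_def powr_diff)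
      then show ?case using ctsm[OF uv] by (simp add: integral_distr_gibbs)
    qed
    ultimately show "(\<lambda>n. integral\<^sup>L (distr (gibbs T f J (beta_c \<mu> f J) n x) borel
           (\<lambda>\<sigma>. magnetization n \<sigma> / real n powr (1 - 1 / real (2 * k)))) (cts_step u v))
        \<longlonglongrightarrow> integral\<^sup>L (limit_Z k l) (cts_step u v)"
      using intZ[OF ctsm[OF uv]] by (simp add: tendsto_cong)
  qed
qed

section \<open>Above the critical value\<close>

lemma supercritical_coefficient:
  assumes classC: "(\<lambda>y. dL_ds (f y) (B * p)) \<in> class_C T \<mu> (1 / 2)" and crit: "G_deriv B Lambda_deriv 1 p = 0"
  shows "(\<lambda>n. real n powr (1 / 2) * G_emp \<phi> B n 1 p) \<longlonglongrightarrow> 0"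
proof -
  have "(\<lambda>n. real n powr (1 - 1 / 2) * ((\<Sum>i=1..n. dL_ds (\<phi> i) (B * p)) / real n - (\<integral>y. dL_ds (f y) (B * p) \<partial>\<mu>))) \<longlonglongrightarrow> 0"
    by (rule class_C_average[OF classC prob_space_axioms])
  then have "(\<lambda>n. real n powr (1 / 2) * (emp_Lambda_deriv \<phi> n 1 (B * p) - Lambda_deriv 1 (B * p))) \<longlonglongrightarrow> 0"
    unfolding dL_ds_eq[OF f_range] emp_Lambda_deriv_def Lambda_deriv_def by simp
  then have "(\<lambda>n. - B * (real n powr (1 / 2) * (emp_Lambda_deriv \<phi> n 1 (B * p) - Lambda_deriv 1 (B * p)))) \<longlonglongrightarrow> - B * 0"
    by (intro tendsto_mult tendsto_const)
  moreover have "real n powr (1 / 2) * G_emp \<phi> B n 1 p =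
      - B * (real n powr (1 / 2) * (emp_Lambda_deriv \<phi> n 1 (B * p) - Lambda_deriv 1 (B * p)))" for n
  proof -
    have "G_emp \<phi> B n 1 p = - B * (emp_Lambda_deriv \<phi> n 1 (B * p) - Lambda_deriv 1 (B * p))"
      using crit unfolding G_emp_def G_deriv_def by (simp add: algebra_simps)
    then show ?thesis by (simp add: mult_ac)
  qed
  ultimately show ?thesis by simp
qed

lemma b_weight_pos: "b_weight T f J \<beta> x p n > 0"
  unfolding b_weight_def by (intro prod_pos) (use L_arg_bounds(3)[OF f_range] in auto)

text \<open>The origin of the weights b: the prefactor depends on \<open>p\<^sup>2\<close> only, so
  it is common to m and -m and drops out of ratios.\<close>

lemma exp_G_emp_eq_b_weight:
  assumes "n \<ge> 1"
  shows "exp (- real n * G_emp \<phi> (\<beta> * J) n 0 p) = exp (- real n * (\<beta> * J / 2 * p\<^sup>2)) * b_weight T f J \<beta> x p n"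
proof -
  have "b_weight T f J \<beta> x p n = exp (real n * emp_Lambda_deriv \<phi> n 0 (\<beta> * J * p))"
    unfolding b_weight_def by (rule prod_eq_exp_emp_Lambda[OF f_range assms])
  then show ?thesis by (simp add: exp_add[symmetric] G_emp_0 algebra_simps)
qed

text \<open>The line is cut at 0, so that each half contains one minimum point and Laplace's method
  with k = 1 applies to it. The equal second derivatives give both halves the same constant
  \<open>c\<close>, and the values exp(-n G_n) at m and -m survive as the weights.\<close>

lemma supercritical_equivalence:
  assumes \<beta>: "\<beta> > beta_c \<mu> f J" and m: "m > 0"
    and gmin: "global_min_points (G_fun \<mu> f J \<beta>) = {m, - m}"
    and classC: "(\<lambda>y. dL_ds (f y) (\<beta> * J * m)) \<in> class_C T \<mu> (1 / 2)"
      "(\<lambda>y. dL_ds (f y) (- (\<beta> * J * m))) \<in> class_C T \<mu> (1 / 2)"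
    and h: "continuous_on UNIV h" "bounded (range h)"
  shows "equivalent_seq
            (\<lambda>n. \<integral>\<sigma>. h (magnetization n \<sigma> / real n) \<partial>(gibbs T f J \<beta> n x))
            (\<lambda>n. (b_weight T f J \<beta> x m n * h m + b_weight T f J \<beta> x (- m) n * h (- m)) /
                  (b_weight T f J \<beta> x m n + b_weight T f J \<beta> x (- m) n))"
proof (rule equivalent_seqI)
  define B where "B = \<beta> * J"
  define G where "G = G_deriv B Lambda_deriv"
  have "1 / (J * a) < \<beta>" using \<beta> beta_c_eq[OF J_pos] by simp
  then have B: "B > 0" "B * a > 1"
  proof -
    assume b: "1 / (J * a) < \<beta>"
    have "0 < 1 / (J * a)" using J_pos a_pos by simp
    then have "\<beta> > 0" using b by (rule less_trans)
    then show "B > 0" using J_pos by (simp add: B_def)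
    show "B * a > 1" using b J_pos a_pos by (simp add: B_def pos_divide_less_eq mult.assoc)
  qed
  have G0: "G_fun \<mu> f J \<beta> = G 0" by (simp add: G_def B_def G_fun_eq_G_deriv)
  have min: "G 0 s \<le> G 0 t" if "s \<in> {m, - m}" for s t
    using that gmin unfolding global_min_points_def G0 by blast
  have strict: "G 0 s < G 0 t" if s: "s \<in> {m, - m}" and t: "t \<notin> {m, - m}" for s t
  proof -
    obtain t' where "\<not> G 0 t \<le> G 0 t'" using t gmin unfolding global_min_points_def G0 by blast
    then show ?thesis using min[OF s, of t'] by linarith
  qed
  have crit: "G 1 m = 0" "G 1 (- m) = 0"
    unfolding G_def by (rule G_min_deriv, use min in \<open>simp add: G_def\<close>)+
  define l where "l = G 2 m"
  have l: "l > 0" unfolding l_def G_def by (rule G_deriv2_pos[OF B m crit(1)[unfolded G_def]])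
  define w where "w t = exp (- l * t ^ (2 * 1) / fact (2 * 1))" for t
  define c where "c = (\<integral>t. w t \<partial>lborel)"
  have c: "c > 0" unfolding c_def w_def using exp_neg_even_power(2)[OF l, of 1] by simp
  define r where "r n = real n powr (1 / real (2 * 1))" for n :: nat
  define q where "q p n = exp (real n * G_emp \<phi> B n 0 p)" for p n
  have coeff: "(\<lambda>n. real n powr (1 - real j / real (2 * 1)) * G_emp \<phi> B n j p) \<longlonglongrightarrow> 0"
    if p: "p \<in> {m, - m}" and j: "1 \<le> j" "j < 2 * 1" for p j
  proof -
    have "(\<lambda>y. dL_ds (f y) (B * p)) \<in> class_C T \<mu> (1 / 2)" using p classC by (auto simp: B_def)
    moreover have "G_deriv B Lambda_deriv 1 p = 0" using p crit by (auto simp: G_def)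
    ultimately have "(\<lambda>n. real n powr (1 / 2) * G_emp \<phi> B n 1 p) \<longlonglongrightarrow> 0" by (rule supercritical_coefficient)
    moreover have "j = 1" using j by simp
    ultimately show ?thesis by simp
  qed
  \<comment> \<open>\<open>g\<close> is a function of \<open>s\<close> itself. In the Laplace
    variable t it reads g(p + t/r), which tends to the constant g(p).\<close>
  have laplace: "(\<lambda>n. r n * q p n * (\<integral>s. indicator S s * g s * E \<beta> n s \<partial>lborel)) \<longlonglongrightarrow> c * g p"
    if p: "p \<in> {m, - m}" and S: "S \<in> sets borel" "p \<in> interior S" "- p \<notin> closure S"
      and g: "continuous_on UNIV g" and K: "\<And>s. \<bar>g s\<bar> \<le> K" for p S g K
  proof -
    have gm: "(\<lambda>t. g (p + t / d)) \<in> borel_measurable borel" for d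
      by (intro borel_measurable_continuous_onI continuous_on_compose2[OF g]) (auto simp: divide_inverse intro!: continuous_intros)
    have "(\<lambda>n. real n powr (1 / real (2 * 1)) * exp (real n * G_emp \<phi> B n 0 p) *
        (\<integral>s. indicator S s * g (p + real n powr (1 / real (2 * 1)) * (s - p) / r n) * exp (- real n * G_emp \<phi> B n 0 s) \<partial>lborel))
      \<longlonglongrightarrow> (\<integral>t. g p * exp (- l * t ^ (2 * 1) / fact (2 * 1)) \<partial>lborel)"
    proof (rule laplace_G_emp[where g = "\<lambda>n t. g (p + t / r n)", OF _ B(1) coeff[OF p]])
      show "G_deriv B Lambda_deriv (2 * 1) p = l"
        using p G_deriv2_even[of B m] by (auto simp: l_def G_def)
      show "G_deriv B Lambda_deriv 0 p < G_deriv B Lambda_deriv 0 s" if "s \<in> closure S" "s \<noteq> p" for s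
      proof -
        have "s \<notin> {m, - m}" using that p S(3) by auto
        then show ?thesis using strict[OF p] by (simp add: G_def)
      qed
      show "(\<lambda>n. g (p + t / r n)) \<longlonglongrightarrow> g p" for t
      proof (rule isCont_tendsto_compose[where g = g])
        show "isCont g p" using g by (simp add: continuous_on_eq_continuous_at)
        have "(\<lambda>n. t * real n powr - (1 / 2)) \<longlonglongrightarrow> t * 0"
          by (intro tendsto_intros tendsto_neg_powr filterlim_real_sequentially) auto
        then have "(\<lambda>n. t / r n) \<longlonglongrightarrow> 0" by (simp add: r_def powr_minus_divide)
        from tendsto_add[OF tendsto_const[of p] this] show "(\<lambda>n. p + t / r n) \<longlonglongrightarrow> p" by simp
      qed
    qed (use l S gm K in simp_all)
    then have "(\<lambda>n. r n * q p n * (\<integral>s. indicator S s * g (p + r n * (s - p) / r n) * E \<beta> n s \<partial>lborel)) \<longlonglongrightarrow> c * g p"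
      by (simp add: r_def q_def E_def B_def c_def w_def mult.commute)
    moreover have "\<forall>\<^sub>F n in sequentially. r n * q p n * (\<integral>s. indicator S s * g (p + r n * (s - p) / r n) * E \<beta> n s \<partial>lborel) =
        r n * q p n * (\<integral>s. indicator S s * g s * E \<beta> n s \<partial>lborel)"
      using eventually_ge_at_top[of 1] by eventually_elim (simp add: r_def)
    ultimately show ?thesis by (rule Lim_transform_eventually)
  qed
  obtain K where K: "\<And>s. \<bar>h s\<bar> \<le> K" using h(2) by (auto simp: bounded_iff)
  define I where "I S g n = (\<integral>s. indicator S s * g s * E \<beta> n s \<partial>lborel)" for S :: "real set" and g :: "real \<Rightarrow> real" and n
  \<comment> \<open>The closures meet only at 0, so neither contains the opposite minimum
    point.\<close>
  have Sp: "{0::real..} \<in> sets borel" "m \<in> interior {0..}" "- m \<notin> closure {0..}"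
    and Sm: "{..<0::real} \<in> sets borel" "- m \<in> interior {..<0}" "- (- m) \<notin> closure {..<0}"
    using m by (auto simp: interior_open)
  have X: "(\<lambda>n. r n * q m n * I {0..} g n) \<longlonglongrightarrow> c * g m" "(\<lambda>n. r n * q (- m) n * I {..<0} g n) \<longlonglongrightarrow> c * g (- m)"
    if "continuous_on UNIV g" "\<And>s. \<bar>g s\<bar> \<le> K'" for g K'
    unfolding I_def using laplace[OF _ Sp that] laplace[OF _ Sm that] by auto
  have X1: "(\<lambda>n. r n * q m n * I {0..} (\<lambda>_. 1) n) \<longlonglongrightarrow> c" "(\<lambda>n. r n * q (- m) n * I {..<0} (\<lambda>_. 1) n) \<longlonglongrightarrow> c"
    using X[of "\<lambda>_. 1" 1] by auto
  have split: "(\<integral>s. g s * E \<beta> n s \<partial>lborel) = I {0..} g n + I {..<0} g n"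
    if g: "continuous_on UNIV g" "\<And>s. \<bar>g s\<bar> \<le> K'" and n: "n \<ge> 1" for g K' n
  proof -
    have gm: "g \<in> borel_measurable borel" using g(1) by (rule borel_measurable_continuous_onI)
    have int: "integrable lborel (\<lambda>s. g s * E \<beta> n s)"
      unfolding E_def by (rule hubbard_stratonovich(2)[OF f_range n _ gm g(2)]) (use B in \<open>simp add: B_def\<close>)
    have int': "integrable lborel (\<lambda>s. indicator S s * (g s * E \<beta> n s))" if "S \<in> sets borel" for S
      using integrable_mult_indicator[OF _ int, of S] that by simp
    have "(\<integral>s. g s * E \<beta> n s \<partial>lborel) =
        (\<integral>s. indicator {0..} s * (g s * E \<beta> n s) + indicator {..<0} s * (g s * E \<beta> n s) \<partial>lborel)"
      by (intro Bochner_Integration.integral_cong refl) (auto simp: indicator_def)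
    also have "\<dots> = I {0..} g n + I {..<0} g n"
      unfolding I_def using int'[OF Sp(1)] int'[OF Sm(1)] by (simp add: mult.assoc)
    finally show ?thesis .
  qed
  define bp bm where "bp n = b_weight T f J \<beta> x m n" and "bm n = b_weight T f J \<beta> x (- m) n" for n
  have b: "bp n > 0" "bm n > 0" for n by (auto simp: bp_def bm_def b_weight_pos)
  have ratio: "(\<lambda>n. (\<integral>s. h s * E \<beta> n s \<partial>lborel) / (\<integral>s. E \<beta> n s \<partial>lborel) -
      (bp n * h m + bm n * h (- m)) / (bp n + bm n)) \<longlonglongrightarrow> 0"
  proof (rule Lim_transform_eventually[OF weighted_ratio_limit[OF c X[OF h(1) K] X1 b]])
    show "\<forall>\<^sub>F n in sequentially.
        (bp n * (r n * q m n * I {0..} h n) + bm n * (r n * q (- m) n * I {..<0} h n)) /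
        (bp n * (r n * q m n * I {0..} (\<lambda>_. 1) n) + bm n * (r n * q (- m) n * I {..<0} (\<lambda>_. 1) n)) -
        (bp n * h m + bm n * h (- m)) / (bp n + bm n) =
        (\<integral>s. h s * E \<beta> n s \<partial>lborel) / (\<integral>s. E \<beta> n s \<partial>lborel) -
        (bp n * h m + bm n * h (- m)) / (bp n + bm n)"
      using eventually_ge_at_top[of 1]
    proof eventually_elim
      case (elim n)
      define e where "e = exp (- real n * (B / 2 * m\<^sup>2))"
      have e: "e > 0" by (simp add: e_def)
      have "e * bp n = exp (- real n * G_emp \<phi> B n 0 m)" "e * bm n = exp (- real n * G_emp \<phi> B n 0 (- m))"
        unfolding B_def exp_G_emp_eq_b_weight[OF elim] by (simp_all add: e_def bp_def bm_def B_def)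
      then have "e * bp n * q m n = 1" "e * bm n * q (- m) n = 1"
        by (simp_all add: q_def exp_add[symmetric])
      \<comment> \<open>Both products have the same value 1/e, so the weighted half-line integrals
        recombine into a multiple of the full integral and the multiple cancels in the
        ratio.\<close>
      then have bq: "bp n * q m n = 1 / e" "bm n * q (- m) n = 1 / e" using e by (auto simp: field_simps)
      have r: "r n > 0" using elim by (simp add: r_def)
      have comb: "bp n * (r n * q m n * I {0..} g n) + bm n * (r n * q (- m) n * I {..<0} g n) =
          r n / e * (\<integral>s. g s * E \<beta> n s \<partial>lborel)"
        if "continuous_on UNIV g" "\<And>s. \<bar>g s\<bar> \<le> K'" for g K'
      proof -
        have "bp n * (r n * q m n * I {0..} g n) + bm n * (r n * q (- m) n * I {..<0} g n) =
            r n * (bp n * q m n) * I {0..} g n + r n * (bm n * q (- m) n) * I {..<0} g n" by (simp add: mult_ac)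
        then show ?thesis unfolding bq split[OF that elim] by (simp add: distrib_left)
      qed
      show ?case unfolding comb[OF h(1) K] comb[of "\<lambda>_. 1" 1, simplified] using r e by simp
    qed
  qed
  have "(\<lambda>n. (\<integral>\<sigma>. h (magnetization n \<sigma> / real n) \<partial>gibbs T f J \<beta> n x)
    - (\<integral>s. h s * E \<beta> n s \<partial>lborel) / (\<integral>s. E \<beta> n s \<partial>lborel)) \<longlonglongrightarrow> 0"
    unfolding E_def
  proof (rule gibbs_expectation_laplace_ratio[OF f_range, of \<beta> J "\<lambda>_. h" K])
    show "\<beta> * J > 0" using B by (simp add: B_def)
    show "h \<in> borel_measurable borel" using h(1) by (rule borel_measurable_continuous_onI)
    fix \<epsilon> :: real assume "\<epsilon> > 0"
    then obtain C where "\<And>y z. \<bar>y\<bar> \<le> 1 \<Longrightarrow> \<bar>h z - h y\<bar> \<le> \<epsilon> + C * (z - y)\<^sup>2"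
      using continuous_modulus[OF h(1) K] by blast
    then show "\<exists>C. (\<forall>n::nat. \<forall>y z. \<bar>y\<bar> \<le> 1 \<longrightarrow> \<bar>h z - h y\<bar> \<le> \<epsilon> + C n * (z - y)\<^sup>2) \<and> (\<lambda>n. C n / real n) \<longlonglongrightarrow> 0"
      by (intro exI[of _ "\<lambda>_. C"]) (auto intro: lim_const_over_n)
  qed (rule K)
  from tendsto_add[OF this ratio]
  show "(\<lambda>n. (\<integral>\<sigma>. h (magnetization n \<sigma> / real n) \<partial>(gibbs T f J \<beta> n x)) -
      (b_weight T f J \<beta> x m n * h m + b_weight T f J \<beta> x (- m) n * h (- m)) /
      (b_weight T f J \<beta> x m n + b_weight T f J \<beta> x (- m) n)) \<longlonglongrightarrow> 0"
    by (simp add: bp_def bm_def)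
qed

end

theorem theorem4p3:
  fixes T :: "'a::metric_space \<Rightarrow> 'a" and \<mu> :: "'a measure" and f :: "'a \<Rightarrow> real"
    and x :: 'a and J a :: real
  assumes compact_E: "compact (UNIV :: 'a set)"
    and T_cont: "continuous_on UNIV T"
    and ue: "uniquely_ergodic T \<mu>"
    and f_cont: "continuous_on UNIV f"
    and f_range: "\<And>y. f y \<in> {0..1}"
    and f_mean: "(\<integral>y. f y \<partial>\<mu>) = 1 / 2"
    and a_eq: "a = (\<integral>y. 4 * f y * (1 - f y) \<partial>\<mu>)"
    and a_pos: "a > 0"
    and J_pos: "J > 0"
    and Lambda_even: "\<And>u. Lambda \<mu> f (- u) = Lambda \<mu> f u"
    and Lambda_deriv_concave: "concave_on {0<..} (deriv (Lambda \<mu> f))"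
  shows
    "(\<forall>k l. 2 * k \<ge> 4 \<longrightarrow>
        has_type_strength (G_fun \<mu> f J (beta_c \<mu> f J)) 0 (2 * k) l \<longrightarrow>
        (\<forall>j\<in>{1..2 * k}. (\<lambda>y. f y ^ j) \<in> class_C T \<mu> (real j / real (2 * k))) \<longrightarrow>
          weak_conv_m
            (\<lambda>n. distr (gibbs T f J (beta_c \<mu> f J) n x) borel
                   (\<lambda>\<sigma>. magnetization n \<sigma> / real n))
            (return borel 0) \<and>
          weak_conv_m
            (\<lambda>n. distr (gibbs T f J (beta_c \<mu> f J) n x) borel
                   (\<lambda>\<sigma>. magnetization n \<sigma> / real n powr (1 - 1 / real (2 * k))))
            (limit_Z k l))
     \<and>
     (\<forall>\<beta> m. \<beta> > beta_c \<mu> f J \<longrightarrow> m > 0 \<longrightarrow>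
        global_min_points (G_fun \<mu> f J \<beta>) = {m, - m} \<longrightarrow>
        (\<lambda>y. dL_ds (f y) (\<beta> * J * m)) \<in> class_C T \<mu> (1 / 2) \<longrightarrow>
        (\<lambda>y. dL_ds (f y) (- (\<beta> * J * m))) \<in> class_C T \<mu> (1 / 2) \<longrightarrow>
        (\<forall>h :: real \<Rightarrow> real. continuous_on UNIV h \<longrightarrow> bounded (range h) \<longrightarrow>
          equivalent_seq
            (\<lambda>n. \<integral>\<sigma>. h (magnetization n \<sigma> / real n) \<partial>(gibbs T f J \<beta> n x))
            (\<lambda>n. (b_weight T f J \<beta> x m n * h m + b_weight T f J \<beta> x (- m) n * h (- m)) /
                  (b_weight T f J \<beta> x m n + b_weight T f J \<beta> x (- m) n))))"
proof -
  have \<mu>: "prob_space \<mu>" "sets \<mu> = sets borel"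
    using ue by (auto simp: uniquely_ergodic_def invariant_prob_def)
  have "f \<in> borel_measurable \<mu>"
    using borel_measurable_continuous_onI[OF f_cont] measurable_cong_sets[OF \<mu>(2) refl] by blast
  then interpret ergodic_curie_weiss \<mu> f a T x J
    using assms \<mu>(1)
    by (intro ergodic_curie_weiss.intro concave_tilted_average.intro tilted_average.intro
        tilted_average_axioms.intro concave_tilted_average_axioms.intro ergodic_curie_weiss_axioms.intro) auto
  show ?thesis
  proof (intro conjI allI impI ballI)
    fix k l
    assume k: "4 \<le> 2 * k" and type: "has_type_strength (G_fun \<mu> f J (beta_c \<mu> f J)) 0 (2 * k) l"
      and C: "\<forall>j\<in>{1..2 * k}. (\<lambda>y. f y ^ j) \<in> class_C T \<mu> (real j / real (2 * k))"
    note wc = critical_weak_conv[OF _ type bspec[OF C]]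
    show "weak_conv_m (\<lambda>n. distr (gibbs T f J (beta_c \<mu> f J) n x) borel (\<lambda>\<sigma>. magnetization n \<sigma> / real n)) (return borel 0)"
      by (rule wc(1)) (use k in simp)
    show "weak_conv_m (\<lambda>n. distr (gibbs T f J (beta_c \<mu> f J) n x) borel
        (\<lambda>\<sigma>. magnetization n \<sigma> / real n powr (1 - 1 / real (2 * k)))) (limit_Z k l)"
      by (rule wc(2)) (use k in simp)
  qed (rule supercritical_equivalence)
qed

end
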